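(* Assume: $F:C_\mu\to H$ is globally Lipschitz continuous, with constants $\bar C_F\ge0$, $C_F>0$ such that $|F(x)|\le\bar C_F+C_F\|x\|_\mu$ for $x\in C_\mu$; $G$ maps $C_\mu$ into $L(U;D((-A)^\nu))$ for some $\nu\in(0,1)$, is Lipschitz continuous with values in that space, and satisfies $\|G(x)\|_{L(U;D((-A)^\nu))}\le C_{G,\nu}$ for all $x\in C_\mu$; there is a Lipschitz continuous $K:C_\mu\to L(U;H)$ with $\|K(x)\|_{L(U;H)}\le C_K$ for all $x\in C_\mu$, such that for every $T>0$ and $u\in C([-\mu,T];H)$ the mapping $t\mapsto G(u_t)$ is in $C^1([0,T];L(U;H))$ with $\frac{d}{dt}G(u_t)=K(u_t)$; and $$\mu<\frac1\lambda\log\Big(\frac{\lambda}{C_F}\Big).$$ Then the random dynamical system $\phi$ on $C_\mu$ generated by the global mild solutions, $\phi(t,\omega,\xi)=u_t$, has a random attractor.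
   Context: $H$ and $U$ are separable Hilbert spaces with norms $|\cdot|$ and $|\cdot|_U$. Fix $\mu>0$; $C_\mu=C([-\mu,0];H)$ with sup norm $\|\cdot\|_\mu$. For a continuous $H$-valued function $u$ on $[-\mu,T]$ or $[-\mu,\infty)$ and $t\ge0$ in its domain, $u_t\in C_\mu$ is defined by $u_t(s)=u(t+s)$, $s\in[-\mu,0]$. $-A$ is a strictly positive symmetric (self-adjoint) operator on $H$ with compact inverse, and $A$ generates an analytic $C_0$-semigroup $S=(S(t))_{t\ge0}$ on $H$. $D((-A)^\gamma)$, $\gamma\ge0$, are the domains of the fractional powers with their usual norms. The number $\lambda>0$ is such that for $t>0$ (constants normalized to $1$): $|S(t)|\le e^{-\lambda t}$; $|(-A)^\gamma S(t)|_{L(H)}\le t^{-\gamma}e^{-\lambda t}$ for $\gamma\in[0,1)$; $|S(t)-\mathrm{id}|_{L(D((-A)^\sigma),D((-A)^\theta))}\le t^{\sigma-\theta}$ for $\theta\ge0$, $\sigma\in[\theta,1+\theta]$. Noise: $C_0(\mathbb{R};U)$ is the space of continuous functions $\mathbb{R}\to U$ vanishing at $0$ with the compact-open topology, carrying the Wiener measure $\mathbb{P}$ with trace-class covariance operator $Q$; $\theta_t\omega(\cdot)=\omega(\cdot+t)-\omega(t)$ is the Wiener shift. Fix $\beta\in(0,1/2)$. $\Omega$ is a fixed $(\theta_t)$-invariant measurable set of full measure consisting of $\omega\in C_0(\mathbb{R};U)$ with finite $\beta$-Hölder seminorm on every $[-k,k]$, $k\in\mathbb{N}$, and such that for every $\omega\in\Omega$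 and $a<0$, $\lim_{t\to\pm\infty}\frac1{|t|}\sup_{a\le s\le0}|\theta_t\omega(s)|_U=0$ (such a set exists). $\mathcal{F}$ is the trace Borel $\sigma$-algebra on $\Omega$, and $\mathbb{P}$ is restricted to it. Random dynamical system: under the stated hypotheses, for every $\xi\in C_\mu$, $\omega\in\Omega$ there is exactly one $u\in C([-\mu,\infty);H)$ (global mild solution) with $u=\xi$ on $[-\mu,0]$ and, for $t\ge0$, $u(t)=S(t)\xi(0)+\int_0^tS(t-r)F(u_r)dr+\int_0^tAS(t-r)G(u_r)\omega(r)dr+G(u_t)\omega(t)-\int_0^tS(t-r)K(u_r)\omega(r)dr$ (the pathwise mild form of $du=(Au+F(u_t))dt+G(u_t)dW$). The map $\phi(t,\omega,\xi)=u_t$ is measurable, continuous in $\xi$, and satisfies $\phi(0,\omega,\xi)=\xi$, $\phi(t+\tau,\omega,\xi)=\phi(t,\theta_\tau\omega,\phi(\tau,\omega,\xi))$. $\mathcal{D}$ is the collection of families $D=(D(\omega))_{\omega\in\Omega}$ of nonempty closed sets $D(\omega)\subset C_\mu$ such that $\omega\mapsto\inf_{x\in D(\omega)}\|x-y\|_\mu$ is a random variable for every $y\in C_\mu$ and $\lim_{t\to\pm\infty}\frac{1}{|t|}\log^+\sup_{x\in D(\theta_t\omega)}\|x\|_\mu=0$ for all $\omega\in\Omega$ (convention $\log^+0=0$). A random attractor for $\phi$ is a family $\mathcal{A}=(\mathcal{A}(\omega))_{\omega\in\Omega}\in\mathcal{D}$ with $\mathcal{A}(\omega)$ compact, $\phi(t,\omega,\mathcal{A}(\omega))=\mathcal{A}(\theta_t\omega)$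 for all $\omega\in\Omega$, $t\ge0$, and $\lim_{t\to\infty}\mathrm{dist}_{C_\mu}(\phi(t,\theta_{-t}\omega,D(\theta_{-t}\omega)),\mathcal{A}(\omega))=0$ for all $D\in\mathcal{D}$, $\omega\in\Omega$, where $\mathrm{dist}_{C_\mu}(X,Y)=\sup_{x\in X}\inf_{y\in Y}\|x-y\|_\mu$ is the Hausdorff semidistance. *)

theory Defs
  imports "HOL-Probability.Probability"
begin

text \<open>Separable real Hilbert spaces are types of sort
  \<open>{real_inner, banach, second_countable_topology}\<close>.\<close>

section \<open>Self-adjoint operators with compact inverse and their fractional powers\<close>

text \<open>An unbounded operator is given by a domain \<open>D\<close> and a function whose values outside \<open>D\<close>
  are irrelevant.\<close>

definition linear_operator_on :: "'h::real_vector set \<Rightarrow> ('h \<Rightarrow> 'h) \<Rightarrow> bool" where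
  "linear_operator_on D B \<longleftrightarrow> subspace D \<and>
     (\<forall>x\<in>D. \<forall>y\<in>D. B (x + y) = B x + B y) \<and> (\<forall>c. \<forall>x\<in>D. B (c *\<^sub>R x) = c *\<^sub>R B x)"

text \<open>The last conjunct says that the domain of the adjoint is contained in \<open>D\<close>.\<close>

definition selfadjoint_on :: "'h::real_inner set \<Rightarrow> ('h \<Rightarrow> 'h) \<Rightarrow> bool" where
  "selfadjoint_on D B \<longleftrightarrow> linear_operator_on D B \<and> closure D = UNIV \<and>
     (\<forall>x\<in>D. \<forall>y\<in>D. inner (B x) y = inner x (B y)) \<and>
     (\<forall>y. (\<exists>z. \<forall>x\<in>D. inner (B x) y = inner x z) \<longrightarrow> y \<in> D)"

definition strictly_positive_on :: "'h::real_inner set \<Rightarrow> ('h \<Rightarrow> 'h) \<Rightarrow> bool" where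
  "strictly_positive_on D B \<longleftrightarrow> (\<forall>x\<in>D. x \<noteq> 0 \<longrightarrow> inner (B x) x > 0)"

definition compact_operator :: "('a::real_normed_vector \<Rightarrow>\<^sub>L 'b::real_normed_vector) \<Rightarrow> bool" where
  "compact_operator T \<longleftrightarrow> (\<forall>X. bounded X \<longrightarrow> compact (closure (blinfun_apply T ` X)))"

definition has_compact_inverse :: "'h::real_normed_vector set \<Rightarrow> ('h \<Rightarrow> 'h) \<Rightarrow> bool" where
  "has_compact_inverse D B \<longleftrightarrow>
     (\<exists>T :: 'h \<Rightarrow>\<^sub>L 'h. compact_operator T \<and>
        (\<forall>y. T y \<in> D \<and> B (T y) = y) \<and> (\<forall>x\<in>D. T (B x) = x))"

definition orthonormal_basis :: "'h::real_inner set \<Rightarrow> bool" where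
  "orthonormal_basis E \<longleftrightarrow>
     pairwise orthogonal E \<and> (\<forall>e\<in>E. norm e = 1) \<and> closure (span E) = UNIV"

definition eigenbasis :: "'h::real_inner set \<Rightarrow> ('h \<Rightarrow> 'h) \<Rightarrow> 'h set \<Rightarrow> bool" where
  "eigenbasis D B E \<longleftrightarrow>
     orthonormal_basis E \<and> E \<subseteq> D \<and> (\<forall>e\<in>E. \<exists>l::real. B e = l *\<^sub>R e)"

text \<open>Fractional powers by the spectral expansion; the eigenvalue belonging to a normalized
  eigenvector \<open>e\<close> is \<open>inner (B e) e\<close>. A strictly positive self-adjoint operator with compact
  inverse has an eigenbasis, and the domain and the values below do not depend on which one is
  chosen.\<close>

definition some_eigenbasis :: "'h::real_inner set \<Rightarrow> ('h \<Rightarrow> 'h) \<Rightarrow> 'h set" where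
  "some_eigenbasis D B = (SOME E. eigenbasis D B E)"

definition frac_dom :: "'h::real_inner set \<Rightarrow> ('h \<Rightarrow> 'h) \<Rightarrow> real \<Rightarrow> 'h set" where
  "frac_dom D B \<gamma> =
     {x. (\<lambda>e. (inner (B e) e powr \<gamma> * inner x e)\<^sup>2) summable_on some_eigenbasis D B}"

definition frac_pow :: "'h::real_inner set \<Rightarrow> ('h \<Rightarrow> 'h) \<Rightarrow> real \<Rightarrow> 'h \<Rightarrow> 'h" where
  "frac_pow D B \<gamma> x =
     (\<Sum>\<^sub>\<infinity>e\<in>some_eigenbasis D B. (inner (B e) e powr \<gamma> * inner x e) *\<^sub>R e)"

text \<open>Bounded operators \<open>V \<rightarrow> D(B\<^sup>\<gamma>)\<close> and their norm, where \<open>D(B\<^sup>\<gamma>)\<close> carries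
  the norm \<open>x \<mapsto> norm (B\<^sup>\<gamma> x)\<close>. For \<open>B\<close> with bounded inverse such operators are also
  bounded as operators into \<open>H\<close>, so nothing is lost by taking \<open>T\<close> in \<open>'v \<Rightarrow>\<^sub>L 'h\<close>.\<close>

definition bounded_into_frac ::
  "'h::real_inner set \<Rightarrow> ('h \<Rightarrow> 'h) \<Rightarrow> real \<Rightarrow> ('v::real_normed_vector \<Rightarrow>\<^sub>L 'h) \<Rightarrow> bool" where
  "bounded_into_frac D B \<gamma> T \<longleftrightarrow>
     range (blinfun_apply T) \<subseteq> frac_dom D B \<gamma> \<and> bounded_linear (\<lambda>v. frac_pow D B \<gamma> (T v))"

definition frac_opnorm ::
  "'h::real_inner set \<Rightarrow> ('h \<Rightarrow> 'h) \<Rightarrow> real \<Rightarrow> ('v::real_normed_vector \<Rightarrow>\<^sub>L 'h) \<Rightarrow> real" where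
  "frac_opnorm D B \<gamma> T = onorm (\<lambda>v. frac_pow D B \<gamma> (T v))"

section \<open>Semigroups\<close>

definition C0_semigroup :: "(real \<Rightarrow> 'h::real_normed_vector \<Rightarrow>\<^sub>L 'h) \<Rightarrow> bool" where
  "C0_semigroup S \<longleftrightarrow> S 0 = id_blinfun \<and>
     (\<forall>s\<ge>0. \<forall>t\<ge>0. S (s + t) = S s o\<^sub>L S t) \<and>
     (\<forall>x. ((\<lambda>t. S t x) \<longlongrightarrow> x) (at_right 0))"

text \<open>The graph of the infinitesimal generator.\<close>

definition generator_graph :: "(real \<Rightarrow> 'h::real_normed_vector \<Rightarrow>\<^sub>L 'h) \<Rightarrow> ('h \<times> 'h) set" where
  "generator_graph S = {(x, y). ((\<lambda>t. (S t x - x) /\<^sub>R t) \<longlongrightarrow> y) (at_right 0)}"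

definition sector :: "real \<Rightarrow> complex set" where
  "sector \<delta> = {z. z \<noteq> 0 \<and> \<bar>Arg z\<bar> < \<delta>}"

text \<open>An analytic semigroup on a real space: the complexified semigroup extends to a holomorphic
  semigroup \<open>z \<mapsto> X z + \<i> * Y z\<close> on a sector, strongly continuous at \<open>0\<close>.  A complex-linear
  operator on the complexification is written through its real part \<open>X z\<close> and imaginary part
  \<open>Y z\<close>, and holomorphy (in operator norm) through the Cauchy-Riemann equations.\<close>

definition analytic_semigroup :: "(real \<Rightarrow> 'h::real_normed_vector \<Rightarrow>\<^sub>L 'h) \<Rightarrow> bool" where
  "analytic_semigroup S \<longleftrightarrow> C0_semigroup S \<and>
     (\<exists>\<delta> X Y. 0 < \<delta> \<and> \<delta> \<le> pi / 2 \<and>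
        (\<forall>t>0. X (complex_of_real t) = S t \<and> Y (complex_of_real t) = 0) \<and>
        (\<forall>z\<in>sector \<delta>. \<forall>w\<in>sector \<delta>.
           X (z + w) = (X z o\<^sub>L X w) - (Y z o\<^sub>L Y w) \<and>
           Y (z + w) = (X z o\<^sub>L Y w) + (Y z o\<^sub>L X w)) \<and>
        (\<forall>x. ((\<lambda>z. X z x) \<longlongrightarrow> x) (at 0 within sector \<delta>) \<and>
             ((\<lambda>z. Y z x) \<longlongrightarrow> 0) (at 0 within sector \<delta>)) \<and>
        (\<forall>z\<in>sector \<delta>. \<exists>a b.
           (X has_derivative (\<lambda>h. Re h *\<^sub>R a - Im h *\<^sub>R b)) (at z) \<and>
           (Y has_derivative (\<lambda>h. Re h *\<^sub>R b + Im h *\<^sub>R a)) (at z)))"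

text \<open>The standing estimates with decay rate \<open>lam\<close> and all constants normalized to \<open>1\<close>, for
  the semigroup generated by \<open>A\<close>; the fractional powers are those of \<open>-A\<close>.\<close>

definition semigroup_estimates ::
  "'h::real_inner set \<Rightarrow> ('h \<Rightarrow> 'h) \<Rightarrow> (real \<Rightarrow> 'h \<Rightarrow>\<^sub>L 'h) \<Rightarrow> real \<Rightarrow> bool" where
  "semigroup_estimates D A S lam \<longleftrightarrow>
     (\<forall>t>0. norm (S t) \<le> exp (- lam * t)) \<and>
     (\<forall>t>0. \<forall>\<gamma>\<in>{0..<1}.
        bounded_into_frac D (\<lambda>x. - A x) \<gamma> (S t) \<and>
        frac_opnorm D (\<lambda>x. - A x) \<gamma> (S t) \<le> t powr (- \<gamma>) * exp (- lam * t)) \<and>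
     (\<forall>t>0. \<forall>\<theta>\<ge>0. \<forall>\<sigma>\<in>{\<theta>..1 + \<theta>}. \<forall>x\<in>frac_dom D (\<lambda>x. - A x) \<sigma>.
        S t x - x \<in> frac_dom D (\<lambda>x. - A x) \<theta> \<and>
        norm (frac_pow D (\<lambda>x. - A x) \<theta> (S t x - x))
          \<le> t powr (\<sigma> - \<theta>) * norm (frac_pow D (\<lambda>x. - A x) \<sigma> x))"

section \<open>The space of histories\<close>

text \<open>\<open>C([-\<mu>,0];H)\<close> with the sup norm is represented isometrically by the closed subspace of
  those bounded continuous functions on the real line that are constant on \<open>{..-\<mu>}\<close> and on
  \<open>{0..}\<close>.\<close>

definition Cmu :: "real \<Rightarrow> (real \<Rightarrow>\<^sub>C 'h::real_normed_vector) set" where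
  "Cmu \<mu> = {x. \<forall>s. apply_bcontfun x s = apply_bcontfun x (max (- \<mu>) (min s 0))}"

text \<open>\<open>hist \<mu> u t\<close> is the segment \<open>u\<^sub>t\<close>.\<close>

definition hist :: "real \<Rightarrow> (real \<Rightarrow> 'h::real_normed_vector) \<Rightarrow> real \<Rightarrow> real \<Rightarrow>\<^sub>C 'h" where
  "hist \<mu> u t = Bcontfun (\<lambda>s. u (t + max (- \<mu>) (min s 0)))"

section \<open>Noise\<close>

definition C0 :: "(real \<Rightarrow> 'u::real_normed_vector) set" where
  "C0 = {\<omega>. continuous_on UNIV \<omega> \<and> \<omega> 0 = 0}"

definition compact_open_C0 :: "(real \<Rightarrow> 'u::real_normed_vector) topology" where
  "compact_open_C0 = topology_generated_by
     {{\<omega> \<in> C0. \<omega> ` X \<subseteq> V} | X V. compact X \<and> open V}"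

definition borel_C0 :: "(real \<Rightarrow> 'u::real_normed_vector) measure" where
  "borel_C0 = sigma C0 {X. openin compact_open_C0 X}"

definition wiener_shift :: "real \<Rightarrow> (real \<Rightarrow> 'u::real_normed_vector) \<Rightarrow> real \<Rightarrow> 'u" where
  "wiener_shift t \<omega> = (\<lambda>s. \<omega> (s + t) - \<omega> t)"

definition trace_class_covariance :: "('u::real_inner \<Rightarrow>\<^sub>L 'u) \<Rightarrow> bool" where
  "trace_class_covariance Q \<longleftrightarrow>
     (\<forall>x y. inner (Q x) y = inner x (Q y)) \<and> (\<forall>x. 0 \<le> inner (Q x) x) \<and>
     (\<exists>E. orthonormal_basis E \<and> (\<lambda>e. inner (Q e) e) summable_on E)"

text \<open>The centred normal law with variance \<open>v\<close>, degenerate for \<open>v = 0\<close>.\<close>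

definition centred_normal :: "real \<Rightarrow> real measure" where
  "centred_normal v =
     (if v = 0 then return borel 0 else density lborel (normal_density 0 (sqrt v)))"

definition wiener_measure ::
  "('u::{real_inner,banach,second_countable_topology} \<Rightarrow>\<^sub>L 'u) \<Rightarrow> (real \<Rightarrow> 'u) measure \<Rightarrow> bool" where
  "wiener_measure Q P \<longleftrightarrow> prob_space P \<and> space P = C0 \<and> sets P = sets borel_C0 \<and>
     (\<forall>s t v. s \<le> t \<longrightarrow>
        distr P borel (\<lambda>\<omega>. inner (\<omega> t - \<omega> s) v) = centred_normal ((t - s) * inner (Q v) v)) \<and>
     (\<forall>(n::nat) \<tau>. strict_mono_on {..n} \<tau> \<longrightarrow>
        prob_space.indep_vars P (\<lambda>_. borel) (\<lambda>i \<omega>. \<omega> (\<tau> (Suc i)) - \<omega> (\<tau> i)) {..<n})"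

text \<open>The properties required of the fixed full-measure shift-invariant set of paths.\<close>

definition admissible_paths ::
  "real \<Rightarrow> (real \<Rightarrow> 'u::real_normed_vector) measure \<Rightarrow> (real \<Rightarrow> 'u) set \<Rightarrow> bool" where
  "admissible_paths \<beta> P \<Omega> \<longleftrightarrow> \<Omega> \<in> sets P \<and> measure P \<Omega> = 1 \<and>
     (\<forall>t. wiener_shift t ` \<Omega> = \<Omega>) \<and>
     (\<forall>\<omega>\<in>\<Omega>. \<forall>k::nat. \<exists>C. \<forall>s\<in>{- real k..real k}. \<forall>t\<in>{- real k..real k}.
        norm (\<omega> t - \<omega> s) \<le> C * \<bar>t - s\<bar> powr \<beta>) \<and>
     (\<forall>\<omega>\<in>\<Omega>. \<forall>a<0.
        ((\<lambda>t. (SUP s\<in>{a..0}. norm (wiener_shift t \<omega> s)) / \<bar>t\<bar>) \<longlongrightarrow> 0) at_top \<and>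
        ((\<lambda>t. (SUP s\<in>{a..0}. norm (wiener_shift t \<omega> s)) / \<bar>t\<bar>) \<longlongrightarrow> 0) at_bot)"

definition path_sigma :: "(real \<Rightarrow> 'u::real_normed_vector) set \<Rightarrow> (real \<Rightarrow> 'u) measure" where
  "path_sigma \<Omega> = restrict_space borel_C0 \<Omega>"

section \<open>Mild solutions and the generated dynamical system\<close>

text \<open>At \<open>r = t\<close> the integrand with \<open>A (S (t - r) \<dots>)\<close> may leave the domain of \<open>A\<close>; this is a
  null set.  Integrability is demanded since a non-integrable function has integral \<open>0\<close>.\<close>

definition mild_solution ::
  "real \<Rightarrow> ('h \<Rightarrow> 'h) \<Rightarrow> (real \<Rightarrow> 'h \<Rightarrow>\<^sub>L 'h) \<Rightarrow>
   ((real \<Rightarrow>\<^sub>C 'h) \<Rightarrow> 'h) \<Rightarrow> ((real \<Rightarrow>\<^sub>C 'h) \<Rightarrow> 'u \<Rightarrow>\<^sub>L 'h) \<Rightarrow> ((real \<Rightarrow>\<^sub>C 'h) \<Rightarrow> 'u \<Rightarrow>\<^sub>L 'h) \<Rightarrow>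
   (real \<Rightarrow> 'u::{real_inner,banach,second_countable_topology}) \<Rightarrow> (real \<Rightarrow>\<^sub>C 'h) \<Rightarrow>
   (real \<Rightarrow> 'h::{real_inner,banach,second_countable_topology}) \<Rightarrow> bool" where
  "mild_solution \<mu> A S F G K \<omega> \<xi> u \<longleftrightarrow>
     continuous_on {- \<mu>..} u \<and> (\<forall>s\<in>{- \<mu>..0}. u s = \<xi> s) \<and>
     (\<forall>t\<ge>0.
        set_integrable lborel {0..t} (\<lambda>r. S (t - r) (F (hist \<mu> u r))) \<and>
        set_integrable lborel {0..t} (\<lambda>r. A (S (t - r) (G (hist \<mu> u r) (\<omega> r)))) \<and>
        set_integrable lborel {0..t} (\<lambda>r. S (t - r) (K (hist \<mu> u r) (\<omega> r))) \<and>
        u t = S t (\<xi> 0)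
              + (LINT r:{0..t}|lborel. S (t - r) (F (hist \<mu> u r)))
              + (LINT r:{0..t}|lborel. A (S (t - r) (G (hist \<mu> u r) (\<omega> r))))
              + G (hist \<mu> u t) (\<omega> t)
              - (LINT r:{0..t}|lborel. S (t - r) (K (hist \<mu> u r) (\<omega> r))))"

text \<open>\<open>mild_flow \<mu> A S F G K t \<omega> \<xi>\<close> is \<open>\<phi>(t,\<omega>,\<xi>) = u\<^sub>t\<close>, \<open>u\<close> being the global mild solution.
  The description is over \<open>u\<^sub>t\<close>, not \<open>u\<close>, as the values of \<open>u\<close> on \<open>{..< - \<mu>}\<close> are arbitrary.\<close>

definition mild_flow ::
  "real \<Rightarrow> ('h \<Rightarrow> 'h) \<Rightarrow> (real \<Rightarrow> 'h \<Rightarrow>\<^sub>L 'h) \<Rightarrow>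
   ((real \<Rightarrow>\<^sub>C 'h) \<Rightarrow> 'h) \<Rightarrow> ((real \<Rightarrow>\<^sub>C 'h) \<Rightarrow> 'u \<Rightarrow>\<^sub>L 'h) \<Rightarrow> ((real \<Rightarrow>\<^sub>C 'h) \<Rightarrow> 'u \<Rightarrow>\<^sub>L 'h) \<Rightarrow>
   real \<Rightarrow> (real \<Rightarrow> 'u::{real_inner,banach,second_countable_topology}) \<Rightarrow>
   (real \<Rightarrow>\<^sub>C 'h::{real_inner,banach,second_countable_topology}) \<Rightarrow> (real \<Rightarrow>\<^sub>C 'h)" where
  "mild_flow \<mu> A S F G K t \<omega> \<xi> = (THE y. \<exists>u. mild_solution \<mu> A S F G K \<omega> \<xi> u \<and> y = hist \<mu> u t)"

section \<open>Random attractors\<close>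

definition log_plus :: "ereal \<Rightarrow> ereal" where
  "log_plus r = (if r = \<infinity> then \<infinity> else ereal (max 0 (ln (real_of_ereal r))))"

text \<open>The universe \<open>\<D>\<close>. Suprema are taken in the extended reals since single fibres may be
  unbounded.\<close>

definition tempered_families ::
  "real \<Rightarrow> (real \<Rightarrow> 'u::real_normed_vector) set \<Rightarrow>
   ((real \<Rightarrow> 'u) \<Rightarrow> (real \<Rightarrow>\<^sub>C 'h::real_normed_vector) set) set" where
  "tempered_families \<mu> \<Omega> = {D.
     (\<forall>\<omega>\<in>\<Omega>. D \<omega> \<noteq> {} \<and> closed (D \<omega>) \<and> D \<omega> \<subseteq> Cmu \<mu>) \<and>
     (\<forall>y\<in>Cmu \<mu>. (\<lambda>\<omega>. INF x\<in>D \<omega>. norm (x - y)) \<in> borel_measurable (path_sigma \<Omega>)) \<and>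
     (\<forall>\<omega>\<in>\<Omega>. \<forall>L\<in>{at_top, at_bot}.
        ((\<lambda>t. log_plus (SUP x\<in>D (wiener_shift t \<omega>). ereal (norm x)) / ereal \<bar>t\<bar>) \<longlongrightarrow> 0) L)}"

definition hausdorff_semidist :: "'a::real_normed_vector set \<Rightarrow> 'a set \<Rightarrow> ereal" where
  "hausdorff_semidist X Y = (SUP x\<in>X. INF y\<in>Y. ereal (norm (x - y)))"

definition random_attractor ::
  "real \<Rightarrow> (real \<Rightarrow> 'u::real_normed_vector) set \<Rightarrow>
   (real \<Rightarrow> (real \<Rightarrow> 'u) \<Rightarrow> (real \<Rightarrow>\<^sub>C 'h::real_normed_vector) \<Rightarrow> (real \<Rightarrow>\<^sub>C 'h)) \<Rightarrow>
   ((real \<Rightarrow> 'u) \<Rightarrow> (real \<Rightarrow>\<^sub>C 'h) set) \<Rightarrow> bool" where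
  "random_attractor \<mu> \<Omega> \<phi> \<A> \<longleftrightarrow> \<A> \<in> tempered_families \<mu> \<Omega> \<and>
     (\<forall>\<omega>\<in>\<Omega>. compact (\<A> \<omega>)) \<and>
     (\<forall>\<omega>\<in>\<Omega>. \<forall>t\<ge>0. \<phi> t \<omega> ` \<A> \<omega> = \<A> (wiener_shift t \<omega>)) \<and>
     (\<forall>D\<in>tempered_families \<mu> \<Omega>. \<forall>\<omega>\<in>\<Omega>.
        ((\<lambda>t. hausdorff_semidist
                (\<phi> t (wiener_shift (- t) \<omega>) ` D (wiener_shift (- t) \<omega>)) (\<A> \<omega>)) \<longlongrightarrow> 0) at_top)"

end

theory Submission
  imports Defs
begin

text \<open>The equation is solved path by path, and the attractor is the pullback limit set of a family of
  balls that absorbs all tempered families.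

  \<^bold>\<open>Smoothing.\<close> A strictly positive self-adjoint operator with compact inverse has an orthonormal
  eigenbasis (\<open>eigenbasis_exists\<close>), on which \<open>S(t)\<close> acts diagonally. Therefore
  \<open>-A S(t) = (-A)\<^sup>1\<^sup>-\<^sup>\<nu> S(t) (-A)\<^sup>\<nu>\<close>, and \<open>A S(t) G(x)\<close> is bounded by a multiple of \<open>t\<^sup>\<nu>\<^sup>-\<^sup>1 exp (- lam t)\<close>
  (\<open>smoothing\<close>), a kernel that is integrable at \<open>0\<close>.

  \<^bold>\<open>Solutions.\<close> In a norm weighted by \<open>exp (- \<rho> t)\<close> with large \<open>\<rho>\<close> the mild equation is a contraction. This
  includes the term \<open>G(u\<^sub>t) \<omega>(t)\<close>, as \<open>G(u\<^sub>t)\<close> is the time integral of \<open>K(u\<^sub>r)\<close> (\<open>mild_map_diff\<close>). One estimate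
  yields existence, uniqueness, and Lipschitz dependence on the initial segment and the noise path
  (\<open>solution_exists\<close>, \<open>solution_stability\<close>). Integration by parts (\<open>noise_const\<close>) shows that a constant noise
  path contributes just \<open>S(t) G(u\<^sub>0) w\<close>. It follows that shifting a solution in time shifts the noise path by
  the Wiener shift (\<open>solves_shift\<close>), which is the cocycle property, and that estimates may use the increments
  \<open>\<omega>(r) - \<omega>(t)\<close>.

  \<^bold>\<open>Absorption.\<close> The smallness condition on \<open>\<mu>\<close> gives \<open>C\<^sub>F < lam\<close>, so that the decay of the semigroup beats the
  linear growth of \<open>F\<close>: comparison with a supersolution \<open>\<alpha> exp (- \<epsilon> t) + \<beta>\<close> bounds the solution (\<open>a_priori\<close>).
  For solutions started at time \<open>-T\<close> this bounds the present segment by a multiple of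
  \<open>exp (- \<epsilon> T) norm \<xi> + 2 M(\<omega>) + 1\<close>, where \<open>M(\<omega>)\<close> is the supremum of \<open>exp (\<epsilon> s) norm (\<omega> s)\<close> over \<open>s \<le> 0\<close>
  (\<open>pullback_bound\<close>). As the increments of \<open>\<omega>\<close> are sublinear, \<open>\<omega>\<close> grows at most quadratically, and \<open>M\<close> is
  finite and tempered.

  \<^bold>\<open>Compactness.\<close> For small \<open>h\<close>, \<open>u(t
      + h)\<close> is uniformly close to \<open>S(h) u(t)\<close> on bounded sets of initial segments.
  Since \<open>S(h)\<close> is compact, this makes the values of solutions totally bounded and the solutions equicontinuous
  (\<open>flow_compact\<close>).

  \<^bold>\<open>Attractor.\<close> A continuous cocycle with such an absorbing family has a compact, invariant, attracting limit
  set (locale \<open>absorbing_cocycle\<close>). Its distance from a point is the limit of the distances of the images of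
  open balls of random radius. As solutions depend continuously on the noise path in the compact-open topology,
  the sublevel sets of these distances are open in \<open>\<Omega>\<close> (\<open>openin_reachable\<close>), which gives measurability.\<close>

section \<open>Orthonormal systems and the spectral theorem\<close>

definition orthonormal :: "'h::real_inner set \<Rightarrow> bool" where
  "orthonormal E \<longleftrightarrow> pairwise orthogonal E \<and> (\<forall>e\<in>E. norm e = 1)"

lemma orthonormal_inner:
  assumes "orthonormal E" "e \<in> E" "f \<in> E"
  shows "inner e f = (if e = f then 1 else 0)"
  using assms unfolding orthonormal_def pairwise_def orthogonal_def
  by (auto simp: power2_norm_eq_inner[symmetric])

lemma orthonormal_sum_inner:
  assumes "orthonormal E" "X \<subseteq> E" "finite X" "f \<in> X"
  shows "inner (\<Sum>e\<in>X. c e *\<^sub>R e) f = c f"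
proof -
  have "inner (\<Sum>e\<in>X. c e *\<^sub>R e) f = (\<Sum>e\<in>X. if e = f then c e else 0)"
    unfolding inner_sum_left
    using assms by (intro sum.cong) (auto simp: orthonormal_inner subset_iff)
  then show ?thesis using assms by simp
qed

lemma orthonormal_norm_sum:
  assumes "orthonormal E" "X \<subseteq> E" "finite X"
  shows "(norm (\<Sum>e\<in>X. c e *\<^sub>R e))\<^sup>2 = (\<Sum>e\<in>X. (c e)\<^sup>2)"
proof -
  have "(norm (\<Sum>e\<in>X. c e *\<^sub>R e))\<^sup>2 = (\<Sum>f\<in>X. inner (\<Sum>e\<in>X. c e *\<^sub>R e) (c f *\<^sub>R f))"
    unfolding power2_norm_eq_inner by (simp add: inner_sum_right)
  also have "\<dots> = (\<Sum>f\<in>X. c f * c f)"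
    using orthonormal_sum_inner[OF assms] by (intro sum.cong) auto
  finally show ?thesis by (simp add: power2_eq_square)
qed

lemma bessel_finite:
  assumes "orthonormal E" "X \<subseteq> E" "finite X"
  shows "(\<Sum>e\<in>X. (inner x e)\<^sup>2) \<le> (norm x)\<^sup>2"
proof -
  define p where "p = (\<Sum>e\<in>X. inner x e *\<^sub>R e)"
  have "inner x p = (\<Sum>e\<in>X. (inner x e)\<^sup>2)"
    by (simp add: p_def inner_sum_right power2_eq_square)
  moreover have "inner p p = (\<Sum>e\<in>X. (inner x e)\<^sup>2)"
    using orthonormal_norm_sum[OF assms, of "inner x"] unfolding p_def power2_norm_eq_inner .
  moreover have "0 \<le> inner (x - p) (x - p)" by simp
  ultimately show ?thesis
    by (simp add: inner_diff_left inner_diff_right inner_commute power2_norm_eq_inner)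
qed

lemma bessel_summable:
  assumes "orthonormal E"
  shows "(\<lambda>e. (inner x e)\<^sup>2) summable_on E"
  using bessel_finite[OF assms]
  by (intro nonneg_bounded_partial_sums_imp_summable_on[where C="(norm x)\<^sup>2"])
     (auto intro!: eventually_finite_subsets_at_top_weakI)

lemma orthonormal_summable:
  fixes E :: "'h::{real_inner,banach} set"
  assumes E: "orthonormal E" and c: "(\<lambda>e. (c e)\<^sup>2) summable_on E"
  shows "(\<lambda>e. c e *\<^sub>R e) summable_on E"
proof -
  obtain l where l: "(sum (\<lambda>e. (c e)\<^sup>2) \<longlongrightarrow> l) (finite_subsets_at_top E)"
    using c unfolding summable_on_def has_sum_def by auto
  have "cauchy_filter (filtermap (sum (\<lambda>e. c e *\<^sub>R e)) (finite_subsets_at_top E))"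
    unfolding cauchy_filter_metric_filtermap
  proof (intro allI impI)
    fix \<epsilon> :: real assume "\<epsilon> > 0"
    then have "eventually (\<lambda>X. dist (sum (\<lambda>e. (c e)\<^sup>2) X) l < \<epsilon>\<^sup>2 / 8) (finite_subsets_at_top E)"
      by (intro tendstoD[OF l]) simp
    then obtain X0 where X0: "finite X0" "X0 \<subseteq> E"
      "\<And>X. finite X \<Longrightarrow> X0 \<subseteq> X \<Longrightarrow> X \<subseteq> E \<Longrightarrow> dist (sum (\<lambda>e. (c e)\<^sup>2) X) l < \<epsilon>\<^sup>2 / 8"
      by (auto simp: eventually_finite_subsets_at_top)
    have close: "norm (sum (\<lambda>e. c e *\<^sub>R e) X - sum (\<lambda>e. c e *\<^sub>R e) X0) < \<epsilon> / 2"
      if X: "finite X" "X0 \<subseteq> X" "X \<subseteq> E" for X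
    proof -
      have "(norm (sum (\<lambda>e. c e *\<^sub>R e) X - sum (\<lambda>e. c e *\<^sub>R e) X0))\<^sup>2
          = (norm (sum (\<lambda>e. c e *\<^sub>R e) (X - X0)))\<^sup>2"
        using X by (simp add: sum_diff)
      also have "\<dots> = (\<Sum>e\<in>X - X0. (c e)\<^sup>2)"
        using X by (intro orthonormal_norm_sum[OF E]) auto
      also have "\<dots> = (\<Sum>e\<in>X. (c e)\<^sup>2) - (\<Sum>e\<in>X0. (c e)\<^sup>2)"
        using X by (simp add: sum_diff)
      also have "\<dots> < \<epsilon>\<^sup>2 / 4"
        using X0(3)[OF X] X0(3)[OF X0(1) order_refl X0(2)] unfolding dist_real_def by linarith
      also have "\<dots> = (\<epsilon> / 2)\<^sup>2" by (simp add: power2_eq_square)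
      finally show ?thesis
        using \<open>\<epsilon> > 0\<close> by (meson half_gt_zero less_eq_real_def power2_less_imp_less)
    qed
    show "\<exists>P. eventually P (finite_subsets_at_top E) \<and>
        (\<forall>x y. P x \<and> P y \<longrightarrow> dist (\<Sum>e\<in>x. c e *\<^sub>R e) (\<Sum>e\<in>y. c e *\<^sub>R e) < \<epsilon>)"
    proof (intro exI conjI allI impI)
      show "eventually (\<lambda>X. finite X \<and> X0 \<subseteq> X \<and> X \<subseteq> E) (finite_subsets_at_top E)"
        unfolding eventually_finite_subsets_at_top using X0(1,2) by (intro exI[of _ X0]) auto
      fix X Y assume "(finite X \<and> X0 \<subseteq> X \<and> X \<subseteq> E) \<and> finite Y \<and> X0 \<subseteq> Y \<and> Y \<subseteq> E"
      then show "dist (\<Sum>e\<in>X. c e *\<^sub>R e) (\<Sum>e\<in>Y. c e *\<^sub>R e) < \<epsilon>"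
        using close[of X] close[of Y]
          dist_triangle_half_l[of _ "sum (\<lambda>e. c e *\<^sub>R e) X0" \<epsilon>]
        by (simp add: dist_norm)
    qed
  qed
  then have "convergent_filter (filtermap (sum (\<lambda>e. c e *\<^sub>R e)) (finite_subsets_at_top E))"
    by (rule cauchy_filter_convergent)
  then obtain L where "(sum (\<lambda>e. c e *\<^sub>R e) \<longlongrightarrow> L) (finite_subsets_at_top E)"
    by (auto simp: convergent_filter_iff filterlim_def)
  then show ?thesis
    unfolding summable_on_def has_sum_def by blast
qed

lemma orthonormal_infsum_inner:
  fixes E :: "'h::{real_inner,banach} set"
  assumes E: "orthonormal E" and c: "(\<lambda>e. (c e)\<^sup>2) summable_on E" and f: "f \<in> E"
  shows "inner (\<Sum>\<^sub>\<infinity>e\<in>E. c e *\<^sub>R e) f = c f"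
proof -
  have "((\<lambda>e. c e *\<^sub>R e) has_sum (\<Sum>\<^sub>\<infinity>e\<in>E. c e *\<^sub>R e)) E"
    using orthonormal_summable[OF E c] by simp
  then have "((\<lambda>e. inner (c e *\<^sub>R e) f) has_sum inner (\<Sum>\<^sub>\<infinity>e\<in>E. c e *\<^sub>R e) f) E"
    by (rule has_sum_bounded_linear[OF bounded_linear_inner_left, unfolded o_def])
  moreover have "((\<lambda>e. inner (c e *\<^sub>R e) f) has_sum c f) E"
  proof -
    have "((\<lambda>e. inner (c e *\<^sub>R e) f) has_sum c f) {f}"
      using orthonormal_inner[OF E f f] by (intro has_sum_finiteI) auto
    then show ?thesis
      using f by (subst has_sum_cong_neutral[where T="{f}" and g="\<lambda>e. inner (c e *\<^sub>R e) f"])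
        (auto simp: orthonormal_inner[OF E])
  qed
  ultimately show ?thesis by (metis has_sum_unique)
qed

text \<open>The Fourier series of \<open>x\<close> converges by Bessel's inequality, and \<open>x\<close> minus its sum is orthogonal to
  the system.\<close>

lemma orthonormal_span_dense:
  fixes E :: "'h::{real_inner,banach} set"
  assumes E: "orthonormal E" and perp: "\<And>x. (\<And>e. e \<in> E \<Longrightarrow> inner x e = 0) \<Longrightarrow> x = 0"
  shows "closure (span E) = UNIV"
proof -
  have "x \<in> closure (span E)" for x
  proof -
    define p where "p = (\<Sum>\<^sub>\<infinity>e\<in>E. inner x e *\<^sub>R e)"
    have "inner (x - p) e = 0" if "e \<in> E" for e
      using orthonormal_infsum_inner[OF E bessel_summable[OF E] that, of x]
      by (simp add: p_def inner_diff_left)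
    then have "x = p" using perp[of "x - p"] by simp
    have "((\<lambda>e. inner x e *\<^sub>R e) has_sum p) E"
      unfolding p_def using orthonormal_summable[OF E bessel_summable[OF E]] by simp
    then have "(sum (\<lambda>e. inner x e *\<^sub>R e) \<longlongrightarrow> p) (finite_subsets_at_top E)"
      unfolding has_sum_def .
    moreover have "eventually (\<lambda>X. sum (\<lambda>e. inner x e *\<^sub>R e) X \<in> closure (span E))
        (finite_subsets_at_top E)"
      by (intro eventually_finite_subsets_at_top_weakI closure_subset[THEN subsetD] span_sum span_mul)
         (auto intro: span_base)
    ultimately show ?thesis
      unfolding \<open>x = p\<close>
      by (intro Lim_in_closed_set[OF closed_closure]) auto
  qed
  then show ?thesis by auto
qed

lemma eq_on_basis:
  fixes f g :: "'h::real_inner \<Rightarrow> real"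
  assumes "orthonormal_basis E" "bounded_linear f" "bounded_linear g" "\<And>e. e \<in> E \<Longrightarrow> f e = g e"
  shows "f x = g x"
proof -
  interpret f: bounded_linear f by fact
  interpret g: bounded_linear g by fact
  have "f y = g y" if "y \<in> span E" for y
    using that assms(4) by (rule linear_eq_on_span[OF f.linear g.linear, rotated])
  then have "closure (span E) \<subseteq> {y. f y = g y}"
    by (intro closure_minimal closed_Collect_eq f.continuous_on g.continuous_on) auto
  then show ?thesis using assms(1) unfolding orthonormal_basis_def by auto
qed

lemma basis_inner_eqI:
  fixes x y :: "'h::real_inner"
  assumes "orthonormal_basis E" "\<And>e. e \<in> E \<Longrightarrow> inner x e = inner y e"
  shows "x = y"
proof -
  have "inner x z = inner y z" for z
    by (rule eq_on_basis[OF assms(1)]) (auto intro: bounded_linear_inner_right assms(2))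
  then show ?thesis by (metis vector_eq_rdot)
qed

lemma orthonormal_basis_imp_orthonormal: "orthonormal_basis E \<Longrightarrow> orthonormal E"
  unfolding orthonormal_basis_def orthonormal_def by auto

text \<open>The Rayleigh quotient attains its maximum \<open>m\<close> over the unit sphere of \<open>N\<close>: along a maximizing sequence
    \<open>x\<^sub>n\<close> positivity of
  \<open>m - T\<close> gives \<open>norm (m x\<^sub>n - T x\<^sub>n)\<^sup>2 \<le> m * \<langle>m x\<^sub>n - T x\<^sub>n, x\<^sub>n\<rangle> \<longrightarrow> 0\<close>.\<close>

lemma compact_positive_has_eigenvector:
  fixes T :: "'h::real_inner \<Rightarrow>\<^sub>L 'h"
  assumes T: "compact_operator T" and sym: "\<And>x y. inner (T x) y = inner x (T y)"
    and pos: "\<And>x. x \<noteq> 0 \<Longrightarrow> inner (T x) x > 0"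
    and N: "subspace N" "closed N" "\<And>x. x \<in> N \<Longrightarrow> T x \<in> N" and v: "v \<in> N" "v \<noteq> 0"
  obtains x m where "x \<in> N" "norm x = 1" "m > 0" "T x = m *\<^sub>R x"
proof -
  define U where "U = {x\<in>N. norm x = 1}"
  define m where "m = (SUP x\<in>U. inner (T x) x)"
  have le_norm: "inner (T x) x \<le> norm T" if "x \<in> U" for x
  proof -
    have "inner (T x) x \<le> norm (T x) * norm x" by (rule norm_cauchy_schwarz)
    also have "\<dots> \<le> norm T * norm x * norm x"
      by (intro mult_right_mono norm_blinfun) auto
    finally show ?thesis using that by (simp add: U_def)
  qed
  have bdd: "bdd_above ((\<lambda>x. inner (T x) x) ` U)" using le_norm by (auto intro!: bdd_aboveI)
  define v1 where "v1 = v /\<^sub>R norm v"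
  have v1: "v1 \<in> U" using v N(1) by (auto simp: v1_def U_def subspace_scale)
  then have "inner (T v1) v1 > 0" by (intro pos) (auto simp: U_def)
  then have m: "m > 0" using cSUP_upper[OF v1 bdd] by (simp add: m_def)
  have rayleigh: "inner (T x) x \<le> m * (norm x)\<^sup>2" if "x \<in> N" for x
  proof (cases "x = 0")
    case False
    have "x /\<^sub>R norm x \<in> U" using that N(1) False by (auto simp: U_def subspace_scale)
    from cSUP_upper[OF this bdd] show ?thesis
      using False by (simp add: m_def blinfun.scaleR_right field_simps power2_eq_square)
  qed simp
  have "\<exists>x\<in>U. m - 1 / real (Suc n) < inner (T x) x" for n
    using less_cSUP_iff[of U "\<lambda>x. inner (T x) x" "m - 1 / real (Suc n)"] v1 bdd
    by (auto simp: m_def)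
  then obtain x where x: "\<And>n. x n \<in> U" "\<And>n. m - 1 / real (Suc n) < inner (T (x n)) (x n)" by metis
  have defect: "norm (m *\<^sub>R x n - T (x n)) \<le> sqrt (m / real (Suc n))" for n
  proof -
    define w where "w = m *\<^sub>R x n - T (x n)"
    have xn: "x n \<in> N" "norm (x n) = 1" using x(1)[of n] by (auto simp: U_def)
    have w: "w \<in> N" unfolding w_def using xn N by (auto intro: subspace_diff subspace_scale)
    define y where "y = x n - w /\<^sub>R m"
    have y: "y \<in> N" unfolding y_def using xn w N by (auto intro: subspace_diff subspace_scale)
    have ww: "inner (T w) w \<le> m * (norm w)\<^sup>2" by (rule rayleigh[OF w])
    have xx: "m * (norm (x n))\<^sup>2 - inner (T (x n)) (x n) \<le> 1 / real (Suc n)"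
      using x(2)[of n] xn by simp
    have wx: "m * inner w (x n) - inner (T (x n)) w = (norm w)\<^sup>2"
    proof -
      have "inner w w = inner (m *\<^sub>R x n - T (x n)) w" by (simp only: w_def)
      also have "\<dots> = m * inner (x n) w - inner (T (x n)) w" by (simp add: inner_diff_left)
      finally show ?thesis by (simp add: power2_norm_eq_inner inner_commute)
    qed
    \<comment> \<open>The step \<open>1 / m\<close> minimizes the upper bound for \<open>\<langle>(m - T) y, y\<rangle>\<close> below.\<close>
    have yy: "inner y y = inner (x n) (x n) - 2 / m * inner w (x n) + inner w w / m\<^sup>2"
      by (simp add: y_def inner_diff_left inner_diff_right inner_commute power2_eq_square divide_inverse)
    have Tyy: "inner (T y) y = inner (T (x n)) (x n) - 2 / m * inner (T (x n)) w + inner (T w) w / m\<^sup>2"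
      using sym[of w "x n"]
      by (simp add: y_def blinfun.diff_right blinfun.scaleR_right inner_diff_left inner_diff_right
          inner_commute power2_eq_square divide_inverse algebra_simps)
    have Tww: "inner (T w) w \<ge> 0" using pos[of w] by (cases "w = 0") auto
    have "0 \<le> m * inner y y - inner (T y) y"
      using rayleigh[OF y] by (simp add: power2_norm_eq_inner)
    also have "\<dots> = (m * inner (x n) (x n) - inner (T (x n)) (x n))
        - 2 / m * (m * inner w (x n) - inner (T (x n)) w)
        + (m * inner w w - inner (T w) w) / m\<^sup>2"
      unfolding yy Tyy by (simp add: algebra_simps diff_divide_distrib)
    also have "\<dots> \<le> 1 / real (Suc n) - 2 / m * (norm w)\<^sup>2 + (m * (norm w)\<^sup>2) / m\<^sup>2"
      using xx Tww unfolding wx power2_norm_eq_inner[symmetric]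
      by (intro add_mono diff_mono divide_right_mono) auto
    also have "\<dots> = 1 / real (Suc n) - (norm w)\<^sup>2 / m"
      using m by (simp add: power2_eq_square)
    finally have "(norm w)\<^sup>2 / m \<le> 1 / real (Suc n)" by simp
    then have "(norm w)\<^sup>2 \<le> m / real (Suc n)" using m by (simp add: pos_divide_le_eq mult.commute)
    then show ?thesis unfolding w_def by (simp add: real_le_rsqrt)
  qed
  have "compact (closure (blinfun_apply T ` U))"
  proof -
    have "bounded U" by (auto simp: U_def bounded_iff intro!: exI[of _ 1])
    then show ?thesis using T unfolding compact_operator_def by blast
  qed
  moreover have "\<And>n. T (x n) \<in> closure (blinfun_apply T ` U)"
    using x(1) closure_subset by blast
  ultimately obtain y r where r: "strict_mono r" "(\<lambda>n. T (x (r n))) \<longlonglongrightarrow> y"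
    using seq_compactE[of "closure (blinfun_apply T ` U)" "\<lambda>n. T (x n)"]
    unfolding compact_eq_seq_compact_metric comp_def by blast
  have "(\<lambda>n. m *\<^sub>R x n - T (x n)) \<longlonglongrightarrow> 0"
  proof (rule Lim_null_comparison)
    show "eventually (\<lambda>n. norm (m *\<^sub>R x n - T (x n)) \<le> sqrt (m / real (Suc n))) sequentially"
      using defect by (intro always_eventually allI)
    have "(\<lambda>n. sqrt (m * (1 / real (Suc n)))) \<longlonglongrightarrow> sqrt (m * 0)"
      by (intro tendsto_intros LIMSEQ_Suc[OF lim_1_over_n])
    then show "(\<lambda>n. sqrt (m / real (Suc n))) \<longlonglongrightarrow> 0" by simp
  qed
  from tendsto_add[OF LIMSEQ_subseq_LIMSEQ[OF this r(1)] r(2)]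
  have "(\<lambda>n. m *\<^sub>R x (r n)) \<longlonglongrightarrow> y" by (simp add: o_def)
  then have "(\<lambda>n. inverse m *\<^sub>R (m *\<^sub>R x (r n))) \<longlonglongrightarrow> inverse m *\<^sub>R y"
    by (intro tendsto_scaleR tendsto_const)
  then have lim: "(\<lambda>n. x (r n)) \<longlonglongrightarrow> y /\<^sub>R m" using m by simp
  then have "(\<lambda>n. T (x (r n))) \<longlonglongrightarrow> T (y /\<^sub>R m)"
    by (rule blinfun.tendsto[OF tendsto_const])
  then have "T (y /\<^sub>R m) = y" using r(2) LIMSEQ_unique by blast
  moreover have "norm (y /\<^sub>R m) = 1"
    using LIMSEQ_unique[OF tendsto_norm[OF lim], of 1] x(1) by (simp add: U_def)
  moreover have "y /\<^sub>R m \<in> N"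
    by (rule closed_sequentially[OF N(2) _ lim]) (use x(1) in \<open>auto simp: U_def\<close>)
  ultimately show thesis using m that[of "y /\<^sub>R m" m] by simp
qed

text \<open>A maximal orthonormal system of eigenvectors of the compact inverse is complete, as otherwise its
  orthogonal complement would contain another eigenvector.\<close>

theorem eigenbasis_exists:
  fixes B :: "'h::{real_inner,banach} \<Rightarrow> 'h"
  assumes sa: "selfadjoint_on D B" and pos: "strictly_positive_on D B"
    and inv: "has_compact_inverse D B"
  shows "\<exists>E. eigenbasis D B E"
proof -
  obtain T :: "'h \<Rightarrow>\<^sub>L 'h" where T: "compact_operator T" "\<And>y. T y \<in> D" "\<And>y. B (T y) = y"
    "\<And>x. x \<in> D \<Longrightarrow> T (B x) = x"
    using inv unfolding has_compact_inverse_def by auto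
  have Bsym: "inner (B x) y = inner x (B y)" if "x \<in> D" "y \<in> D" for x y
    using sa that unfolding selfadjoint_on_def by blast
  have sym: "inner (T x) y = inner x (T y)" for x y
    using Bsym[OF T(2) T(2), of x y] T(3) by simp
  have Tpos: "inner (T x) x > 0" if "x \<noteq> 0" for x
  proof -
    have "T x \<noteq> 0" using that T(3)[of x] T(3)[of 0] by auto
    then have "inner (B (T x)) (T x) > 0"
      using pos T(2) unfolding strictly_positive_on_def by auto
    then show ?thesis using T(3) by (simp add: inner_commute)
  qed
  define \<A> where "\<A> = {E. orthonormal E \<and> (\<forall>e\<in>E. \<exists>m>0. T e = m *\<^sub>R e)}"
  have "\<exists>M\<in>\<A>. \<forall>X\<in>\<A>. M \<subseteq> X \<longrightarrow> X = M"
  proof (rule subset_Zorn')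
    fix C assume C: "subset.chain \<A> C"
    then have CA: "C \<subseteq> \<A>" by (simp add: subset.chain_def)
    have "e \<noteq> f \<longrightarrow> orthogonal e f" if ef: "e \<in> \<Union>C" "f \<in> \<Union>C" for e f
    proof -
      obtain X Y where "X \<in> C" "Y \<in> C" "e \<in> X" "f \<in> Y" using ef by auto
      moreover then have "X \<subseteq> Y \<or> Y \<subseteq> X" using C by (simp add: subset.chain_def) blast
      ultimately obtain Z where "Z \<in> \<A>" "e \<in> Z" "f \<in> Z"
        using CA by blast
      then show ?thesis by (auto simp: \<A>_def orthonormal_def pairwise_def)
    qed
    then show "\<Union>C \<in> \<A>"
      using C by (auto simp: \<A>_def orthonormal_def pairwise_def subset.chain_def subset_iff)
  qed
  then obtain E where "E \<in> \<A>" and max: "\<And>X. X \<in> \<A> \<Longrightarrow> E \<subseteq> X \<Longrightarrow> X = E" by blast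
  then have E: "orthonormal E" "\<And>e. e \<in> E \<Longrightarrow> \<exists>m>0. T e = m *\<^sub>R e" by (auto simp: \<A>_def)
  define N where "N = {x. \<forall>e\<in>E. inner x e = 0}"
  have N: "subspace N" "closed N" "\<And>x. x \<in> N \<Longrightarrow> T x \<in> N"
  proof -
    show "subspace N" by (auto simp: N_def subspace_def inner_add_left)
    have "N = (\<Inter>e\<in>E. {x. inner x e = 0})" by (auto simp: N_def)
    then show "closed N" by (auto intro!: closed_INT closed_Collect_eq continuous_intros)
    fix x assume "x \<in> N"
    then show "T x \<in> N" using E(2) by (fastforce simp: N_def sym)
  qed
  have "x = 0" if "\<And>e. e \<in> E \<Longrightarrow> inner x e = 0" for x
  proof (rule ccontr)
    assume "x \<noteq> 0"
    have "x \<in> N" using that by (simp add: N_def)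
    then obtain y m where y: "y \<in> N" "norm y = 1" "m > 0" "T y = m *\<^sub>R y"
      using compact_positive_has_eigenvector[OF T(1), of N x thesis] sym Tpos N \<open>x \<noteq> 0\<close> by blast
    have "insert y E \<in> \<A>"
      using E y by (auto simp: \<A>_def orthonormal_def pairwise_def orthogonal_def N_def inner_commute)
    then have "y \<in> E" using max by blast
    then show False using y by (auto simp: N_def)
  qed
  then have dense: "closure (span E) = UNIV" by (rule orthonormal_span_dense[OF E(1)])
  have "\<exists>l. B e = l *\<^sub>R e" "e \<in> D" if e: "e \<in> E" for e
  proof -
    obtain m where m: "m > 0" "T e = m *\<^sub>R e" using E(2)[OF e] by auto
    have lin: "linear_operator_on D B" using sa unfolding selfadjoint_on_def by auto
    have "e = inverse m *\<^sub>R T e" using m by simp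
    moreover have "inverse m *\<^sub>R T e \<in> D"
      using lin T(2) unfolding linear_operator_on_def by (auto intro: subspace_scale)
    ultimately show "e \<in> D" by simp
    have "B (inverse m *\<^sub>R T e) = inverse m *\<^sub>R e"
      using lin T(2,3) unfolding linear_operator_on_def by auto
    then show "\<exists>l. B e = l *\<^sub>R e" using \<open>e = inverse m *\<^sub>R T e\<close> by metis
  qed
  then show ?thesis
    using E(1) dense unfolding eigenbasis_def orthonormal_basis_def orthonormal_def by blast
qed


lemma eigenbasis_some_eigenbasis:
  fixes B :: "'h::{real_inner,banach} \<Rightarrow> 'h"
  assumes "selfadjoint_on D B" "strictly_positive_on D B" "has_compact_inverse D B"
  shows "eigenbasis D B (some_eigenbasis D B)"
  unfolding some_eigenbasis_def using eigenbasis_exists[OF assms] by (rule someI_ex)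

section \<open>Fractional powers and smoothing\<close>

text \<open>The Fourier coefficients decide both membership in the domain of a fractional power and its
  value, so that identities between fractional powers reduce to identities between numbers.\<close>

lemma frac_pow_iff:
  fixes B :: "'h::{real_inner,banach} \<Rightarrow> 'h"
  assumes "eigenbasis D B (some_eigenbasis D B)"
  shows "x \<in> frac_dom D B \<gamma> \<and> frac_pow D B \<gamma> x = z \<longleftrightarrow>
    (\<forall>e\<in>some_eigenbasis D B. inner z e = inner (B e) e powr \<gamma> * inner x e)"
proof -
  define E where "E = some_eigenbasis D B"
  have E: "orthonormal_basis E" "orthonormal E"
    using assms unfolding E_def eigenbasis_def by (auto intro: orthonormal_basis_imp_orthonormal)
  have coeff: "inner (frac_pow D B \<gamma> x) e = inner (B e) e powr \<gamma> * inner x e"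
    if "x \<in> frac_dom D B \<gamma>" "e \<in> E" for e
    using orthonormal_infsum_inner[OF E(2) _ that(2)] that(1)
    unfolding frac_dom_def frac_pow_def E_def by auto
  have "x \<in> frac_dom D B \<gamma> \<and> frac_pow D B \<gamma> x = z"
    if z: "\<forall>e\<in>E. inner z e = inner (B e) e powr \<gamma> * inner x e"
  proof -
    have "(\<lambda>e. (inner (B e) e powr \<gamma> * inner x e)\<^sup>2) summable_on E"
      using bessel_summable[OF E(2), of z] z by (subst summable_on_cong[where g="\<lambda>e. (inner z e)\<^sup>2"]) auto
    then have "x \<in> frac_dom D B \<gamma>" unfolding frac_dom_def E_def by simp
    with coeff z show ?thesis by (auto intro: basis_inner_eqI[OF E(1)])
  qed
  with coeff show ?thesis unfolding E_def by blast
qed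

lemma frac_pow_diff:
  fixes B :: "'h::{real_inner,banach} \<Rightarrow> 'h"
  assumes "eigenbasis D B (some_eigenbasis D B)" "x \<in> frac_dom D B \<gamma>" "y \<in> frac_dom D B \<gamma>"
  shows "x - y \<in> frac_dom D B \<gamma>" "frac_pow D B \<gamma> (x - y) = frac_pow D B \<gamma> x - frac_pow D B \<gamma> y"
proof -
  have "inner (frac_pow D B \<gamma> z) e = inner (B e) e powr \<gamma> * inner z e"
    if "z \<in> frac_dom D B \<gamma>" "e \<in> some_eigenbasis D B" for z e
    using frac_pow_iff[OF assms(1), of z \<gamma>] that by blast
  then have "x - y \<in> frac_dom D B \<gamma> \<and> frac_pow D B \<gamma> (x - y) = frac_pow D B \<gamma> x - frac_pow D B \<gamma> y"
    using assms(2,3) by (subst frac_pow_iff[OF assms(1)]) (auto simp: inner_diff_left right_diff_distrib)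
  then show "x - y \<in> frac_dom D B \<gamma>"
    "frac_pow D B \<gamma> (x - y) = frac_pow D B \<gamma> x - frac_pow D B \<gamma> y" by auto
qed

section \<open>Analytic semigroups\<close>

lemma C0_semigroup_continuous:
  assumes "C0_semigroup S" and "\<And>t. t > 0 \<Longrightarrow> continuous (at t) (\<lambda>t. S t x)"
  shows "continuous_on {0..} (\<lambda>t. blinfun_apply (S t) x)"
  unfolding continuous_on_eq_continuous_within
proof
  fix t :: real assume "t \<in> {0..}"
  show "continuous (at t within {0..}) (\<lambda>t. S t x)"
  proof (cases "t = 0")
    case True
    have "((\<lambda>t. S t x) \<longlongrightarrow> S 0 x) (at_right 0)"
      using assms(1) unfolding C0_semigroup_def by simp
    then show ?thesis using True by (simp add: continuous_within at_within_Ici_at_right)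
  next
    case False
    then show ?thesis using assms(2)[of t] \<open>t \<in> {0..}\<close> by (auto intro: continuous_at_imp_continuous_at_within)
  qed
qed

lemma generator_graph_unique:
  assumes "(x, y) \<in> generator_graph S" "(x, z) \<in> generator_graph S"
  shows "y = z"
  using assms tendsto_unique[OF trivial_limit_at_right_real] unfolding generator_graph_def by blast

text \<open>Analyticity enters through differentiability in operator norm on the open half-line. The
  derivative \<open>S'(t)\<close> is a bounded operator and will turn out to be \<open>A S(t)\<close>.\<close>

locale smooth_semigroup =
  fixes S S' :: "real \<Rightarrow> 'h::{real_inner,banach,second_countable_topology} \<Rightarrow>\<^sub>L 'h"
  assumes C0: "C0_semigroup S"
    and deriv: "\<And>t. t > 0 \<Longrightarrow> (S has_vector_derivative S' t) (at t)"
begin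

lemma S_0 [simp]: "S 0 = id_blinfun"
  and S_add: "s \<ge> 0 \<Longrightarrow> t \<ge> 0 \<Longrightarrow> S (s + t) = S s o\<^sub>L S t"
  using C0 unfolding C0_semigroup_def by auto

lemma deriv_apply: "t > 0 \<Longrightarrow> ((\<lambda>t. S t x) has_vector_derivative S' t x) (at t)"
  using bounded_linear.has_vector_derivative[OF bounded_linear_blinfun_apply deriv]
  by (simp add: bounded_linear.has_vector_derivative[OF blinfun.bounded_linear_left deriv])

lemma S_continuous: "continuous_on {0..} (\<lambda>t. S t x)"
  by (rule C0_semigroup_continuous[OF C0]) (use deriv_apply in \<open>blast intro: has_vector_derivative_continuous\<close>)

lemma S_norm_continuous: "continuous_on {0<..} S"
  by (intro continuous_at_imp_continuous_on ballI)
     (use deriv in \<open>auto intro: has_vector_derivative_continuous\<close>)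

lemma S'_add: "t > 0 \<Longrightarrow> s \<ge> 0 \<Longrightarrow> S' (s + t) = S s o\<^sub>L S' t"
  and S'_add_right: "t > 0 \<Longrightarrow> s \<ge> 0 \<Longrightarrow> S' (s + t) = S' t o\<^sub>L S s"
proof -
  assume ts: "t > 0" "s \<ge> 0"
  have d: "((\<lambda>t. S (s + t)) has_vector_derivative S' (s + t)) (at t)"
  proof -
    have "((\<lambda>t. s + t) has_vector_derivative 1) (at t)"
      by (rule derivative_eq_intros refl)+ simp
    from vector_diff_chain_at[OF this deriv] show ?thesis using ts by (simp add: o_def)
  qed
  have eigv: "eventually (\<lambda>r. r > 0) (nhds t)" using ts by (intro order_tendstoD[OF filterlim_ident]) 
  have "((\<lambda>t. S s o\<^sub>L S t) has_vector_derivative S s o\<^sub>L S' t) (at t)"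
    by (rule bounded_linear.has_vector_derivative[OF bounded_bilinear.bounded_linear_right[OF
        bounded_bilinear_blinfun_compose] deriv[OF ts(1)]])
  then have "((\<lambda>t. S (s + t)) has_vector_derivative S s o\<^sub>L S' t) (at t)"
    unfolding has_vector_derivative_def
    by (rule has_derivative_transform_eventually)
       (use eigv ts S_add in \<open>auto simp: eventually_at_filter elim!: eventually_mono\<close>)
  then show "S' (s + t) = S s o\<^sub>L S' t" using d vector_derivative_unique_at by blast
  have "((\<lambda>t. S t o\<^sub>L S s) has_vector_derivative S' t o\<^sub>L S s) (at t)"
    by (rule bounded_linear.has_vector_derivative[OF bounded_bilinear.bounded_linear_left[OF
        bounded_bilinear_blinfun_compose] deriv[OF ts(1)]])
  then have "((\<lambda>t. S (s + t)) has_vector_derivative S' t o\<^sub>L S s) (at t)"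
    unfolding has_vector_derivative_def
    by (rule has_derivative_transform_eventually)
       (use eigv ts S_add in \<open>auto simp: add.commute[of s] eventually_at_filter elim!: eventually_mono\<close>)
  then show "S' (s + t) = S' t o\<^sub>L S s" using d vector_derivative_unique_at by blast
qed

lemma S'_continuous: "continuous_on {0<..} S'"
proof (intro continuous_at_imp_continuous_on ballI)
  fix t :: real assume "t \<in> {0<..}"
  then have t: "t > 0" by simp
  have "isCont S (t / 2)" using S_norm_continuous t by (simp add: continuous_on_eq_continuous_at)
  then have "isCont (\<lambda>r. S (r - t / 2)) t"
    using isCont_o2[of t "\<lambda>r. r - t / 2" S] by simp
  then have "isCont (\<lambda>r. S' (t / 2) o\<^sub>L S (r - t / 2)) t"
    by (intro bounded_linear.isCont[OF bounded_bilinear.bounded_linear_right[OF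
        bounded_bilinear_blinfun_compose]])
  moreover have "eventually (\<lambda>r. r > t / 2) (nhds t)" using t by (intro order_tendstoD[OF filterlim_ident]) simp
  then have "eventually (\<lambda>r. S' r = S' (t / 2) o\<^sub>L S (r - t / 2)) (nhds t)"
  proof eventually_elim
    case (elim r)
    then show ?case using t S'_add_right[of "t / 2" "r - t / 2"] by simp
  qed
  ultimately show "isCont S' t" by (simp add: isCont_cong)
qed

lemma orbit_in_generator_graph: "t > 0 \<Longrightarrow> (S t x, S' t x) \<in> generator_graph S"
proof -
  assume t: "t > 0"
  have "(\<lambda>h. norm (S (t + h) x - S t x - h *\<^sub>R S' t x) / norm h) \<midarrow>0\<rightarrow> 0"
    using deriv_apply[OF t, of x] unfolding has_vector_derivative_def has_derivative_at by simp
  then have "((\<lambda>h. norm (S (t + h) x - S t x - h *\<^sub>R S' t x) / norm h) \<longlongrightarrow> 0) (at_right 0)"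
    by (rule tendsto_within_subset) simp
  moreover have "eventually (\<lambda>h. norm (S (t + h) x - S t x - h *\<^sub>R S' t x) / norm h
      = norm ((S (t + h) x - S t x) /\<^sub>R h - S' t x)) (at_right 0)"
    using eventually_at_right_less[of 0]
  proof eventually_elim
    case (elim h)
    then have "(S (t + h) x - S t x) /\<^sub>R h - S' t x = (S (t + h) x - S t x - h *\<^sub>R S' t x) /\<^sub>R h"
      by (simp add: scaleR_diff_right)
    with elim show ?case by (simp add: divide_inverse)
  qed
  ultimately have "((\<lambda>h. norm ((S (t + h) x - S t x) /\<^sub>R h - S' t x)) \<longlongrightarrow> 0) (at_right 0)"
    by (rule Lim_transform_eventually)
  then have "((\<lambda>h. (S (t + h) x - S t x) /\<^sub>R h - S' t x) \<longlongrightarrow> 0) (at_right 0)"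
    by (rule tendsto_norm_zero_cancel)
  then have "((\<lambda>h. (S (t + h) x - S t x) /\<^sub>R h) \<longlongrightarrow> S' t x) (at_right 0)"
    by (simp add: LIM_zero_iff)
  moreover have "eventually (\<lambda>h. (S (t + h) x - S t x) /\<^sub>R h = (S h (S t x) - S t x) /\<^sub>R h) (at_right 0)"
    using eventually_at_right_less[of 0] by eventually_elim (use t S_add[of _ t] in \<open>simp add: add.commute\<close>)
  ultimately show ?thesis
    unfolding generator_graph_def by (auto elim: Lim_transform_eventually)
qed

text \<open>The semigroup commutes with its generator, since \<open>S(t)\<close> can be pulled out of the difference quotient.\<close>

lemma deriv_on_domain:
  assumes "(x, y) \<in> generator_graph S" "t > 0"
  shows "S' t x = S t y"
proof -
  have "((\<lambda>h. (S h x - x) /\<^sub>R h) \<longlongrightarrow> y) (at_right 0)"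
    using assms unfolding generator_graph_def by simp
  then have "((\<lambda>h. S t ((S h x - x) /\<^sub>R h)) \<longlongrightarrow> S t y) (at_right 0)"
    by (rule blinfun.tendsto[OF tendsto_const])
  moreover have "eventually (\<lambda>h. S t ((S h x - x) /\<^sub>R h) = (S h (S t x) - S t x) /\<^sub>R h) (at_right 0)"
    using eventually_at_right_less[of 0]
  proof eventually_elim
    case (elim h)
    have "S t (S h x) = S h (S t x)"
      using arg_cong[OF add.commute[of t h], of "\<lambda>r. S r x"] elim assms(2) by (simp add: S_add)
    then show ?case by (simp add: blinfun.scaleR_right blinfun.diff_right)
  qed
  ultimately have "(S t x, S t y) \<in> generator_graph S"
    unfolding generator_graph_def by (auto elim: Lim_transform_eventually)
  then show ?thesis using orbit_in_generator_graph[OF assms(2)] generator_graph_unique by blast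
qed

text \<open>The function \<open>exp (l t) S(t) e\<close> has derivative zero.\<close>

lemma S_eigenvector:
  assumes "(e, - (l *\<^sub>R e)) \<in> generator_graph S" "t \<ge> 0"
  shows "S t e = exp (- l * t) *\<^sub>R e"
proof (cases "t = 0")
  case False
  with assms have t: "t > 0" by simp
  define g where "g = (\<lambda>t. exp (l * t) *\<^sub>R S t e)"
  have "norm (g t - g 0) \<le> 0 - 0"
  proof (rule differentiable_bound_general[OF t])
    show "continuous_on {0..t} g" unfolding g_def
      by (intro continuous_intros continuous_on_subset[OF S_continuous]) auto
    show "(g has_vector_derivative 0) (at r)" if "0 < r" "r < t" for r
    proof -
      have "S' r e = - (l *\<^sub>R S r e)"
        using deriv_on_domain[OF assms(1) that(1)] by (simp add: blinfun.minus_right blinfun.scaleR_right)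
      then show ?thesis
        unfolding g_def using deriv_apply[OF that(1), of e]
        by (auto intro!: derivative_eq_intros simp: algebra_simps)
    qed
  qed (auto intro!: derivative_eq_intros)
  then have "exp (- l * t) *\<^sub>R g t = exp (- l * t) *\<^sub>R e" by (simp add: g_def)
  then show ?thesis by (simp add: g_def exp_minus_inverse exp_add[symmetric])
qed simp

end

lemma analytic_semigroup_smooth:
  assumes "analytic_semigroup S"
  obtains S' where "smooth_semigroup S S'"
proof -
  obtain \<delta> X Y where \<delta>: "0 < \<delta>"
    and XY: "\<forall>t>0. X (complex_of_real t) = S t \<and> Y (complex_of_real t) = 0"
      "\<forall>z\<in>sector \<delta>. \<exists>a b. (X has_derivative (\<lambda>h. Re h *\<^sub>R a - Im h *\<^sub>R b)) (at z) \<and>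
         (Y has_derivative (\<lambda>h. Re h *\<^sub>R b + Im h *\<^sub>R a)) (at z)"
    using assms unfolding analytic_semigroup_def by (elim conjE exE) (rule that, assumption+)
  then have X: "X (complex_of_real t) = S t" if "t > 0" for t using that by blast
  have d: "\<exists>a b. (X has_derivative (\<lambda>h. Re h *\<^sub>R a - Im h *\<^sub>R b)) (at z)" if "z \<in> sector \<delta>" for z
    using XY(2) that by blast
  have "\<exists>a. (S has_vector_derivative a) (at t)" if t: "t > 0" for t
  proof -
    have "complex_of_real t \<in> sector \<delta>" using t \<delta> by (simp add: sector_def)
    then obtain a b where X': "(X has_derivative (\<lambda>h. Re h *\<^sub>R a - Im h *\<^sub>R b)) (at (complex_of_real t))"
      using d by blast
    have "((\<lambda>r. X (complex_of_real r)) has_derivative (\<lambda>h. h *\<^sub>R a)) (at t)"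
      using has_derivative_compose[OF has_derivative_of_real[OF has_derivative_ident] X'] by simp
    moreover have "eventually (\<lambda>r. r > 0) (nhds t)" using t by (intro order_tendstoD[OF filterlim_ident])
    ultimately have "(S has_derivative (\<lambda>h. h *\<^sub>R a)) (at t)"
      by (elim has_derivative_transform_eventually)
         (use X t in \<open>auto simp: eventually_at_filter elim!: eventually_mono\<close>)
    then show ?thesis unfolding has_vector_derivative_def by blast
  qed
  then obtain S' where "\<And>t. t > 0 \<Longrightarrow> (S has_vector_derivative S' t) (at t)" by metis
  with assms show thesis by (intro that[of S'] smooth_semigroup.intro) (auto simp: analytic_semigroup_def)
qed

text \<open>Here \<open>-A\<close> is strictly positive and self-adjoint with compact inverse. In the eigenbasis
  \<open>S(t)\<close> acts by the factors \<open>exp (- l t)\<close>, so that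
  \<open>-A S(t) y = (-A)\<^sup>1\<^sup>-\<^sup>\<nu> S(t) (-A)\<^sup>\<nu> y\<close>; this turns the normalized estimates into the
  smoothing bound for \<open>A S(t)\<close> on the domain of \<open>(-A)\<^sup>\<nu>\<close>.\<close>

locale dissipative_semigroup = smooth_semigroup S S'
  for S S' :: "real \<Rightarrow> 'h::{real_inner,banach,second_countable_topology} \<Rightarrow>\<^sub>L 'h" +
  fixes A :: "'h \<Rightarrow> 'h" and DA :: "'h set" and lam :: real
  assumes selfadjoint: "selfadjoint_on DA (\<lambda>x. - A x)"
    and positive: "strictly_positive_on DA (\<lambda>x. - A x)"
    and inverse_compact: "has_compact_inverse DA (\<lambda>x. - A x)"
    and generator: "generator_graph S = {(x, A x) | x. x \<in> DA}"
    and estimates: "semigroup_estimates DA A S lam"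
    and lam_pos: "lam > 0"
begin

lemma A_S: "t > 0 \<Longrightarrow> S t x \<in> DA" "t > 0 \<Longrightarrow> A (S t x) = S' t x"
  using orbit_in_generator_graph[of t x] unfolding generator by auto

lemma S_norm: "t \<ge> 0 \<Longrightarrow> norm (S t) \<le> exp (- lam * t)"
  using estimates norm_blinfun_id_le unfolding semigroup_estimates_def by (cases "t = 0") auto

text \<open>\<open>S(t) = -T S'(t)\<close> for the compact inverse \<open>T\<close> of \<open>-A\<close>.\<close>

lemma S_compact: "t > 0 \<Longrightarrow> compact_operator (S t)"
proof -
  assume t: "t > 0"
  obtain T :: "'h \<Rightarrow>\<^sub>L 'h" where T: "compact_operator T" "\<And>x. x \<in> DA \<Longrightarrow> T (- A x) = x"
    using inverse_compact unfolding has_compact_inverse_def by auto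
  have eq: "S t x = T (- S' t x)" for x using T(2)[OF A_S(1)[OF t, of x]] A_S(2)[OF t] by simp
  show ?thesis unfolding compact_operator_def
  proof (intro allI impI)
    fix X :: "'h set" assume "bounded X"
    then have "bounded ((\<lambda>x. - S' t x) ` X)"
      by (intro bounded_linear_image bounded_linear_minus blinfun.bounded_linear_right)
    moreover have "S t ` X = T ` (\<lambda>x. - S' t x) ` X" using eq by (auto simp: image_image)
    ultimately show "compact (closure (S t ` X))" using T(1) unfolding compact_operator_def by metis
  qed
qed

abbreviation "basis \<equiv> some_eigenbasis DA (\<lambda>x. - A x)"
abbreviation "eigv e \<equiv> inner (- A e) e"
abbreviation "fdom \<equiv> frac_dom DA (\<lambda>x. - A x)"
abbreviation "fpow \<equiv> frac_pow DA (\<lambda>x. - A x)"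

lemma eigenbasis: "eigenbasis DA (\<lambda>x. - A x) basis"
  by (rule eigenbasis_some_eigenbasis[OF selfadjoint positive inverse_compact])

lemma basis: "orthonormal_basis basis" "e \<in> basis \<Longrightarrow> e \<in> DA"
  using eigenbasis unfolding eigenbasis_def by auto

lemma eigv: assumes "e \<in> basis" shows "A e = - (eigv e *\<^sub>R e)" "eigv e > 0"
proof -
  have e: "norm e = 1" using basis(1) assms unfolding orthonormal_basis_def by auto
  obtain l where "- A e = l *\<^sub>R e" using eigenbasis assms unfolding eigenbasis_def by blast
  moreover from this have "eigv e = l" using e by (metis inner_scaleR_left mult.right_neutral norm_eq_1)
  ultimately show "A e = - (eigv e *\<^sub>R e)" by (metis minus_minus)
  show "eigv e > 0" using positive basis(2)[OF assms] e unfolding strictly_positive_on_def by force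
qed

text \<open>Both sides are bounded functionals of \<open>x\<close> that agree on the eigenbasis.\<close>

lemma inner_S: assumes "e \<in> basis" "t \<ge> 0" shows "inner (S t x) e = exp (- eigv e * t) * inner x e"
proof (rule eq_on_basis[OF basis(1), where f="\<lambda>x. inner (S t x) e" and g="\<lambda>x. exp (- eigv e * t) * inner x e"])
  show "bounded_linear (\<lambda>x. inner (S t x) e)"
    by (intro bounded_linear_compose[OF bounded_linear_inner_left blinfun.bounded_linear_right])
  show "bounded_linear (\<lambda>x. exp (- eigv e * t) * inner x e)"
    by (intro bounded_linear_const_mult bounded_linear_inner_left)
  fix f assume f: "f \<in> basis"
  have "(f, - (eigv f *\<^sub>R f)) \<in> generator_graph S"
    unfolding generator using basis(2)[OF f] eigv(1)[OF f] by auto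
  from S_eigenvector[OF this assms(2)]
  show "inner (S t f) e = exp (- eigv e * t) * inner f e"
    using orthonormal_inner[OF orthonormal_basis_imp_orthonormal[OF basis(1)] f assms(1)]
    by auto
qed

lemma smoothing:
  assumes y: "y \<in> fdom \<nu>" and nu: "0 < \<nu>" "\<nu> < 1" and t: "t > 0"
  shows "norm (S' t y) \<le> t powr (\<nu> - 1) * exp (- lam * t) * norm (fpow \<nu> y)"
proof -
  define z where "z = fpow \<nu> y"
  have z: "inner z e = eigv e powr \<nu> * inner y e" if "e \<in> basis" for e
    using frac_pow_iff[OF eigenbasis, of y \<nu> z] y z_def that by auto
  have into: "bounded_into_frac DA (\<lambda>x. - A x) (1 - \<nu>) (S t)"
    and le: "frac_opnorm DA (\<lambda>x. - A x) (1 - \<nu>) (S t) \<le> t powr (- (1 - \<nu>)) * exp (- lam * t)"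
  proof -
    have "1 - \<nu> \<in> {0..<1}" using nu by auto
    then show "bounded_into_frac DA (\<lambda>x. - A x) (1 - \<nu>) (S t)"
      "frac_opnorm DA (\<lambda>x. - A x) (1 - \<nu>) (S t) \<le> t powr (- (1 - \<nu>)) * exp (- lam * t)"
      using estimates t unfolding semigroup_estimates_def by blast+
  qed
  define w where "w = fpow (1 - \<nu>) (S t z)"
  have w: "inner w e = eigv e powr (1 - \<nu>) * inner (S t z) e" if "e \<in> basis" for e
    using frac_pow_iff[OF eigenbasis, of "S t z" "1 - \<nu>" w] into w_def that
    unfolding bounded_into_frac_def by auto
  have "w = - A (S t y)"
  proof (rule basis_inner_eqI[OF basis(1)])
    fix e assume e: "e \<in> basis"
    have "inner (- A (S t y)) e = inner (S t y) (- A e)"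
      using selfadjoint A_S(1)[OF t] basis(2)[OF e] unfolding selfadjoint_on_def by blast
    also have "\<dots> = eigv e * inner (S t y) e" by (subst eigv(1)[OF e]) simp
    finally show "inner w e = inner (- A (S t y)) e"
      using eigv(2)[OF e] t by (simp add: w[OF e] z[OF e] inner_S[OF e] powr_diff)
  qed
  then have "norm (S' t y) = norm w" using A_S(2)[OF t] by simp
  also have "\<dots> \<le> frac_opnorm DA (\<lambda>x. - A x) (1 - \<nu>) (S t) * norm z"
    unfolding w_def frac_opnorm_def using into unfolding bounded_into_frac_def by (intro onorm) auto
  also have "\<dots> \<le> t powr (\<nu> - 1) * exp (- lam * t) * norm z"
    using le by (intro mult_right_mono) auto
  finally show ?thesis unfolding z_def .
qed

text \<open>The third normalized estimate with \<open>\<theta> = 0\<close> and \<open>t = 1\<close> bounds \<open>S(1) y - y\<close>, and \<open>S(1)\<close> is a strict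
  contraction.\<close>

lemma norm_le_fpow:
  assumes y: "y \<in> fdom \<nu>" and nu: "0 < \<nu>" "\<nu> < 1"
  shows "norm y \<le> norm (fpow \<nu> y) / (1 - exp (- lam))"
proof -
  have fpow0: "fpow 0 x = x" for x
    using frac_pow_iff[OF eigenbasis, of x 0 x] eigv(2) by force
  have "norm (fpow 0 (S 1 y - y)) \<le> 1 powr (\<nu> - 0) * norm (fpow \<nu> y)"
  proof -
    have "\<forall>t>0. \<forall>\<theta>\<ge>0. \<forall>\<sigma>\<in>{\<theta>..1 + \<theta>}. \<forall>x\<in>fdom \<sigma>. S t x - x \<in> fdom \<theta> \<and>
        norm (fpow \<theta> (S t x - x)) \<le> t powr (\<sigma> - \<theta>) * norm (fpow \<sigma> x)"
      using estimates unfolding semigroup_estimates_def by (elim conjE)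
    from this[rule_format, of 1 0 \<nu> y] show ?thesis using y nu by auto
  qed
  then have "norm (S 1 y - y) \<le> norm (fpow \<nu> y)" by (simp add: fpow0)
  moreover have "norm (S 1 y) \<le> exp (- lam) * norm y"
    using norm_blinfun[of "S 1" y] mult_right_mono[OF S_norm[of 1], of "norm y"] by simp
  moreover have "norm y \<le> norm (S 1 y - y) + norm (S 1 y)"
    using norm_triangle_ineq[of "y - S 1 y" "S 1 y"] by (simp add: norm_minus_commute)
  ultimately have "norm y * (1 - exp (- lam)) \<le> norm (fpow \<nu> y)" by (simp add: algebra_simps)
  then show ?thesis using lam_pos by (simp add: pos_le_divide_eq)
qed

end

section \<open>Segments of paths\<close>

lemma hist_apply:
  fixes u :: "real \<Rightarrow> 'h::real_normed_vector"
  assumes "continuous_on {t - \<mu>..t} u" "0 \<le> \<mu>"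
  shows "apply_bcontfun (hist \<mu> u t) s = u (t + max (- \<mu>) (min s 0))"
proof -
  have "(\<lambda>s. u (t + max (- \<mu>) (min s 0))) \<in> bcontfun"
    unfolding bcontfun_def
  proof (intro CollectI conjI)
    show "continuous_on UNIV (\<lambda>s. u (t + max (- \<mu>) (min s 0)))"
      by (rule continuous_on_compose2[OF assms(1)]) (use assms(2) in \<open>auto intro!: continuous_intros\<close>)
    have "range (\<lambda>s. u (t + max (- \<mu>) (min s 0))) \<subseteq> u ` {t - \<mu>..t}"
      using assms(2) by auto
    moreover have "bounded (u ` {t - \<mu>..t})"
      by (intro compact_imp_bounded compact_continuous_image assms(1)) simp
    ultimately show "bounded (range (\<lambda>s. u (t + max (- \<mu>) (min s 0))))" using bounded_subset by blast
  qed
  then show ?thesis unfolding hist_def by (simp add: Bcontfun_inverse)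
qed

lemma hist_in_Cmu:
  fixes u :: "real \<Rightarrow> 'h::real_normed_vector"
  assumes "continuous_on {t - \<mu>..t} u" "0 \<le> \<mu>"
  shows "hist \<mu> u t \<in> Cmu \<mu>"
  unfolding Cmu_def by (auto simp: hist_apply[OF assms] max_def min_def)

lemma norm_hist_diff_le:
  fixes u v :: "real \<Rightarrow> 'h::real_normed_vector"
  assumes "continuous_on {t - \<mu>..t} u" "continuous_on {r - \<mu>..r} v" "0 \<le> \<mu>"
    and "\<And>s. s \<in> {- \<mu>..0} \<Longrightarrow> norm (u (t + s) - v (r + s)) \<le> b"
  shows "norm (hist \<mu> u t - hist \<mu> v r) \<le> b"
  by (rule norm_bound) (use assms in \<open>auto simp: hist_apply\<close>)

lemma norm_hist_le:
  fixes u :: "real \<Rightarrow> 'h::real_normed_vector"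
  assumes "continuous_on {t - \<mu>..t} u" "0 \<le> \<mu>" "\<And>s. s \<in> {t - \<mu>..t} \<Longrightarrow> norm (u s) \<le> b"
  shows "norm (hist \<mu> u t) \<le> b"
  by (rule norm_bound) (use assms in \<open>auto simp: hist_apply\<close>)

lemma norm_le_hist:
  fixes u :: "real \<Rightarrow> 'h::real_normed_vector"
  assumes "continuous_on {t - \<mu>..t} u" "0 \<le> \<mu>" "s \<in> {t - \<mu>..t}"
  shows "norm (u s) \<le> norm (hist \<mu> u t)"
  using norm_bounded[of "hist \<mu> u t" "s - t"] assms by (simp add: hist_apply)

lemma hist_cong:
  assumes "\<And>s. s \<in> {t - \<mu>..t} \<Longrightarrow> u s = v s" "0 \<le> \<mu>"
  shows "hist \<mu> u t = hist \<mu> v t"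
  unfolding hist_def using assms by (intro arg_cong[of _ _ Bcontfun] ext) auto

lemma hist_eq_initial:
  fixes u :: "real \<Rightarrow> 'h::real_normed_vector"
  assumes "\<xi> \<in> Cmu \<mu>" "\<And>s. s \<in> {- \<mu>..0} \<Longrightarrow> u s = \<xi> s" "0 \<le> \<mu>"
  shows "hist \<mu> u 0 = \<xi>"
proof -
  have "(\<lambda>s. u (0 + max (- \<mu>) (min s 0))) = apply_bcontfun \<xi>"
    using assms unfolding Cmu_def by (auto simp: fun_eq_iff)
  then show ?thesis unfolding hist_def by (simp add: apply_bcontfun_inverse)
qed

lemma hist_shift: "hist \<mu> (\<lambda>s. u (s + \<tau>)) t = hist \<mu> u (t + \<tau>)"
  unfolding hist_def by (simp add: ac_simps)

lemma continuous_on_hist: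
  fixes u :: "real \<Rightarrow> 'h::real_normed_vector"
  assumes u: "continuous_on {- \<mu>..} u" and "0 \<le> \<mu>"
  shows "continuous_on {0..} (hist \<mu> u)"
  unfolding continuous_on_iff
proof (intro ballI allI impI)
  fix t \<epsilon> :: real assume t: "t \<in> {0..}" and "\<epsilon> > 0"
  have "uniformly_continuous_on {- \<mu>..t + 1} u"
    by (intro compact_uniformly_continuous continuous_on_subset[OF u]) auto
  then obtain d where d: "d > 0" "\<And>x y. x \<in> {- \<mu>..t + 1} \<Longrightarrow> y \<in> {- \<mu>..t + 1} \<Longrightarrow> dist y x < d
      \<Longrightarrow> dist (u y) (u x) < \<epsilon> / 2"
    unfolding uniformly_continuous_on_def using \<open>\<epsilon> > 0\<close> by (meson half_gt_zero)
  have "dist (hist \<mu> u r) (hist \<mu> u t) < \<epsilon>" if r: "r \<in> {0..}" "dist r t < min d 1" for r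
  proof -
    have "norm (hist \<mu> u r - hist \<mu> u t) \<le> \<epsilon> / 2"
    proof (rule norm_hist_diff_le)
      fix s assume s: "s \<in> {- \<mu>..0}"
      have "dist (u (r + s)) (u (t + s)) < \<epsilon> / 2"
        using r t s by (intro d(2)) (auto simp: dist_real_def)
      then show "norm (u (r + s) - u (t + s)) \<le> \<epsilon> / 2" by (simp add: dist_norm)
    qed (use assms t r in \<open>auto intro!: continuous_on_subset[OF u]\<close>)
    then show ?thesis using \<open>\<epsilon> > 0\<close> by (simp add: dist_norm)
  qed
  then show "\<exists>d>0. \<forall>r\<in>{0..}. dist r t < d \<longrightarrow> dist (hist \<mu> u r) (hist \<mu> u t) < \<epsilon>"
    using d(1) by (intro exI[of _ "min d 1"]) auto
qed

lemma closed_Cmu: "closed (Cmu \<mu> :: (real \<Rightarrow>\<^sub>C 'h::real_normed_vector) set)"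
proof -
  have "closed {x :: real \<Rightarrow>\<^sub>C 'h. apply_bcontfun x s = apply_bcontfun x r}" for s r
  proof (rule closed_Collect_eq)
    have "bounded_linear (\<lambda>x :: real \<Rightarrow>\<^sub>C 'h. apply_bcontfun x q)" for q
      by (rule bounded_linear_intro[where K=1]) (auto simp: norm_bounded)
    then show "continuous_on UNIV (\<lambda>x :: real \<Rightarrow>\<^sub>C 'h. apply_bcontfun x s)"
      "continuous_on UNIV (\<lambda>x :: real \<Rightarrow>\<^sub>C 'h. apply_bcontfun x r)"
      by (auto intro: linear_continuous_on)
  qed
  moreover have "Cmu \<mu> = (\<Inter>s. {x :: real \<Rightarrow>\<^sub>C 'h. apply_bcontfun x s = apply_bcontfun x (max (- \<mu>) (min s 0))})"
    by (auto simp: Cmu_def)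
  ultimately show ?thesis by (auto intro!: closed_INT)
qed

section \<open>Integrals with a weakly singular kernel\<close>

lemma nn_integral_indicator_has_integral:
  fixes f :: "real \<Rightarrow> real"
  assumes I: "(f has_integral I) A" and [measurable]: "f \<in> borel_measurable borel" "A \<in> sets borel"
    and nonneg: "\<And>x. 0 \<le> f x"
  shows "(\<integral>\<^sup>+s. ennreal (indicator A s * f s) \<partial>lborel) = ennreal I"
proof (rule nn_integral_has_integral_lborel)
  have "(\<lambda>s. indicator A s * f s) = (\<lambda>s. if s \<in> A then f s else 0)"
    by (auto simp: fun_eq_iff)
  then show "((\<lambda>s. indicator A s * f s) has_integral I) UNIV"
    using I by (simp add: has_integral_restrict_UNIV)
qed (use nonneg in auto)

text \<open>The range of integration is split at \<open>1 / a\<close>: before this point the exponential is bounded by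
  \<open>1\<close>, after it the power by its value there.\<close>

lemma nn_integral_kernel:
  fixes a c0 c1 \<nu> :: real
  assumes nu: "0 < \<nu>" "\<nu> \<le> 1" and a: "a > 0" and c: "0 \<le> c0" "0 \<le> c1"
  shows "(\<integral>\<^sup>+s. ennreal (indicator {0..t} s * ((c1 * s powr (\<nu> - 1) + c0) * exp (- a * s))) \<partial>lborel)
    \<le> ennreal (c1 * (a powr (- \<nu>) * (1 + 1 / \<nu>)) + c0 / a)"
proof -
  define d where "d = 1 / a"
  have d: "d > 0" using a by (simp add: d_def)
  have "((\<lambda>s. s powr (\<nu> - 1)) has_integral (d powr \<nu> / \<nu>)) {0..d}"
    using has_integral_powr_from_0[of "\<nu> - 1" d] nu d by simp
  then have I1: "(\<integral>\<^sup>+s. ennreal (indicator {0..d} s * s powr (\<nu> - 1)) \<partial>lborel) = ennreal (d powr \<nu> / \<nu>)"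
    using d nu by (intro nn_integral_indicator_has_integral) auto
  have "((\<lambda>s. exp (- a * s)) has_integral (exp (- a * 0) / a)) {0..}"
    using has_integral_exp_minus_to_infinity[OF a, of 0] by simp
  then have I2: "(\<integral>\<^sup>+s. ennreal (indicator {0..} s * exp (- a * s)) \<partial>lborel) = ennreal (1 / a)"
    using a by (intro nn_integral_indicator_has_integral) auto
  define b where "b = c1 * d powr (\<nu> - 1) + c0"
  have b: "b \<ge> 0" using c by (simp add: b_def)
  have "(\<integral>\<^sup>+s. ennreal (indicator {0..t} s * ((c1 * s powr (\<nu> - 1) + c0) * exp (- a * s))) \<partial>lborel)
    \<le> (\<integral>\<^sup>+s. ennreal c1 * ennreal (indicator {0..d} s * s powr (\<nu> - 1)) +
          ennreal b * ennreal (indicator {0..} s * exp (- a * s)) \<partial>lborel)"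
  proof (rule nn_integral_mono)
    fix s :: real
    have le: "(c1 * s powr (\<nu> - 1) + c0) * exp (- a * s)
        \<le> c1 * (indicator {0..d} s * s powr (\<nu> - 1)) + b * exp (- a * s)" if s: "s \<ge> 0"
    proof (cases "s \<le> d")
      case True
      have "c1 * s powr (\<nu> - 1) * exp (- a * s) \<le> c1 * s powr (\<nu> - 1) * 1"
        using c a s by (intro mult_left_mono) auto
      moreover have "c0 * exp (- a * s) \<le> b * exp (- a * s)"
        using c by (intro mult_right_mono) (auto simp: b_def)
      ultimately have "(c1 * s powr (\<nu> - 1) + c0) * exp (- a * s) \<le> c1 * s powr (\<nu> - 1) * 1 + b * exp (- a * s)"
        unfolding distrib_right by (rule add_mono)
      then show ?thesis using True s by simp
    next
      case False
      have "s powr (\<nu> - 1) \<le> d powr (\<nu> - 1)"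
        using False d nu by (intro powr_mono2') auto
      then have "c1 * s powr (\<nu> - 1) + c0 \<le> b" unfolding b_def using c by (intro add_mono mult_left_mono) auto
      then show ?thesis using False by (simp add: mult_right_mono)
    qed
    have "ennreal (indicator {0..t} s * ((c1 * s powr (\<nu> - 1) + c0) * exp (- a * s)))
        \<le> ennreal (c1 * (indicator {0..d} s * s powr (\<nu> - 1)) + b * (indicator {0..} s * exp (- a * s)))"
      using le b c by (intro ennreal_leI) (auto split: split_indicator)
    also have "\<dots> = ennreal c1 * ennreal (indicator {0..d} s * s powr (\<nu> - 1)) +
          ennreal b * ennreal (indicator {0..} s * exp (- a * s))"
      using b c by (simp add: ennreal_plus ennreal_mult)
    finally show "ennreal (indicator {0..t} s * ((c1 * s powr (\<nu> - 1) + c0) * exp (- a * s))) \<le> \<dots>" .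
  qed
  also have "\<dots> = ennreal c1 * ennreal (d powr \<nu> / \<nu>) + ennreal b * ennreal (1 / a)"
    by (subst nn_integral_add) (auto simp: nn_integral_cmult I1 I2[simplified])
  also have "\<dots> = ennreal (c1 * (d powr \<nu> / \<nu>) + b * (1 / a))"
    using b c a nu by (simp add: ennreal_mult'[symmetric] ennreal_plus[symmetric] del: ennreal_plus)
  also have "c1 * (d powr \<nu> / \<nu>) + b * (1 / a) = c1 * (a powr (- \<nu>) * (1 + 1 / \<nu>)) + c0 / a"
  proof -
    have "d powr \<nu> = a powr (- \<nu>)" and "d powr (\<nu> - 1) / a = a powr (- \<nu>)"
      using a by (simp_all add: d_def powr_divide powr_minus_divide powr_diff field_simps)
    moreover from this(2) have "c1 * d powr (\<nu> - 1) / a = c1 * a powr (- \<nu>)"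
      by (metis times_divide_eq_right)
    ultimately show ?thesis by (simp add: b_def add_divide_distrib distrib_left)
  qed
  finally show ?thesis .
qed

text \<open>The value of \<open>f\<close> at the singular point \<open>0\<close> is arbitrary, hence continuity on \<open>{0<..t}\<close> only.\<close>

lemma kernel_integral:
  fixes f :: "real \<Rightarrow> 'b::{banach,second_countable_topology}" and a c0 c1 \<nu> :: real
  assumes nu: "0 < \<nu>" "\<nu> \<le> 1" and a: "a > 0" and c: "0 \<le> c0" "0 \<le> c1"
    and f: "continuous_on {0<..t} f"
    and le: "\<And>s. 0 < s \<Longrightarrow> s \<le> t \<Longrightarrow> norm (f s) \<le> (c1 * s powr (\<nu> - 1) + c0) * exp (- a * s)"
  shows "set_integrable lborel {0..t} f"
    and "norm (LINT s:{0..t}|lborel. f s) \<le> c1 * (a powr (- \<nu>) * (1 + 1 / \<nu>)) + c0 / a"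
proof -
  have "(\<lambda>s. indicator {0<..t} s *\<^sub>R f s + indicator ({0} \<inter> {0..t}) s *\<^sub>R f 0) \<in> borel_measurable borel"
    by (intro borel_measurable_add borel_measurable_continuous_on_indicator f
        borel_measurable_scaleR borel_measurable_indicator borel_measurable_const) auto
  moreover have "(\<lambda>s. indicator {0<..t} s *\<^sub>R f s + indicator ({0} \<inter> {0..t}) s *\<^sub>R f 0)
      = (\<lambda>s. indicator {0..t} s *\<^sub>R f s)"
    by (auto simp: fun_eq_iff split: split_indicator)
  ultimately have meas: "(\<lambda>s. indicator {0..t} s *\<^sub>R f s) \<in> borel_measurable lborel" by simp
  have "AE s in lborel. s \<noteq> (0::real)" by (rule AE_lborel_singleton)
  then have "(\<integral>\<^sup>+s. ennreal (norm (indicator {0..t} s *\<^sub>R f s)) \<partial>lborel)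
    \<le> (\<integral>\<^sup>+s. ennreal (indicator {0..t} s * ((c1 * s powr (\<nu> - 1) + c0) * exp (- a * s))) \<partial>lborel)"
    by (intro nn_integral_mono_AE, eventually_elim)
       (use le in \<open>auto intro!: ennreal_leI split: split_indicator\<close>)
  also note nn_integral_kernel[OF nu a c]
  finally have bound: "(\<integral>\<^sup>+s. ennreal (norm (indicator {0..t} s *\<^sub>R f s)) \<partial>lborel)
    \<le> ennreal (c1 * (a powr (- \<nu>) * (1 + 1 / \<nu>)) + c0 / a)" .
  then show int: "set_integrable lborel {0..t} f"
    unfolding set_integrable_def by (intro integrableI_bounded meas) (auto simp: le_less_trans)
  have "ennreal (norm (LINT s:{0..t}|lborel. f s)) \<le> ennreal (c1 * (a powr (- \<nu>) * (1 + 1 / \<nu>)) + c0 / a)"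
    using integral_norm_bound_ennreal[OF int[unfolded set_integrable_def]] bound
    unfolding set_lebesgue_integral_def by simp
  then show "norm (LINT s:{0..t}|lborel. f s) \<le> c1 * (a powr (- \<nu>) * (1 + 1 / \<nu>)) + c0 / a"
    using c a nu by (subst (asm) ennreal_le_iff) auto
qed

lemma reflect_integral:
  fixes f :: "real \<Rightarrow> 'b::{banach,second_countable_topology}"
  shows "set_integrable lborel {0..t} (\<lambda>r. f (t - r)) \<longleftrightarrow> set_integrable lborel {0..t} f"
    and "(LINT r:{0..t}|lborel. f (t - r)) = (LINT s:{0..t}|lborel. f s)"
proof -
  have eq: "indicator {0..t} r *\<^sub>R f (t - r) = indicator {0..t} (t + - 1 * r) *\<^sub>R f (t + - 1 * r)" for r
    by (auto split: split_indicator)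
  show "set_integrable lborel {0..t} (\<lambda>r. f (t - r)) \<longleftrightarrow> set_integrable lborel {0..t} f"
    unfolding set_integrable_def eq by (rule lborel_integrable_real_affine_iff) simp
  show "(LINT r:{0..t}|lborel. f (t - r)) = (LINT s:{0..t}|lborel. f s)"
    unfolding set_lebesgue_integral_def eq
    using lborel_integral_real_affine[of "-1" "\<lambda>s. indicator {0..t} s *\<^sub>R f s" t] by simp
qed

lemma split_integral:
  fixes f :: "real \<Rightarrow> 'b::{banach,second_countable_topology}"
  assumes "set_integrable lborel {0..t + \<tau>} f" "0 \<le> t" "0 \<le> \<tau>"
  shows "(LINT s:{0..t + \<tau>}|lborel. f s) = (LINT s:{0..t}|lborel. f s) + (LINT s:{0..\<tau>}|lborel. f (t + s))"
proof -
  have "(LINT s:{0..t + \<tau>}|lborel. f s) = (LINT s:{0..t} \<union> {t..t + \<tau>}|lborel. f s)"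
    using assms by (simp add: ivl_disj_un_two_touch)
  also have "\<dots> = (LINT s:{0..t}|lborel. f s) + (LINT s:{t..t + \<tau>}|lborel. f s)"
  proof (rule set_integral_Un_AE)
    have "AE s in lborel. s \<noteq> t" by (rule AE_lborel_singleton)
    then show "AE s in lborel. \<not> (s \<in> {0..t} \<and> s \<in> {t..t + \<tau>})" by eventually_elim auto
  qed (use assms in \<open>auto intro: set_integrable_subset[OF assms(1)]\<close>)
  also have "(LINT s:{t..t + \<tau>}|lborel. f s) = (LINT s:{0..\<tau>}|lborel. f (t + s))"
  proof -
    have "indicator {0..\<tau>} s *\<^sub>R f (t + s) = indicator {t..t + \<tau>} (t + 1 * s) *\<^sub>R f (t + 1 * s)" for s
      by (auto split: split_indicator)
    then have eq: "indicator {0..\<tau>} s *\<^sub>R f (t + s) = indicator {t..t + \<tau>} (t + s) *\<^sub>R f (t + s)" for s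
      by simp
    show ?thesis unfolding set_lebesgue_integral_def eq
      using lborel_integral_real_affine[of 1 "\<lambda>s. indicator {t..t + \<tau>} s *\<^sub>R f s" t] by simp
  qed
  finally show ?thesis .
qed

lemma continuous_on_kernel_conv:
  fixes P :: "real \<Rightarrow> 'a::real_normed_vector \<Rightarrow>\<^sub>L 'b::{banach,second_countable_topology}"
  assumes P: "continuous_on {0<..} P" and g: "continuous_on {0..} g"
  shows "continuous_on {0<..t} (\<lambda>s. P s (g (t - s)))"
  by (intro bounded_bilinear.continuous_on[OF bounded_bilinear_blinfun_apply]
      continuous_on_subset[OF P] continuous_on_compose2[OF g] continuous_intros) auto

text \<open>In the form \<open>\<integral> P(s) g(t - s) ds\<close> the singular factor does not depend on \<open>t\<close>, and dominated
  convergence applies.\<close>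

lemma continuous_on_convolution:
  fixes P :: "real \<Rightarrow> 'a::real_normed_vector \<Rightarrow>\<^sub>L 'b::{banach,second_countable_topology}"
  assumes nu: "0 < \<nu>" "\<nu> \<le> 1" and P: "continuous_on {0<..} P" and g: "continuous_on {0..} g"
    and le: "\<And>T. \<exists>c\<ge>0. \<forall>s\<in>{0<..T}. \<forall>r\<in>{0..T}. norm (P s (g r)) \<le> c * (s powr (\<nu> - 1) + 1)"
  shows "continuous_on {0..} (\<lambda>t. LINT s:{0..t}|lborel. P s (g (t - s)))"
  unfolding continuous_on_sequentially comp_def
proof (intro allI ballI impI)
  fix x :: "nat \<Rightarrow> real" and a assume a: "a \<in> {0..}" and x: "(\<forall>n. x n \<in> {0..}) \<and> x \<longlonglongrightarrow> a"
  obtain T where T: "\<And>n. x n \<le> T" 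
    using convergent_imp_bounded[of x a] x unfolding bounded_iff by (auto simp: abs_le_iff)
  have aT: "a \<le> T" using x T by (intro LIMSEQ_le_const2) auto
  obtain c where c: "c \<ge> 0" "\<And>s r. s \<in> {0<..T} \<Longrightarrow> r \<in> {0..T} \<Longrightarrow> norm (P s (g r)) \<le> c * (s powr (\<nu> - 1) + 1)"
    using le[of T] by blast
  have T0: "T \<ge> 0" using a aT by simp
  have w: "set_integrable lborel {0..T} (\<lambda>s. c * (s powr (\<nu> - 1) + 1))"
  proof (rule kernel_integral(1)[OF nu, of 1 "c * exp T" "c * exp T"])
    show "norm (c * (s powr (\<nu> - 1) + 1)) \<le> (c * exp T * s powr (\<nu> - 1) + c * exp T) * exp (- 1 * s)"
      if "0 < s" "s \<le> T" for s
    proof -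
      have "c * (s powr (\<nu> - 1) + 1) * 1 \<le> c * (s powr (\<nu> - 1) + 1) * exp (T - s)"
        using that c(1) by (intro mult_left_mono) auto
      then show ?thesis using c(1) by (simp add: exp_diff exp_minus field_simps)
    qed
  qed (use c in \<open>auto intro!: continuous_intros\<close>)
  show "(\<lambda>n. LINT s:{0..x n}|lborel. P s (g (x n - s))) \<longlonglongrightarrow> (LINT s:{0..a}|lborel. P s (g (a - s)))"
    unfolding set_lebesgue_integral_def
  proof (rule integral_dominated_convergence[where w="\<lambda>s. indicator {0..T} s *\<^sub>R (c * (s powr (\<nu> - 1) + 1))"])
    have int: "set_integrable lborel {0..y} (\<lambda>s. P s (g (y - s)))" if "y \<in> {0..T}" for y
    proof (rule kernel_integral(1)[OF nu, of 1 "c * exp T" "c * exp T"])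
      show "norm (P s (g (y - s))) \<le> (c * exp T * s powr (\<nu> - 1) + c * exp T) * exp (- 1 * s)"
        if "0 < s" "s \<le> y" for s
      proof -
        have "norm (P s (g (y - s))) \<le> c * (s powr (\<nu> - 1) + 1) * 1"
          using c(2)[of s "y - s"] that \<open>y \<in> {0..T}\<close> by simp
        also have "c * (s powr (\<nu> - 1) + 1) * 1 \<le> c * (s powr (\<nu> - 1) + 1) * exp (T - s)"
          using that c(1) \<open>y \<in> {0..T}\<close> by (intro mult_left_mono) auto
        finally show ?thesis by (simp add: exp_diff exp_minus field_simps)
      qed
    qed (use c continuous_on_kernel_conv[OF P g] in auto)
    show "(\<lambda>s. indicator {0..a} s *\<^sub>R P s (g (a - s))) \<in> borel_measurable lborel"
      using int[of a] a aT unfolding set_integrable_def by auto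
    show "(\<lambda>s. indicator {0..x n} s *\<^sub>R P s (g (x n - s))) \<in> borel_measurable lborel" for n
      using int[of "x n"] x T unfolding set_integrable_def by auto
    show "integrable lborel (\<lambda>s. indicator {0..T} s *\<^sub>R (c * (s powr (\<nu> - 1) + 1)))"
      using w unfolding set_integrable_def .
    have AE0: "AE s in lborel. s \<noteq> 0" "AE s in lborel. s \<noteq> a" by (rule AE_lborel_singleton)+
    show "AE s in lborel. norm (indicator {0..x n} s *\<^sub>R P s (g (x n - s)))
        \<le> indicator {0..T} s *\<^sub>R (c * (s powr (\<nu> - 1) + 1))" for n
      using AE0(1)
    proof eventually_elim
      case (elim s)
      have "norm (P s (g (x n - s))) \<le> c * (s powr (\<nu> - 1) + 1)" if "0 \<le> s" "s \<le> x n"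
        using that elim T[of n] by (intro c(2)) auto
      then show ?case using T[of n] c(1) by (auto split: split_indicator)
    qed
    show "AE s in lborel. (\<lambda>n. indicator {0..x n} s *\<^sub>R P s (g (x n - s))) \<longlonglongrightarrow> indicator {0..a} s *\<^sub>R P s (g
        (a - s))"
      using AE0
    proof eventually_elim
      case (elim s)
      have xa: "x \<longlonglongrightarrow> a" using x by simp
      consider "s < 0" | "0 < s" "s < a" | "s > a" "s > 0" using elim by linarith
      then show ?case
      proof cases
        case 1 then show ?thesis by simp
      next
        case 2
        have ev: "eventually (\<lambda>n. x n > s) sequentially" by (rule order_tendstoD(1)[OF xa 2(2)])
        have "(\<lambda>n. g (x n - s)) \<longlonglongrightarrow> g (a - s)"
          by (rule continuous_on_tendsto_compose[OF g])
             (use 2 ev in \<open>auto intro!: tendsto_intros xa elim!: eventually_mono\<close>)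
        then have "(\<lambda>n. P s (g (x n - s))) \<longlonglongrightarrow> P s (g (a - s))"
          by (rule blinfun.tendsto[OF tendsto_const])
        moreover have "eventually (\<lambda>n. P s (g (x n - s))
            = indicator {0..x n} s *\<^sub>R P s (g (x n - s))) sequentially"
          using ev by eventually_elim (use 2 in auto)
        ultimately show ?thesis using 2 by (auto intro: Lim_transform_eventually)
      next
        case 3
        have "eventually (\<lambda>n. x n < s) sequentially" by (rule order_tendstoD(2)[OF xa 3(1)])
        then have "eventually (\<lambda>n. 0 = indicator {0..x n} s *\<^sub>R P s (g (x n - s))) sequentially"
          by eventually_elim auto
        then show ?thesis using 3 by (auto intro: Lim_transform_eventually[OF tendsto_const])
      qed
    qed
  qed
qed

text \<open>Paired with a fixed vector \<open>v\<close>, the claim is the fundamental theorem for the scalar function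
  \<open>\<langle>\<phi>, v\<rangle>\<close>, and these pairings determine a vector.\<close>

lemma FTC_inner:
  fixes \<phi> \<phi>' :: "real \<Rightarrow> 'h::{real_inner,banach,second_countable_topology}"
  assumes t: "0 \<le> t" and cont: "continuous_on {0..t} \<phi>"
    and d: "\<And>s. 0 < s \<Longrightarrow> s < t \<Longrightarrow> (\<phi> has_vector_derivative \<phi>' s) (at s)"
    and cont': "continuous_on {0<..<t} \<phi>'" and int: "set_integrable lborel {0..t} \<phi>'"
  shows "(LINT s:{0..t}|lborel. \<phi>' s) = \<phi> t - \<phi> 0"
proof (cases "t = 0")
  case True
  have "(LINT s:{0..0}|lborel. \<phi>' s) = (LINT s:{}|lborel. \<phi>' s)"
  proof (rule set_integral_cong_set)
    have "(\<lambda>x. indicat_real {0} x *\<^sub>R \<phi>' x) = (\<lambda>x. indicat_real {0} x *\<^sub>R \<phi>' 0)"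
      by (auto simp: fun_eq_iff split: split_indicator)
    then show "set_borel_measurable lborel {0..0} \<phi>'" by (simp add: set_borel_measurable_def)
    show "AE x in lborel. (x \<in> {}) = (x \<in> {0..0::real})"
      using AE_lborel_singleton[of "0::real"] by eventually_elim auto
  qed (simp add: set_borel_measurable_def)
  then show ?thesis using True by (simp add: set_lebesgue_integral_def)
next
  case False
  with t have t: "t > 0" by simp
  have "inner (LINT s:{0..t}|lborel. \<phi>' s) v = inner (\<phi> t - \<phi> 0) v" for v
  proof -
    have bl: "bounded_linear (\<lambda>x. inner x v)" by (rule bounded_linear_inner_left)
    have int': "set_integrable lborel {0..t} (\<lambda>s. inner (\<phi>' s) v)"
      using integrable_bounded_linear[OF bl int[unfolded set_integrable_def]] unfolding set_integrable_def
          by simp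
    have "inner (LINT s:{0..t}|lborel. \<phi>' s) v = (LINT s:{0..t}|lborel. inner (\<phi>' s) v)"
      using integral_bounded_linear[OF bl int[unfolded set_integrable_def]]
      unfolding set_lebesgue_integral_def by simp
    also have "\<dots> = (LBINT s=ereal 0..ereal t. inner (\<phi>' s) v)"
      using t by (subst interval_integral_Icc) auto
    also have "\<dots> = inner (\<phi> t) v - inner (\<phi> 0) v"
    proof (rule interval_integral_FTC_integrable)
      show "((\<lambda>s. inner (\<phi> s) v) has_vector_derivative inner (\<phi>' s) v) (at s)"
        if "ereal 0 < ereal s" "ereal s < ereal t" for s
        using that by (intro bounded_linear.has_vector_derivative[OF bl] d) auto
      show "isCont (\<lambda>s. inner (\<phi>' s) v) s" if "ereal 0 < ereal s" "ereal s < ereal t" for s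
        using cont' that by (intro isCont_inner continuous_const) (auto simp: continuous_on_eq_continuous_at)
      show "set_integrable lborel (einterval (ereal 0) (ereal t)) (\<lambda>s. inner (\<phi>' s) v)"
        by (rule set_integrable_subset[OF int']) auto
      have c: "continuous_on {0..t} (\<lambda>s. inner (\<phi> s) v)" using cont by (intro continuous_intros)
      have "((\<lambda>s. inner (\<phi> s) v) \<longlongrightarrow> inner (\<phi> 0) v) (at_right 0)"
        using continuous_on_Icc_at_rightD[OF c t] by simp
      then show "(((\<lambda>s. inner (\<phi> s) v) \<circ> real_of_ereal) \<longlongrightarrow> inner (\<phi> 0) v) (at_right (ereal 0))"
        by (simp add: ereal_tendsto_simps)
      have "((\<lambda>s. inner (\<phi> s) v) \<longlongrightarrow> inner (\<phi> t) v) (at_left t)"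
        using continuous_on_Icc_at_leftD[OF c t] by simp
      then show "(((\<lambda>s. inner (\<phi> s) v) \<circ> real_of_ereal) \<longlongrightarrow> inner (\<phi> t) v) (at_left (ereal t))"
        by (simp add: ereal_tendsto_simps)
    qed (use t in auto)
    finally show ?thesis by (simp add: inner_diff_left)
  qed
  then show ?thesis by (metis vector_eq_rdot)
qed

section \<open>Pathwise mild solutions\<close>

text \<open>The part of the hypotheses on the equation that the dynamics depends on. The fractional powers
  enter only through the two smoothing bounds for \<open>S'(t) G(x)\<close>; all bounds share the constant \<open>C\<close> and
  all Lipschitz conditions the constant \<open>L\<close>, except that the growth rate \<open>cF\<close> of \<open>F\<close> is kept apart, as
  it competes with the decay rate \<open>lam\<close>.\<close>

locale delay_equation = smooth_semigroup S S'
  for S S' :: "real \<Rightarrow> 'h::{real_inner,banach,second_countable_topology} \<Rightarrow>\<^sub>L 'h" +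
  fixes F :: "(real \<Rightarrow>\<^sub>C 'h) \<Rightarrow> 'h"
    and G K :: "(real \<Rightarrow>\<^sub>C 'h) \<Rightarrow> 'u::{real_inner,banach,second_countable_topology} \<Rightarrow>\<^sub>L 'h"
    and \<mu> lam \<nu> C L cF :: real
  assumes mu: "\<mu> > 0" and lam: "lam > 0" and nu: "0 < \<nu>" "\<nu> < 1"
    and C: "C \<ge> 0" and L: "L \<ge> 0" and cF: "0 \<le> cF" "cF < lam"
    and S_norm: "\<And>t. t \<ge> 0 \<Longrightarrow> norm (S t) \<le> exp (- lam * t)"
    and S_compact: "\<And>t. t > 0 \<Longrightarrow> compact_operator (S t)"
    and F_lip: "\<And>x y. x \<in> Cmu \<mu> \<Longrightarrow> y \<in> Cmu \<mu> \<Longrightarrow> norm (F x - F y) \<le> L * norm (x - y)"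
    and F_growth: "\<And>x. x \<in> Cmu \<mu> \<Longrightarrow> norm (F x) \<le> C + cF * norm x"
    and G_smooth: "\<And>x t v. x \<in> Cmu \<mu> \<Longrightarrow> t > 0 \<Longrightarrow>
          norm (S' t (G x v)) \<le> C * t powr (\<nu> - 1) * exp (- lam * t) * norm v"
    and G_smooth_lip: "\<And>x y t v. x \<in> Cmu \<mu> \<Longrightarrow> y \<in> Cmu \<mu> \<Longrightarrow> t > 0 \<Longrightarrow>
          norm (S' t (G x v - G y v)) \<le> L * norm (x - y) * t powr (\<nu> - 1) * norm v"
    and G_bound: "\<And>x. x \<in> Cmu \<mu> \<Longrightarrow> norm (G x) \<le> C"
    and G_lip: "\<And>x y. x \<in> Cmu \<mu> \<Longrightarrow> y \<in> Cmu \<mu> \<Longrightarrow> norm (G x - G y) \<le> L * norm (x - y)"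
    and K_bound: "\<And>x. x \<in> Cmu \<mu> \<Longrightarrow> norm (K x) \<le> C"
    and K_lip: "\<And>x y. x \<in> Cmu \<mu> \<Longrightarrow> y \<in> Cmu \<mu> \<Longrightarrow> norm (K x - K y) \<le> L * norm (x - y)"
    and G_deriv: "\<And>T u t. T > 0 \<Longrightarrow> continuous_on {- \<mu>..T} u \<Longrightarrow> t \<in> {0..T} \<Longrightarrow>
          ((\<lambda>r. G (hist \<mu> u r)) has_vector_derivative K (hist \<mu> u t)) (at t within {0..T})"
begin

abbreviation path :: "(real \<Rightarrow> 'h) \<Rightarrow> bool" where "path u \<equiv> continuous_on {- \<mu>..} u"
abbreviation noisy :: "(real \<Rightarrow> 'u) \<Rightarrow> bool" where "noisy \<omega> \<equiv> continuous_on {0..} \<omega>"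

definition conv :: "(real \<Rightarrow> 'h \<Rightarrow>\<^sub>L 'h) \<Rightarrow> (real \<Rightarrow> 'h) \<Rightarrow> real \<Rightarrow> 'h" where
  "conv R g t = (LINT s:{0..t}|lborel. R s (g (t - s)))"

text \<open>The three terms with \<open>\<omega>\<close> in the mild equation, which come from one stochastic integral
  \<open>\<integral> S(t - r) G(u\<^sub>r) d\<omega>(r)\<close> by formal integration by parts.\<close>

definition noise :: "(real \<Rightarrow> 'h) \<Rightarrow> (real \<Rightarrow> 'u) \<Rightarrow> real \<Rightarrow> 'h" where
  "noise u \<omega> t = conv S' (\<lambda>r. G (hist \<mu> u r) (\<omega> r)) t + G (hist \<mu> u t) (\<omega> t)
     - conv S (\<lambda>r. K (hist \<mu> u r) (\<omega> r)) t"

definition mild_map :: "(real \<Rightarrow> 'u) \<Rightarrow> (real \<Rightarrow>\<^sub>C 'h) \<Rightarrow> (real \<Rightarrow> 'h) \<Rightarrow> real \<Rightarrow> 'h" where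
  "mild_map \<omega> \<xi> u t = S t (\<xi> 0) + conv S (\<lambda>r. F (hist \<mu> u r)) t + noise u \<omega> t"

definition solves :: "(real \<Rightarrow> 'u) \<Rightarrow> (real \<Rightarrow>\<^sub>C 'h) \<Rightarrow> (real \<Rightarrow> 'h) \<Rightarrow> bool" where
  "solves \<omega> \<xi> u \<longleftrightarrow> path u \<and> (\<forall>s\<in>{- \<mu>..0}. u s = \<xi> s) \<and> (\<forall>t\<ge>0. u t = mild_map \<omega> \<xi> u t)"

text \<open>\<open>J a\<close> bounds \<open>\<integral> (s\<^sup>\<nu>\<^sup>-\<^sup>1 + 1) exp (- a s) ds\<close> over the half-line.\<close>

definition J :: "real \<Rightarrow> real" where "J a = a powr (- \<nu>) * (1 + 1 / \<nu>) + 1 / a"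

lemma J_pos: "a > 0 \<Longrightarrow> J a > 0"
  unfolding J_def using nu by (intro add_pos_pos mult_pos_pos) (auto intro: add_pos_nonneg)

lemma J_parts: "a > 0 \<Longrightarrow> 1 / a \<le> J a" "a > 0 \<Longrightarrow> a powr (- \<nu>) * (1 + 1 / \<nu>) \<le> J a"
  unfolding J_def using nu by auto

lemma J_tendsto: "(J \<longlongrightarrow> 0) at_top"
proof -
  have "((\<lambda>a. a powr (- \<nu>) * (1 + 1 / \<nu>) + 1 / a) \<longlongrightarrow> 0 * (1 + 1 / \<nu>) + 0) at_top"
    using nu by (intro tendsto_intros tendsto_neg_powr filterlim_ident tendsto_divide_0[OF tendsto_const]
        filterlim_at_top_imp_at_infinity) auto
  then show ?thesis unfolding J_def by simp
qed

lemma path_cont: "path u \<Longrightarrow> t \<ge> 0 \<Longrightarrow> continuous_on {t - \<mu>..t} u"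
  by (erule continuous_on_subset) auto

lemma hist_in: "path u \<Longrightarrow> t \<ge> 0 \<Longrightarrow> hist \<mu> u t \<in> Cmu \<mu>"
  using hist_in_Cmu[OF path_cont] mu by simp

lemma path_shift: "path u \<Longrightarrow> \<tau> \<ge> 0 \<Longrightarrow> path (\<lambda>s. u (s + \<tau>))"
  by (rule continuous_on_compose2[of "{- \<mu>..}" u]) (auto intro!: continuous_intros)

lemma coeff_continuous:
  assumes "path u"
  shows "continuous_on {0..} (\<lambda>r. F (hist \<mu> u r))" "continuous_on {0..} (\<lambda>r. G (hist \<mu> u r))"
    "continuous_on {0..} (\<lambda>r. K (hist \<mu> u r))"
proof -
  have h: "continuous_on {0..} (hist \<mu> u)" using continuous_on_hist[OF assms] mu by simp
  have im: "hist \<mu> u ` {0..} \<subseteq> Cmu \<mu>" using hist_in[OF assms] by auto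
  have "L-lipschitz_on (Cmu \<mu>) F" "L-lipschitz_on (Cmu \<mu>) G" "L-lipschitz_on (Cmu \<mu>) K"
    using F_lip G_lip K_lip L by (auto intro!: lipschitz_onI simp: dist_norm)
  from this[THEN lipschitz_on_continuous_on, THEN continuous_on_compose2, OF h im]
  show "continuous_on {0..} (\<lambda>r. F (hist \<mu> u r))" "continuous_on {0..} (\<lambda>r. G (hist \<mu> u r))"
    "continuous_on {0..} (\<lambda>r. K (hist \<mu> u r))" .
qed

lemma forcing_continuous:
  assumes "path u" "noisy \<omega>"
  shows "continuous_on {0..} (\<lambda>r. G (hist \<mu> u r) (\<omega> r))" "continuous_on {0..} (\<lambda>r. K (hist \<mu> u r) (\<omega> r))"
  by (intro bounded_bilinear.continuous_on[OF bounded_bilinear_blinfun_apply] coeff_continuous assms)+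

lemma bounded_interval:
  fixes g :: "real \<Rightarrow> 'b::real_normed_vector"
  assumes "continuous_on {0..} g"
  obtains b where "b \<ge> 0" "\<And>r. r \<in> {0..T} \<Longrightarrow> norm (g r) \<le> b"
proof -
  have "bounded (g ` {0..T})"
    by (intro compact_imp_bounded compact_continuous_image continuous_on_subset[OF assms]) auto
  then obtain b where "\<forall>r\<in>{0..T}. norm (g r) \<le> b" unfolding bounded_iff by auto
  then show thesis by (intro that[of "max b 0"]) (auto intro: max.coboundedI1)
qed

text \<open>The exponent \<open>(lam - a) s\<close> in the hypothesis trades decay of the semigroup for growth of \<open>g\<close>
  towards the past: \<open>a = lam\<close> means a bounded \<open>g\<close>, \<open>a < lam\<close> a \<open>g\<close> that grows backwards in time, and
  \<open>a > lam\<close> a \<open>g\<close> that grows forwards in time.\<close>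

lemma S_kernel:
  assumes g: "continuous_on {0..} g" and t: "t \<ge> 0" and a: "a > 0" and b: "b \<ge> 0"
    and le: "\<And>s. 0 < s \<Longrightarrow> s \<le> t \<Longrightarrow> norm (g (t - s)) \<le> b * exp ((lam - a) * s)"
  shows "norm (conv S g t) \<le> b / a"
proof -
  have "norm (S s (g (t - s))) \<le> (0 * s powr (\<nu> - 1) + b) * exp (- a * s)" if "0 < s" "s \<le> t" for s
  proof -
    have "norm (S s (g (t - s))) \<le> norm (S s) * norm (g (t - s))" by (rule norm_blinfun)
    also have "\<dots> \<le> exp (- lam * s) * (b * exp ((lam - a) * s))"
      using that le by (intro mult_mono S_norm) auto
    also have "\<dots> = b * exp (- a * s)" by (simp add: mult_exp_exp algebra_simps)
    finally show ?thesis by simp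
  qed
  from kernel_integral(2)[OF nu(1) less_imp_le[OF nu(2)] a b order_refl continuous_on_kernel_conv[OF
      S_norm_continuous g] this]
  show ?thesis by (simp add: conv_def)
qed

lemma S_integrable:
  assumes g: "continuous_on {0..} g"
  shows "set_integrable lborel {0..t} (\<lambda>s. S s (g (t - s)))"
proof -
  obtain b where b: "b \<ge> 0" "\<And>r. r \<in> {0..t} \<Longrightarrow> norm (g r) \<le> b" using bounded_interval[OF g] by metis
  have "norm (S s (g (t - s))) \<le> (0 * s powr (\<nu> - 1) + b) * exp (- lam * s)" if "0 < s" "s \<le> t" for s
  proof -
    have "norm (S s (g (t - s))) \<le> norm (S s) * norm (g (t - s))" by (rule norm_blinfun)
    also have "\<dots> \<le> exp (- lam * s) * b" using that b by (intro mult_mono S_norm) auto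
    finally show ?thesis by (simp add: mult.commute)
  qed
  from kernel_integral(1)[OF nu(1) less_imp_le[OF nu(2)] lam b(1) order_refl continuous_on_kernel_conv[OF
      S_norm_continuous g] this]
  show ?thesis .
qed

lemma S_conv_continuous:
  assumes g: "continuous_on {0..} g"
  shows "continuous_on {0..} (conv S g)"
  unfolding conv_def
proof (rule continuous_on_convolution[OF nu(1) less_imp_le[OF nu(2)] S_norm_continuous g])
  fix T :: real
  obtain b where b: "b \<ge> 0" "\<And>r. r \<in> {0..T} \<Longrightarrow> norm (g r) \<le> b" using bounded_interval[OF g] by metis
  have "norm (S s (g r)) \<le> b * (s powr (\<nu> - 1) + 1)" if "s \<in> {0<..T}" "r \<in> {0..T}" for s r
  proof -
    have "norm (S s (g r)) \<le> norm (S s) * norm (g r)" by (rule norm_blinfun)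
    also have "\<dots> \<le> 1 * b" using that b lam S_norm[of s] by (intro mult_mono order_trans[OF S_norm]) auto
    also have "1 * b \<le> b * (s powr (\<nu> - 1) + 1)" using b by (simp add: algebra_simps)
    finally show ?thesis .
  qed
  then show "\<exists>c\<ge>0. \<forall>s\<in>{0<..T}. \<forall>r\<in>{0..T}. norm (S s (g r)) \<le> c * (s powr (\<nu> - 1) + 1)"
    using b(1) by blast
qed

lemma S'_kernel:
  assumes g: "continuous_on {0..} g" and t: "t \<ge> 0" and a: "a > 0" and b: "b \<ge> 0"
    and le: "\<And>s. 0 < s \<Longrightarrow> s \<le> t \<Longrightarrow> norm (S' s (g (t - s))) \<le> b * s powr (\<nu> - 1) * exp (- a * s)"
  shows "norm (conv S' g t) \<le> b * (a powr (- \<nu>) * (1 + 1 / \<nu>))"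
proof -
  have "norm (S' s (g (t - s))) \<le> (b * s powr (\<nu> - 1) + 0) * exp (- a * s)" if "0 < s" "s \<le> t" for s
    using le[OF that] by simp
  from kernel_integral(2)[OF nu(1) less_imp_le[OF nu(2)] a order_refl b continuous_on_kernel_conv[OF
      S'_continuous g] this]
  show ?thesis by (simp add: conv_def)
qed

lemma gain_bound:
  assumes u: "path u" and "r \<ge> 0" "s > 0" "norm (\<omega> r) \<le> b"
  shows "norm (S' s (G (hist \<mu> u r) (\<omega> r))) \<le> C * b * s powr (\<nu> - 1) * exp (- lam * s)"
proof -
  have "norm (S' s (G (hist \<mu> u r) (\<omega> r))) \<le> C * s powr (\<nu> - 1) * exp (- lam * s) * norm (\<omega> r)"
    by (intro G_smooth hist_in assms)
  also have "\<dots> \<le> C * s powr (\<nu> - 1) * exp (- lam * s) * b"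
    using C assms by (intro mult_left_mono) auto
  finally show ?thesis by (simp add: ac_simps)
qed

lemma S'_integrable:
  assumes u: "path u" and \<omega>: "noisy \<omega>"
  shows "set_integrable lborel {0..t} (\<lambda>s. S' s (G (hist \<mu> u (t - s)) (\<omega> (t - s))))"
proof -
  obtain b where b: "b \<ge> 0" "\<And>r. r \<in> {0..t} \<Longrightarrow> norm (\<omega> r) \<le> b" using bounded_interval[OF \<omega>] by metis
  have "norm (S' s (G (hist \<mu> u (t - s)) (\<omega> (t - s)))) \<le> (C * b * s powr (\<nu> - 1) + 0) * exp (- lam * s)"
    if "0 < s" "s \<le> t" for s
    using gain_bound[OF u _ that(1), of "t - s" \<omega> b] b that by simp
  from kernel_integral(1)[OF nu(1) less_imp_le[OF nu(2)] lam order_refl mult_nonneg_nonneg[OF C b(1)]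
      continuous_on_kernel_conv[OF S'_continuous forcing_continuous(1)[OF u \<omega>]] this]
  show ?thesis .
qed

lemma noise_continuous:
  assumes u: "path u" and \<omega>: "noisy \<omega>"
  shows "continuous_on {0..} (noise u \<omega>)"
proof -
  have "continuous_on {0..} (conv S' (\<lambda>r. G (hist \<mu> u r) (\<omega> r)))"
    unfolding conv_def
  proof (rule continuous_on_convolution[OF nu(1) less_imp_le[OF nu(2)] S'_continuous
      forcing_continuous(1)[OF u \<omega>]])
    fix T :: real
    obtain b where b: "b \<ge> 0" "\<And>r. r \<in> {0..T} \<Longrightarrow> norm (\<omega> r) \<le> b" using bounded_interval[OF \<omega>] by metis
    have "norm (S' s (G (hist \<mu> u r) (\<omega> r))) \<le> C * b * (s powr (\<nu> - 1) + 1)" if "s \<in> {0<..T}" "r \<in> {0..T}"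
        for s r
    proof -
      have "norm (S' s (G (hist \<mu> u r) (\<omega> r))) \<le> C * b * s powr (\<nu> - 1) * exp (- lam * s)"
        using that b by (intro gain_bound u) auto
      also have "\<dots> \<le> C * b * s powr (\<nu> - 1) * 1"
        using that b C lam by (intro mult_left_mono) auto
      also have "\<dots> \<le> C * b * (s powr (\<nu> - 1) + 1)" using b C by (simp add: algebra_simps)
      finally show ?thesis .
    qed
    then show "\<exists>c\<ge>0. \<forall>s\<in>{0<..T}. \<forall>r\<in>{0..T}. norm (S' s (G (hist \<mu> u r) (\<omega> r))) \<le> c * (s powr (\<nu> - 1) + 1)"
      using b(1) C by (intro exI[of _ "C * b"]) auto
  qed
  then show ?thesis
    unfolding noise_def[abs_def]
    by (intro continuous_on_diff continuous_on_add forcing_continuous S_conv_continuous u \<omega>)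
qed

lemma mild_map_continuous:
  assumes "path u" "noisy \<omega>"
  shows "continuous_on {0..} (mild_map \<omega> \<xi> u)"
  unfolding mild_map_def[abs_def]
  by (intro continuous_on_add S_continuous noise_continuous S_conv_continuous coeff_continuous assms)

lemma conv_0: "conv R g 0 = 0"
proof -
  have "AE s in lborel. indicator {0..0} s *\<^sub>R blinfun_apply (R s) (g (0 - s)) = 0"
    using AE_lborel_singleton[of "0::real"] by eventually_elim auto
  then show ?thesis
    unfolding conv_def set_lebesgue_integral_def by (rule integral_eq_zero_AE)
qed

lemma mild_map_0: "\<omega> 0 = 0 \<Longrightarrow> mild_map \<omega> \<xi> u 0 = \<xi> 0"
  unfolding mild_map_def noise_def by (simp add: conv_0)

lemma conv_diff:
  fixes R :: "real \<Rightarrow> 'h \<Rightarrow>\<^sub>L 'h"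
  assumes "set_integrable lborel {0..t} (\<lambda>s. R s (g (t - s)))"
      "set_integrable lborel {0..t} (\<lambda>s. R s (h (t - s)))"
  shows "conv R g t - conv R h t = conv R (\<lambda>r. g r - h r) t"
  unfolding conv_def using assms by (simp add: blinfun.diff_right)

lemma noise_diff:
  assumes "path u" "noisy \<omega>" "noisy \<eta>"
  shows "noise u \<omega> t - noise u \<eta> t = noise u (\<lambda>r. \<omega> r - \<eta> r) t"
proof -
  have "conv S' (\<lambda>r. G (hist \<mu> u r) (\<omega> r)) t - conv S' (\<lambda>r. G (hist \<mu> u r) (\<eta> r)) t
      = conv S' (\<lambda>r. G (hist \<mu> u r) (\<omega> r) - G (hist \<mu> u r) (\<eta> r)) t"
    by (intro conv_diff S'_integrable assms)
  moreover have "conv S (\<lambda>r. K (hist \<mu> u r) (\<omega> r)) t - conv S (\<lambda>r. K (hist \<mu> u r) (\<eta> r)) t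
      = conv S (\<lambda>r. K (hist \<mu> u r) (\<omega> r) - K (hist \<mu> u r) (\<eta> r)) t"
    by (intro conv_diff S_integrable forcing_continuous assms)
  ultimately show ?thesis unfolding noise_def by (simp add: blinfun.diff_right algebra_simps)
qed

lemma noise_bound:
  assumes u: "path u" and \<omega>: "noisy \<omega>" and t: "t \<ge> 0" and a: "a > 0" and V: "V \<ge> 0"
    and le: "\<And>s. 0 \<le> s \<Longrightarrow> s \<le> t \<Longrightarrow> norm (\<omega> (t - s)) \<le> V * exp ((lam - a) * s)"
  shows "norm (noise u \<omega> t) \<le> C * V * (J a + 1)"
proof -
  have 1: "norm (conv S' (\<lambda>r. G (hist \<mu> u r) (\<omega> r)) t) \<le> (C * V) * (a powr (- \<nu>) * (1 + 1 / \<nu>))"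
  proof (rule S'_kernel[OF forcing_continuous(1)[OF u \<omega>] t a])
    fix s assume s: "0 < s" "s \<le> t"
    have "norm (S' s (G (hist \<mu> u (t - s)) (\<omega> (t - s))))
        \<le> C * (V * exp ((lam - a) * s)) * s powr (\<nu> - 1) * exp (- lam * s)"
      using s le by (intro gain_bound u) auto
    also have "\<dots> = C * V * s powr (\<nu> - 1) * (exp ((lam - a) * s) * exp (- lam * s))" by simp
    also have "\<dots> = C * V * s powr (\<nu> - 1) * exp (- a * s)" by (simp add: mult_exp_exp algebra_simps)
    finally show "norm (S' s (G (hist \<mu> u (t - s)) (\<omega> (t - s)))) \<le> C * V * s powr (\<nu> - 1) * exp (- a * s)" .
  qed (use C V in auto)
  have 2: "norm (conv S (\<lambda>r. K (hist \<mu> u r) (\<omega> r)) t) \<le> (C * V) / a"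
  proof (rule S_kernel[OF forcing_continuous(2)[OF u \<omega>] t a])
    fix s assume s: "0 < s" "s \<le> t"
    have "norm (K (hist \<mu> u (t - s)) (\<omega> (t - s))) \<le> norm (K (hist \<mu> u (t - s))) * norm (\<omega> (t - s))"
      by (rule norm_blinfun)
    also have "\<dots> \<le> C * (V * exp ((lam - a) * s))"
      using s C le by (intro mult_mono K_bound hist_in u) auto
    finally show "norm (K (hist \<mu> u (t - s)) (\<omega> (t - s))) \<le> C * V * exp ((lam - a) * s)" by simp
  qed (use C V in auto)
  have "norm (G (hist \<mu> u t) (\<omega> t)) \<le> norm (G (hist \<mu> u t)) * norm (\<omega> t)" by (rule norm_blinfun)
  also have "\<dots> \<le> C * V" using t C le[of 0] by (intro mult_mono G_bound hist_in u) auto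
  finally have 3: "norm (G (hist \<mu> u t) (\<omega> t)) \<le> C * V" .
  have "norm (noise u \<omega> t) \<le> norm (conv S' (\<lambda>r. G (hist \<mu> u r) (\<omega> r)) t) + norm (G (hist \<mu> u t) (\<omega> t))
      + norm (conv S (\<lambda>r. K (hist \<mu> u r) (\<omega> r)) t)"
    unfolding noise_def by (rule order_trans[OF norm_triangle_ineq4 add_right_mono[OF norm_triangle_ineq]])
  also have "\<dots> \<le> C * V * (a powr (- \<nu>) * (1 + 1 / \<nu>)) + C * V + C * V / a"
    using 1 2 3 by (intro add_mono)
  also have "\<dots> = C * V * (J a + 1)" unfolding J_def by (simp add: algebra_simps)
  finally show ?thesis .
qed

lemma G_deriv_at:
  assumes u: "path u" and t: "t > 0"
  shows "((\<lambda>r. G (hist \<mu> u r)) has_vector_derivative K (hist \<mu> u t)) (at t)"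
proof -
  have "((\<lambda>r. G (hist \<mu> u r)) has_vector_derivative K (hist \<mu> u t)) (at t within {0..t + 1})"
    by (rule G_deriv) (use t in \<open>auto intro: continuous_on_subset[OF u]\<close>)
  moreover have "at t within {0..t + 1} = at t" by (rule at_within_Icc_at) (use t in auto)
  ultimately show ?thesis by simp
qed

text \<open>At \<open>s = 0\<close> the semigroup is continuous only strongly, so that its norm bound is used.\<close>

lemma continuous_on_S_apply:
  assumes y: "continuous_on {0..t} y"
  shows "continuous_on {0..t} (\<lambda>s. S s (y s))"
  unfolding continuous_on_def
proof
  fix s assume s: "s \<in> {0..t}"
  have "((\<lambda>r. norm (y r - y s) + norm (S r (y s) - S s (y s))) \<longlongrightarrow> norm (y s - y s)
      + norm (S s (y s) - S s (y s)))
      (at s within {0..t})"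
  proof (intro tendsto_add tendsto_norm tendsto_diff tendsto_const)
    show "(y \<longlongrightarrow> y s) (at s within {0..t})" using y s by (simp add: continuous_on_def)
    have "continuous_on {0..t} (\<lambda>r. S r (y s))" by (rule continuous_on_subset[OF S_continuous]) auto
    then show "((\<lambda>r. S r (y s)) \<longlongrightarrow> S s (y s)) (at s within {0..t})" using s by (simp add: continuous_on_def)
  qed
  then have lim: "((\<lambda>r. norm (y r - y s) + norm (S r (y s) - S s (y s))) \<longlongrightarrow> 0) (at s within {0..t})" by simp
  have "eventually (\<lambda>r. norm (S r (y r) - S s (y s)) \<le> norm (y r - y s) + norm (S r (y s) - S s (y s)))
      (at s within {0..t})"
    unfolding eventually_at_filter
  proof (intro always_eventually allI impI)
    fix r assume r: "r \<in> {0..t}"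
    have "norm (S r (y r) - S s (y s)) \<le> norm (S r (y r - y s)) + norm (S r (y s) - S s (y s))"
      using norm_triangle_ineq[of "S r (y r - y s)" "S r (y s) - S s (y s)"] by (simp add: blinfun.diff_right)
    also have "norm (S r (y r - y s)) \<le> norm (S r) * norm (y r - y s)" by (rule norm_blinfun)
    also have "\<dots> \<le> 1 * norm (y r - y s)"
      using r lam by (intro mult_right_mono order_trans[OF S_norm]) auto
    finally show "norm (S r (y r) - S s (y s)) \<le> norm (y r - y s) + norm (S r (y s) - S s (y s))" by simp
  qed
  then have "((\<lambda>r. S r (y r) - S s (y s)) \<longlongrightarrow> 0) (at s within {0..t})"
    by (rule Lim_null_comparison[OF _ lim])
  then show "((\<lambda>s. S s (y s)) \<longlongrightarrow> S s (y s)) (at s within {0..t})" by (simp add: LIM_zero_iff)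
qed

text \<open>\<open>S(s) G(u\<^sub>t\<^sub>-\<^sub>s) w\<close> has the derivative \<open>S'(s) G(u\<^sub>t\<^sub>-\<^sub>s) w - S(s) K(u\<^sub>t\<^sub>-\<^sub>s) w\<close> with respect to \<open>s\<close>. Hence
  a constant noise path acts only through the initial segment, and \<open>\<omega>\<close> may be replaced by its increments
  at the cost of a term governed by \<open>S(t)\<close>.\<close>

lemma noise_const:
  assumes u: "path u" and t: "t \<ge> 0"
  shows "noise u (\<lambda>_. w) t = S t (G (hist \<mu> u 0) w)"
proof -
  define g where "g = (\<lambda>r. G (hist \<mu> u r) w)"
  define k where "k = (\<lambda>r. K (hist \<mu> u r) w)"
  have g: "continuous_on {0..} g" and k: "continuous_on {0..} k"
    unfolding g_def k_def by (intro forcing_continuous u continuous_on_const)+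
  have Sk: "set_integrable lborel {0..t} (\<lambda>s. S s (k (t - s)))" by (rule S_integrable[OF k])
  have S'g: "set_integrable lborel {0..t} (\<lambda>s. S' s (g (t - s)))"
    unfolding g_def by (rule S'_integrable[OF u, of "\<lambda>_. w"]) simp
  have "(LINT s:{0..t}|lborel. S' s (g (t - s)) - S s (k (t - s))) = S t (g (t - t)) - S 0 (g (t - 0))"
  proof (rule FTC_inner[OF t])
    show "continuous_on {0..t} (\<lambda>s. S s (g (t - s)))"
      by (intro continuous_on_S_apply continuous_on_compose2[OF g] continuous_intros) auto
    show "((\<lambda>s. S s (g (t - s))) has_vector_derivative S' s (g (t - s)) - S s (k (t - s))) (at s)"
      if s: "0 < s" "s < t" for s
    proof -
      have "(g has_vector_derivative k (t - s)) (at (t - s))"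
        unfolding g_def k_def using G_deriv_at[OF u, of "t - s"] s
        by (intro bounded_linear.has_vector_derivative[OF blinfun.bounded_linear_left]) auto
      moreover have "((\<lambda>s. t - s) has_vector_derivative - 1) (at s)"
        by (rule derivative_eq_intros refl)+ simp
      ultimately have "((\<lambda>s. g (t - s)) has_vector_derivative - k (t - s)) (at s)"
        using vector_diff_chain_at[of "\<lambda>s. t - s" "- 1" s g "k (t - s)"] by (simp add: o_def)
      from bounded_bilinear.has_vector_derivative[OF bounded_bilinear_blinfun_apply deriv[OF s(1)] this]
      show ?thesis by (simp add: blinfun.minus_right)
    qed
    show "continuous_on {0<..<t} (\<lambda>s. S' s (g (t - s)) - S s (k (t - s)))"
      using continuous_on_kernel_conv[OF S'_continuous g, of t] continuous_on_kernel_conv[OF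
          S_norm_continuous k, of t]
      by (intro continuous_on_diff) (auto elim: continuous_on_subset)
    show "set_integrable lborel {0..t} (\<lambda>s. S' s (g (t - s)) - S s (k (t - s)))"
      by (intro set_integral_diff Sk S'g)
  qed
  then have "conv S' g t - conv S k t = S t (g 0) - g t"
    unfolding conv_def using Sk S'g by simp
  then show ?thesis unfolding noise_def g_def k_def by (simp add: algebra_simps)
qed

end

lemma continuous_on_Ici:
  fixes u :: "real \<Rightarrow> 'a::topological_space"
  assumes "\<And>T. continuous_on {a..T} u"
  shows "continuous_on {a..} u"
  unfolding continuous_on_eq_continuous_within
proof
  fix x assume "x \<in> {a..}"
  moreover have "at x within {a..} = at x within {a..x + 1}"
    by (rule at_within_nhd[of _ "{..<x + 1}"]) auto
  ultimately show "continuous (at x within {a..}) u"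
    using assms[of "x + 1"] by (simp add: continuous_on_eq_continuous_within continuous_within)
qed

context delay_equation begin

lemma G_diff_growth:
  assumes u: "path u" and v: "path v" and t: "t \<ge> 0" and \<rho>: "\<rho> > 0" and c: "c \<ge> 0"
    and h: "\<And>r. r \<in> {0..t} \<Longrightarrow> norm (hist \<mu> u r - hist \<mu> v r) \<le> c * exp (\<rho> * r)"
  shows "norm (G (hist \<mu> u t) - G (hist \<mu> v t)) \<le> L * norm (hist \<mu> u 0 - hist \<mu> v 0)
      + L * c * exp (\<rho> * t) * J \<rho>"
proof (cases "t = 0")
  case True
  have "0 \<le> L * c * exp (\<rho> * t) * J \<rho>" using L c J_pos[OF \<rho>] by simp
  then show ?thesis using True G_lip[OF hist_in hist_in, OF u _ v, of 0 0] by simp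
next
  case False
  with t have t0: "t > 0" by simp
  define f where "f = (\<lambda>r. G (hist \<mu> u r) - G (hist \<mu> v r))"
  define \<phi> where "\<phi> = (\<lambda>r. L * c / \<rho> * exp (\<rho> * r))"
  have "norm (f t - f 0) \<le> \<phi> t - \<phi> 0"
  proof (rule differentiable_bound_general[OF t0])
    show "continuous_on {0..t} f" unfolding f_def
      by (intro continuous_on_diff continuous_on_subset[OF coeff_continuous(2)] u v) auto
    show "continuous_on {0..t} \<phi>" unfolding \<phi>_def by (intro continuous_intros)
    fix r assume r: "0 < r" "r < t"
    show "(f has_vector_derivative K (hist \<mu> u r) - K (hist \<mu> v r)) (at r)"
      unfolding f_def using r by (intro has_vector_derivative_diff G_deriv_at u v)
    show "(\<phi> has_vector_derivative L * c * exp (\<rho> * r)) (at r)"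
      unfolding \<phi>_def has_real_derivative_iff_has_vector_derivative[symmetric]
      using \<rho> by (auto intro!: derivative_eq_intros)
    have "norm (K (hist \<mu> u r) - K (hist \<mu> v r)) \<le> L * norm (hist \<mu> u r - hist \<mu> v r)"
      using r by (intro K_lip hist_in u v) auto
    also have "\<dots> \<le> L * (c * exp (\<rho> * r))" using r L by (intro mult_left_mono h) auto
    finally show "norm (K (hist \<mu> u r) - K (hist \<mu> v r)) \<le> L * c * exp (\<rho> * r)" by simp
  qed
  moreover have "\<phi> t - \<phi> 0 \<le> L * c * exp (\<rho> * t) * J \<rho>"
  proof -
    have "\<phi> t - \<phi> 0 \<le> L * c * exp (\<rho> * t) * (1 / \<rho>)" using L c \<rho> by (simp add: \<phi>_def)
    also have "\<dots> \<le> L * c * exp (\<rho> * t) * J \<rho>" using L c J_parts(1)[OF \<rho>] by (intro mult_left_mono) auto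
    finally show ?thesis .
  qed
  moreover have "norm (f 0) \<le> L * norm (hist \<mu> u 0 - hist \<mu> v 0)"
    unfolding f_def by (intro G_lip hist_in u v) auto
  moreover have "norm (f t) \<le> norm (f t - f 0) + norm (f 0)"
    using norm_triangle_ineq[of "f t - f 0" "f 0"] by simp
  ultimately show ?thesis unfolding f_def by linarith
qed

text \<open>In the norm weighted by \<open>exp (\<rho> t)\<close> the mild map is Lipschitz in the path with a constant
  that vanishes as \<open>\<rho> \<rightarrow> \<infinity>\<close>. The summand \<open>G(u\<^sub>t) \<omega>(t)\<close>, which carries no smoothing time
  integral, fits in since \<open>G(u\<^sub>t)\<close> is the time integral of \<open>K(u\<^sub>r)\<close>.\<close>

lemma mild_map_diff:
  assumes u: "path u" and v: "path v" and \<omega>: "noisy \<omega>" and t: "t \<ge> 0" and \<rho>: "\<rho> > 0" and c: "c \<ge> 0"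
    and W: "\<And>r. r \<in> {0..t} \<Longrightarrow> norm (\<omega> r) \<le> W"
    and h: "\<And>r. r \<in> {0..t} \<Longrightarrow> norm (hist \<mu> u r - hist \<mu> v r) \<le> c * exp (\<rho> * r)"
  shows "norm (mild_map \<omega> \<xi> u t - mild_map \<omega> \<eta> v t) \<le> norm (\<xi> 0 - \<eta> 0)
    + L * W * norm (hist \<mu> u 0 - hist \<mu> v 0) + L * (1 + 3 * W) * J \<rho> * (c * exp (\<rho> * t))"
proof -
  define b where "b = L * c * exp (\<rho> * t)"
  have b: "b \<ge> 0" using L c by (simp add: b_def)
  have W0: "W \<ge> 0" using order_trans[OF norm_ge_zero W[of 0]] t by simp
  have J0: "J \<rho> > 0" by (rule J_pos[OF \<rho>])
  \<comment> \<open>The integral of \<open>exp (- lam s) exp (- \<rho> s)\<close> is at most \<open>1 / (lam + \<rho>)\<close>.\<close>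
  have small: "q / (lam + \<rho>) \<le> q * J \<rho>" if "q \<ge> 0" for q
  proof -
    have "q / (lam + \<rho>) \<le> q / \<rho>" using that lam \<rho> by (intro divide_left_mono) auto
    also have "\<dots> \<le> q * J \<rho>" using mult_left_mono[OF J_parts(1)[OF \<rho>] that] by simp
    finally show ?thesis .
  qed
  have e: "exp (\<rho> * (t - s)) = exp (\<rho> * t) * exp ((lam - (lam + \<rho>)) * s)" for s
    by (simp add: mult_exp_exp algebra_simps)
  have Fd: "norm (conv S (\<lambda>r. F (hist \<mu> u r)) t - conv S (\<lambda>r. F (hist \<mu> v r)) t) \<le> b * J \<rho>"
  proof -
    have "conv S (\<lambda>r. F (hist \<mu> u r)) t - conv S (\<lambda>r. F (hist \<mu> v r)) t
        = conv S (\<lambda>r. F (hist \<mu> u r) - F (hist \<mu> v r)) t"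
      by (intro conv_diff S_integrable coeff_continuous u v)
    also have "norm \<dots> \<le> b / (lam + \<rho>)"
    proof (rule S_kernel[OF _ t _ b])
      fix s assume s: "0 < s" "s \<le> t"
      have "norm (F (hist \<mu> u (t - s)) - F (hist \<mu> v (t - s))) \<le> L * norm (hist \<mu> u (t - s) - hist \<mu> v (t - s))"
        using s by (intro F_lip hist_in u v) auto
      also have "\<dots> \<le> L * (c * exp (\<rho> * (t - s)))" using s L by (intro mult_left_mono h) auto
      finally show "norm (F (hist \<mu> u (t - s)) - F (hist \<mu> v (t - s))) \<le> b * exp ((lam - (lam + \<rho>)) * s)"
        by (simp add: b_def e)
    qed (use lam \<rho> in \<open>auto intro!: continuous_on_diff coeff_continuous u v\<close>)
    finally show ?thesis using small[OF b] by simp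
  qed
  have Kd: "norm (conv S (\<lambda>r. K (hist \<mu> u r) (\<omega> r)) t - conv S (\<lambda>r. K (hist \<mu> v r) (\<omega> r)) t) \<le> b * W * J \<rho>"
  proof -
    have "conv S (\<lambda>r. K (hist \<mu> u r) (\<omega> r)) t - conv S (\<lambda>r. K (hist \<mu> v r) (\<omega> r)) t
        = conv S (\<lambda>r. K (hist \<mu> u r) (\<omega> r) - K (hist \<mu> v r) (\<omega> r)) t"
      by (intro conv_diff S_integrable forcing_continuous \<omega> u v)
    also have "norm \<dots> \<le> (b * W) / (lam + \<rho>)"
    proof (rule S_kernel[OF _ t])
      fix s assume s: "0 < s" "s \<le> t"
      have "norm (K (hist \<mu> u (t - s)) (\<omega> (t - s)) - K (hist \<mu> v (t - s)) (\<omega> (t - s)))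
          \<le> norm (K (hist \<mu> u (t - s)) - K (hist \<mu> v (t - s))) * norm (\<omega> (t - s))"
        using norm_blinfun[of "K (hist \<mu> u (t - s)) - K (hist \<mu> v (t - s))" "\<omega> (t - s)"]
        by (simp add: blinfun.diff_left)
      also have "\<dots> \<le> (L * norm (hist \<mu> u (t - s) - hist \<mu> v (t - s))) * W"
        using s L by (intro mult_mono K_lip hist_in u v W) auto
      also have "\<dots> \<le> (L * (c * exp (\<rho> * (t - s)))) * W"
        using s L W0 by (intro mult_left_mono mult_right_mono h) auto
      finally show "norm (K (hist \<mu> u (t - s)) (\<omega> (t - s)) - K (hist \<mu> v (t - s)) (\<omega> (t - s)))
          \<le> b * W * exp ((lam - (lam + \<rho>)) * s)"
        by (simp add: b_def e ac_simps)
    qed (use lam \<rho> b W0 in \<open>auto intro!: continuous_on_diff forcing_continuous u v \<omega>\<close>)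
    finally show ?thesis using small[of "b * W"] b W0 by simp
  qed
  have Gd: "norm (conv S' (\<lambda>r. G (hist \<mu> u r) (\<omega> r)) t - conv S' (\<lambda>r. G (hist \<mu> v r) (\<omega> r)) t) \<le> b * W * J \<rho>"
  proof -
    have "conv S' (\<lambda>r. G (hist \<mu> u r) (\<omega> r)) t - conv S' (\<lambda>r. G (hist \<mu> v r) (\<omega> r)) t
        = conv S' (\<lambda>r. G (hist \<mu> u r) (\<omega> r) - G (hist \<mu> v r) (\<omega> r)) t"
      by (intro conv_diff S'_integrable \<omega> u v)
    also have "norm \<dots> \<le> (b * W) * (\<rho> powr (- \<nu>) * (1 + 1 / \<nu>))"
    proof (rule S'_kernel[OF _ t \<rho>])
      fix s assume s: "0 < s" "s \<le> t"
      have "norm (S' s (G (hist \<mu> u (t - s)) (\<omega> (t - s)) - G (hist \<mu> v (t - s)) (\<omega> (t - s))))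
          \<le> L * norm (hist \<mu> u (t - s) - hist \<mu> v (t - s)) * s powr (\<nu> - 1) * norm (\<omega> (t - s))"
        using s by (intro G_smooth_lip hist_in u v) auto
      also have "\<dots> \<le> L * (c * exp (\<rho> * (t - s))) * s powr (\<nu> - 1) * W"
        using s L c by (intro mult_mono mult_nonneg_nonneg W h) auto
      also have "\<dots> = b * W * s powr (\<nu> - 1) * exp (- \<rho> * s)"
        by (simp add: b_def e ac_simps)
      finally show "norm (S' s (G (hist \<mu> u (t - s)) (\<omega> (t - s)) - G (hist \<mu> v (t - s)) (\<omega> (t - s))))
          \<le> b * W * s powr (\<nu> - 1) * exp (- \<rho> * s)" .
    qed (use b W0 in \<open>auto intro!: continuous_on_diff forcing_continuous u v \<omega>\<close>)
    also have "\<dots> \<le> b * W * J \<rho>" using b W0 by (intro mult_left_mono J_parts \<rho>) auto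
    finally show ?thesis .
  qed
  have gd: "norm (G (hist \<mu> u t) (\<omega> t) - G (hist \<mu> v t) (\<omega> t)) \<le> (L * norm (hist \<mu> u 0 - hist \<mu> v 0)
      + b * J \<rho>) * W"
  proof -
    have "norm (G (hist \<mu> u t) (\<omega> t) - G (hist \<mu> v t) (\<omega> t))
        \<le> norm (G (hist \<mu> u t) - G (hist \<mu> v t)) * norm (\<omega> t)"
      using norm_blinfun[of "G (hist \<mu> u t) - G (hist \<mu> v t)" "\<omega> t"] by (simp add: blinfun.diff_left)
    also have "\<dots> \<le> (L * norm (hist \<mu> u 0 - hist \<mu> v 0) + b * J \<rho>) * W"
      using G_diff_growth[OF u v t \<rho> c h] W[of t] t L b J0 unfolding b_def
      by (intro mult_mono add_nonneg_nonneg) auto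
    finally show ?thesis .
  qed
  have Sd: "norm (S t (\<xi> 0) - S t (\<eta> 0)) \<le> norm (\<xi> 0 - \<eta> 0)"
  proof -
    have "norm (S t (\<xi> 0 - \<eta> 0)) \<le> norm (S t) * norm (\<xi> 0 - \<eta> 0)" by (rule norm_blinfun)
    also have "\<dots> \<le> 1 * norm (\<xi> 0 - \<eta> 0)"
      using t lam by (intro mult_right_mono order_trans[OF S_norm]) auto
    finally show ?thesis by (simp add: blinfun.diff_right)
  qed
  have split: "mild_map \<omega> \<xi> u t - mild_map \<omega> \<eta> v t = (S t (\<xi> 0) - S t (\<eta> 0))
    + (conv S (\<lambda>r. F (hist \<mu> u r)) t - conv S (\<lambda>r. F (hist \<mu> v r)) t)
    + (conv S' (\<lambda>r. G (hist \<mu> u r) (\<omega> r)) t - conv S' (\<lambda>r. G (hist \<mu> v r) (\<omega> r)) t)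
    + (G (hist \<mu> u t) (\<omega> t) - G (hist \<mu> v t) (\<omega> t))
    - (conv S (\<lambda>r. K (hist \<mu> u r) (\<omega> r)) t - conv S (\<lambda>r. K (hist \<mu> v r) (\<omega> r)) t)"
    unfolding mild_map_def noise_def by (simp add: algebra_simps)
  have "norm (mild_map \<omega> \<xi> u t - mild_map \<omega> \<eta> v t) \<le> norm (\<xi> 0 - \<eta> 0) + b * J \<rho> + b * W * J \<rho>
    + (L * norm (hist \<mu> u 0 - hist \<mu> v 0) + b * J \<rho>) * W + b * W * J \<rho>"
    unfolding split
    by (rule order_trans[OF norm_triangle_ineq4], rule add_mono[OF _ Kd],
        rule order_trans[OF norm_triangle_ineq], rule add_mono[OF _ gd],
        rule order_trans[OF norm_triangle_ineq], rule add_mono[OF _ Gd],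
        rule order_trans[OF norm_triangle_ineq], rule add_mono[OF Sd Fd])
  also have "\<dots> = norm (\<xi> 0 - \<eta> 0) + L * W * norm (hist \<mu> u 0 - hist \<mu> v 0)
      + L * (1 + 3 * W) * J \<rho> * (c * exp (\<rho> * t))"
    unfolding b_def by (simp add: algebra_simps)
  finally show ?thesis .
qed

lemma contraction_weight:
  obtains \<rho> where "\<rho> > 0" "L * (1 + 3 * W) * J \<rho> \<le> 1 / 2"
proof -
  have "((\<lambda>\<rho>. L * (1 + 3 * W) * J \<rho>) \<longlongrightarrow> L * (1 + 3 * W) * 0) at_top"
    by (intro tendsto_intros J_tendsto)
  then have "eventually (\<lambda>\<rho>. L * (1 + 3 * W) * J \<rho> < 1 / 2) at_top"
    by (intro order_tendstoD) auto
  then have "eventually (\<lambda>\<rho>. L * (1 + 3 * W) * J \<rho> < 1 / 2 \<and> \<rho> > 0) at_top"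
    using eventually_gt_at_top[of 0] by eventually_elim auto
  then obtain \<rho> where "\<rho> > 0" "L * (1 + 3 * W) * J \<rho> < 1 / 2"
    unfolding eventually_at_top_linorder by blast
  then show thesis using that[of \<rho>] by simp
qed

lemma hist_diff_weighted:
  assumes u: "path u" and v: "path v" and r: "0 \<le> r" and \<rho>: "\<rho> > 0" and c: "c \<ge> 0"
    and neg: "\<And>s. s \<in> {- \<mu>..0} \<Longrightarrow> norm (u s - v s) \<le> c"
    and pos: "\<And>s. s \<in> {0..r} \<Longrightarrow> norm (u s - v s) \<le> c * exp (\<rho> * s)"
  shows "norm (hist \<mu> u r - hist \<mu> v r) \<le> c * exp (\<rho> * r)"
proof (rule norm_hist_diff_le)
  fix s assume s: "s \<in> {- \<mu>..0}"
  show "norm (u (r + s) - v (r + s)) \<le> c * exp (\<rho> * r)"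
  proof (cases "r + s \<ge> 0")
    case True
    have "norm (u (r + s) - v (r + s)) \<le> c * exp (\<rho> * (r + s))" using True s by (intro pos) auto
    also have "\<dots> \<le> c * exp (\<rho> * r)" using s c \<rho> by (intro mult_left_mono) auto
    finally show ?thesis .
  next
    case False
    have "norm (u (r + s) - v (r + s)) \<le> c * 1" using False s r by (simp add: neg)
    also have "\<dots> \<le> c * exp (\<rho> * r)" using r c \<rho> by (intro mult_left_mono) auto
    finally show ?thesis .
  qed
qed (use path_cont u v r mu in auto)

text \<open>The iteration runs on the whole half-line at once; on each \<open>[0,T]\<close> it contracts in a weighted norm
  depending on \<open>T\<close>. It starts from the segment \<open>\<xi>\<close> itself, which is constant on \<open>{0..}\<close>.\<close>

primrec picard :: "(real \<Rightarrow> 'u) \<Rightarrow> (real \<Rightarrow>\<^sub>C 'h) \<Rightarrow> nat \<Rightarrow> real \<Rightarrow> 'h" where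
  "picard \<omega> \<xi> 0 = apply_bcontfun \<xi>"
| "picard \<omega> \<xi> (Suc n) = (\<lambda>t. if t \<le> 0 then \<xi> t else mild_map \<omega> \<xi> (picard \<omega> \<xi> n) t)"

lemma path_extend:
  assumes "path u" "noisy \<omega>" "\<omega> 0 = 0"
  shows "path (\<lambda>t. if t \<le> 0 then apply_bcontfun \<xi> t else mild_map \<omega> \<xi> u t)"
proof -
  have "continuous_on ({- \<mu>..0} \<union> {0..}) (\<lambda>t. if t \<le> 0 then apply_bcontfun \<xi> t else mild_map \<omega> \<xi> u t)"
    by (rule continuous_on_cases) (use mild_map_continuous assms in \<open>auto simp: mild_map_0\<close>)
  moreover have "{- \<mu>..0} \<union> {0..} = {- \<mu>..}" using mu by auto
  ultimately show ?thesis by simp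
qed

lemma path_picard: "noisy \<omega> \<Longrightarrow> \<omega> 0 = 0 \<Longrightarrow> path (picard \<omega> \<xi> n)"
  by (induction n) (auto intro: path_extend simp del: if_split)

text \<open>All iterates agree up to time \<open>0\<close>, so that only the contraction term of the mild map remains.\<close>

lemma picard_contraction:
  assumes \<omega>: "noisy \<omega>" "\<omega> 0 = 0" and \<rho>: "\<rho> > 0" "L * (1 + 3 * W) * J \<rho> \<le> 1 / 2"
    and W: "\<And>r. r \<in> {0..T} \<Longrightarrow> norm (\<omega> r) \<le> W"
    and c: "c \<ge> 0" "\<And>t. t \<in> {0..T} \<Longrightarrow> norm (picard \<omega> \<xi> 1 t - \<xi> t) \<le> c" and t: "t \<in> {- \<mu>..T}"
  shows "norm (picard \<omega> \<xi> (Suc n) t - picard \<omega> \<xi> n t) \<le> c * (1 / 2) ^ n * exp (\<rho> * max 0 t)"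
  using t
proof (induction n arbitrary: t)
  case 0
  show ?case
  proof (cases "t \<le> 0")
    case False
    have "norm (picard \<omega> \<xi> 1 t - \<xi> t) \<le> c * 1" using False 0 c(2)[of t] by simp
    also have "\<dots> \<le> c * exp (\<rho> * t)" using False c(1) \<rho>(1) by (intro mult_left_mono) auto
    finally show ?thesis using False by simp
  qed (use c in simp)
next
  case (Suc n)
  define d where "d = c * (1 / 2) ^ n"
  have d: "d \<ge> 0" using c by (simp add: d_def)
  have init: "picard \<omega> \<xi> m s = \<xi> s" if "s \<le> 0" for m s using that by (cases m) auto
  show ?case
  proof (cases "t \<le> 0")
    case True
    then show ?thesis using init[OF True] c(1) by simp
  next
    case False
    then have t: "0 < t" "t \<le> T" using Suc.prems by auto
    have "norm (mild_map \<omega> \<xi> (picard \<omega> \<xi> (Suc n)) t - mild_map \<omega> \<xi> (picard \<omega> \<xi> n) t)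
        \<le> norm (\<xi> 0 - \<xi> 0) + L * W * norm (hist \<mu> (picard \<omega> \<xi> (Suc n)) 0 - hist \<mu> (picard \<omega> \<xi> n) 0)
          + L * (1 + 3 * W) * J \<rho> * (d * exp (\<rho> * t))"
    proof (rule mild_map_diff[OF path_picard[OF \<omega>] path_picard[OF \<omega>] \<omega>(1) less_imp_le[OF t(1)] \<rho>(1) d])
      fix r assume r: "r \<in> {0..t}"
      show "norm (\<omega> r) \<le> W" using r t by (intro W) auto
      show "norm (hist \<mu> (picard \<omega> \<xi> (Suc n)) r - hist \<mu> (picard \<omega> \<xi> n) r) \<le> d * exp (\<rho> * r)"
      proof (rule hist_diff_weighted[OF path_picard[OF \<omega>] path_picard[OF \<omega>] _ \<rho>(1) d])
        show "norm (picard \<omega> \<xi> (Suc n) s - picard \<omega> \<xi> n s) \<le> d" if "s \<in> {- \<mu>..0}" for s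
          using that init[of s n] init[of s "Suc n"] d by simp
        show "norm (picard \<omega> \<xi> (Suc n) s - picard \<omega> \<xi> n s) \<le> d * exp (\<rho> * s)" if "s \<in> {0..r}" for s
          using Suc.IH[of s] that r t mu unfolding d_def by (simp add: max_def del: picard.simps)
      qed (use r in auto)
    qed
    also have "hist \<mu> (picard \<omega> \<xi> (Suc n)) 0 = hist \<mu> (picard \<omega> \<xi> n) 0"
      using init[of _ n] init[of _ "Suc n"] mu by (intro hist_cong) auto
    also have "norm (\<xi> 0 - \<xi> 0) + L * W * norm (hist \<mu> (picard \<omega> \<xi> n) 0 - hist \<mu> (picard \<omega> \<xi> n) 0)
          + L * (1 + 3 * W) * J \<rho> * (d * exp (\<rho> * t)) = L * (1 + 3 * W) * J \<rho> * (d * exp (\<rho> * t))" by simp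
    also have "\<dots> \<le> 1 / 2 * (d * exp (\<rho> * t))" using d by (intro mult_right_mono \<rho>(2)) auto
    finally show ?thesis using False unfolding d_def by (simp add: max_def)
  qed
qed

text \<open>The contraction estimate also shows that the mild map may be applied to the limit.\<close>

theorem solution_exists:
  assumes \<omega>: "noisy \<omega>" "\<omega> 0 = 0" and \<xi>: "\<xi> \<in> Cmu \<mu>"
  obtains u where "solves \<omega> \<xi> u"
proof -
  let ?p = "picard \<omega> \<xi>"
  note pp = path_picard[OF \<omega>]
  define u where "u t = \<xi> t + (\<Sum>i. ?p (Suc i) t - ?p i t)" for t
  have lim: "uniform_limit {- \<mu>..T} ?p u sequentially" for T
  proof -
    obtain W where W: "\<And>r. r \<in> {0..T} \<Longrightarrow> norm (\<omega> r) \<le> W" using bounded_interval[OF \<omega>(1)] by metis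
    obtain \<rho> where \<rho>: "\<rho> > 0" "L * (1 + 3 * W) * J \<rho> \<le> 1 / 2" by (rule contraction_weight)
    have cont: "continuous_on {0..} (\<lambda>t. ?p 1 t - \<xi> t)"
      by (intro continuous_on_diff continuous_on_subset[OF pp] continuous_on_apply_bcontfun) (use mu in auto)
    obtain c where c: "c \<ge> 0" "\<And>t. t \<in> {0..T} \<Longrightarrow> norm (?p 1 t - \<xi> t) \<le> c"
      using bounded_interval[OF cont, of T] by blast
    have "uniform_limit {- \<mu>..T} (\<lambda>n t. \<Sum>i<n. ?p (Suc i) t - ?p i t) (\<lambda>t. \<Sum>i. ?p (Suc i) t - ?p i t)
        sequentially"
    proof (rule Weierstrass_m_test)
      fix n t assume t: "t \<in> {- \<mu>..T}"
      have "norm (?p (Suc n) t - ?p n t) \<le> c * (1 / 2) ^ n * exp (\<rho> * max 0 t)"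
        by (rule picard_contraction[OF \<omega> \<rho> W c t])
      also have "\<dots> \<le> c * (1 / 2) ^ n * exp (\<rho> * max 0 T)"
        using c(1) \<rho>(1) t by (intro mult_left_mono) auto
      finally show "norm (?p (Suc n) t - ?p n t) \<le> c * exp (\<rho> * max 0 T) * (1 / 2) ^ n" by (simp add: ac_simps)
    qed (intro summable_mult summable_geometric, simp)
    then have "uniform_limit {- \<mu>..T} (\<lambda>n t. \<xi> t + (\<Sum>i<n. ?p (Suc i) t - ?p i t)) u sequentially"
      unfolding u_def[abs_def] by (intro uniform_limit_add uniform_limit_const)
    moreover have "\<xi> t + (\<Sum>i<n. ?p (Suc i) t - ?p i t) = ?p n t" for n t
      by (subst sum_lessThan_telescope) simp
    ultimately show ?thesis by simp
  qed
  have u: "path u"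
  proof (rule continuous_on_Ici)
    fix T
    show "continuous_on {- \<mu>..T} u"
      by (rule uniform_limit_theorem[OF _ lim])
         (intro always_eventually allI continuous_on_subset[OF pp], auto)
  qed
  have ptw: "(\<lambda>n. ?p n t) \<longlonglongrightarrow> u t" if "t \<ge> - \<mu>" for t
    by (rule tendsto_uniform_limitI[OF lim[of t]]) (use that in auto)
  have init: "?p m s = \<xi> s" if "s \<le> 0" for m s using that by (cases m) auto
  have u_init: "u s = \<xi> s" if "s \<in> {- \<mu>..0}" for s
    using ptw[of s] that init[of s] LIMSEQ_unique[OF _ tendsto_const] by (auto simp: LIMSEQ_const_iff)
  have "u t = mild_map \<omega> \<xi> u t" if t: "t \<ge> 0" for t
  proof (cases "t = 0")
    case True
    then show ?thesis using u_init[of 0] mu \<omega>(2) by (simp add: mild_map_0)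
  next
    case False
    with t have t0: "t > 0" by simp
    obtain W where W: "\<And>r. r \<in> {0..t} \<Longrightarrow> norm (\<omega> r) \<le> W" using bounded_interval[OF \<omega>(1)] by metis
    obtain \<rho> where \<rho>: "\<rho> > 0" "L * (1 + 3 * W) * J \<rho> \<le> 1 / 2" by (rule contraction_weight)
    have "(\<lambda>n. mild_map \<omega> \<xi> (?p n) t) \<longlonglongrightarrow> mild_map \<omega> \<xi> u t"
    proof (rule LIMSEQ_I)
      fix e :: real assume e: "e > 0"
      define d where "d = e / exp (\<rho> * t)"
      have d: "d > 0" using e by (simp add: d_def)
      from uniform_limitD[OF lim[of t] d] obtain N where
        N: "\<And>n s. n \<ge> N \<Longrightarrow> s \<in> {- \<mu>..t} \<Longrightarrow> dist (?p n s) (u s) < d"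
        unfolding eventually_sequentially by blast
      have "norm (mild_map \<omega> \<xi> (?p n) t - mild_map \<omega> \<xi> u t) < e" if n: "n \<ge> N" for n
      proof -
        have Nd: "norm (?p n s - u s) \<le> d" if "s \<in> {- \<mu>..t}" for s
          using N[OF n that] by (simp add: dist_norm)
        have "norm (mild_map \<omega> \<xi> (?p n) t - mild_map \<omega> \<xi> u t)
          \<le> norm (\<xi> 0 - \<xi> 0) + L * W * norm (hist \<mu> (?p n) 0 - hist \<mu> u 0) + L * (1
              + 3 * W) * J \<rho> * (d * exp (\<rho> * t))"
        proof (rule mild_map_diff[OF pp u \<omega>(1) t \<rho>(1) less_imp_le[OF d]])
          fix r assume r: "r \<in> {0..t}"
          show "norm (\<omega> r) \<le> W" by (rule W[OF r])
          show "norm (hist \<mu> (?p n) r - hist \<mu> u r) \<le> d * exp (\<rho> * r)"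
          proof (rule hist_diff_weighted[OF pp u _ \<rho>(1) less_imp_le[OF d]])
            show "norm (?p n s - u s) \<le> d" if "s \<in> {- \<mu>..0}" for s using that t by (intro Nd) auto
            show "norm (?p n s - u s) \<le> d * exp (\<rho> * s)" if s: "s \<in> {0..r}" for s
            proof -
              have "norm (?p n s - u s) \<le> d * 1" using s r mu by (simp add: Nd)
              also have "\<dots> \<le> d * exp (\<rho> * s)" using s d \<rho>(1) by (intro mult_left_mono) auto
              finally show ?thesis .
            qed
          qed (use r in auto)
        qed
        also have "hist \<mu> (?p n) 0 = hist \<mu> u 0"
          using init[of _ n] u_init mu by (intro hist_cong) auto
        also have "norm (\<xi> 0 - \<xi> 0) + L * W * norm (hist \<mu> u 0 - hist \<mu> u 0) + L * (1
            + 3 * W) * J \<rho> * (d * exp (\<rho> * t))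
           \<le> 1 / 2 * (d * exp (\<rho> * t))"
          using mult_right_mono[OF \<rho>(2), of "d * exp (\<rho> * t)"] d by simp
        also have "\<dots> < e" using e by (simp add: d_def)
        finally show ?thesis .
      qed
      then show "\<exists>no. \<forall>n\<ge>no. norm (mild_map \<omega> \<xi> (?p n) t - mild_map \<omega> \<xi> u t) < e" by blast
    qed
    moreover have "(\<lambda>n. mild_map \<omega> \<xi> (?p n) t) \<longlonglongrightarrow> u t"
      using LIMSEQ_Suc[OF ptw[of t]] t0 mu by simp
    ultimately show ?thesis using LIMSEQ_unique by blast
  qed
  with u u_init show thesis using that unfolding solves_def by blast
qed

lemma solvesD:
  assumes "solves \<omega> \<xi> u"
  shows "path u" "\<And>s. s \<in> {- \<mu>..0} \<Longrightarrow> u s = \<xi> s" "\<And>t. t \<ge> 0 \<Longrightarrow> u t = mild_map \<omega> \<xi> u t"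
  using assms unfolding solves_def by auto

lemma solves_hist_0: "solves \<omega> \<xi> u \<Longrightarrow> \<xi> \<in> Cmu \<mu> \<Longrightarrow> hist \<mu> u 0 = \<xi>"
  using hist_eq_initial[of \<xi> \<mu> u] mu unfolding solves_def by simp

text \<open>The weighted contraction also gives Lipschitz dependence on the initial segment and on the
  noise path (in the sup norm over \<open>[0,T]\<close>), with a constant depending only on \<open>T\<close> and on a bound
  for one of the two noise paths.\<close>

definition stability_bound :: "real \<Rightarrow> real \<Rightarrow> real \<Rightarrow> bool" where
  "stability_bound T W B \<longleftrightarrow> (\<forall>\<omega> \<eta> \<xi> \<zeta> u v \<delta>. \<forall>t\<in>{0..T}. noisy \<omega> \<longrightarrow> noisy \<eta> \<longrightarrow> \<xi> \<in> Cmu \<mu> \<longrightarrow> \<zeta> \<in> Cmu \<mu> \<longrightarrow>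
     solves \<omega> \<xi> u \<longrightarrow> solves \<eta> \<zeta> v \<longrightarrow> (\<forall>r\<in>{0..T}. norm (\<omega> r) \<le> W) \<longrightarrow> (\<forall>r\<in>{0..T}. norm (\<omega> r - \<eta> r) \<le> \<delta>) \<longrightarrow>
     norm (hist \<mu> u t - hist \<mu> v t) \<le> B * (norm (\<xi> - \<zeta>) + \<delta>))"

lemma stability_boundD:
  assumes "stability_bound T W B" "noisy \<omega>" "noisy \<eta>" "\<xi> \<in> Cmu \<mu>" "\<zeta> \<in> Cmu \<mu>" "solves \<omega> \<xi> u" "solves \<eta> \<zeta> v"
    "\<And>r. r \<in> {0..T} \<Longrightarrow> norm (\<omega> r) \<le> W" "\<And>r. r \<in> {0..T} \<Longrightarrow> norm (\<omega> r - \<eta> r) \<le> \<delta>" "t \<in> {0..T}"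
  shows "norm (hist \<mu> u t - hist \<mu> v t) \<le> B * (norm (\<xi> - \<zeta>) + \<delta>)"
  using assms unfolding stability_bound_def by simp

theorem solution_stability: "\<exists>B\<ge>0. stability_bound T W B"
proof -
  obtain \<rho> where \<rho>: "\<rho> > 0" "L * (1 + 3 * W) * J \<rho> \<le> 1 / 2" by (rule contraction_weight)
  define B1 where "B1 = 2 * (2 + L * \<bar>W\<bar> + C * (J lam + 1))"
  have B1: "B1 \<ge> 1" "B1 \<ge> 0" using L C J_pos[OF lam] by (simp_all add: B1_def add_increasing2)
  have "stability_bound T W (B1 * exp (\<rho> * T))"
    unfolding stability_bound_def
  proof (intro allI ballI impI)
    fix \<omega> \<eta> :: "real \<Rightarrow> 'u" and \<xi> \<zeta> u v \<delta> t
    assume t: "t \<in> {0..T}" and \<omega>: "noisy \<omega>" and \<eta>: "noisy \<eta>" and init: "\<xi> \<in> Cmu \<mu>" "\<zeta> \<in> Cmu \<mu>"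
      and u: "solves \<omega> \<xi> u" and v: "solves \<eta> \<zeta> v"
      and W': "\<forall>r\<in>{0..T}. norm (\<omega> r) \<le> W" and \<delta>': "\<forall>r\<in>{0..T}. norm (\<omega> r - \<eta> r) \<le> \<delta>"
    have W: "norm (\<omega> r) \<le> W" and \<delta>: "norm (\<omega> r - \<eta> r) \<le> \<delta>" if "r \<in> {0..T}" for r
      using W' \<delta>' that by auto
    note pu = solvesD(1)[OF u] and pv = solvesD(1)[OF v]
    have W0: "W \<ge> 0" by (rule order_trans[OF norm_ge_zero W[OF t]])
    have \<delta>0: "\<delta> \<ge> 0" by (rule order_trans[OF norm_ge_zero \<delta>[OF t]])
    define n0 where "n0 = norm (\<xi> - \<zeta>)"
    have n0: "n0 \<ge> 0" by (simp add: n0_def)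
    have at0: "norm (\<xi> s - \<zeta> s) \<le> n0" for s using norm_bounded[of "\<xi> - \<zeta>" s] by (simp add: n0_def)
    define f where "f = (\<lambda>r. norm (u r - v r) / exp (\<rho> * r))"
    \<comment> \<open>At a maximum point \<open>x\<close> of the weighted difference \<open>f\<close> the contraction term is at most \<open>c / 2\<close>.\<close>
    have "continuous_on {0..T} f" unfolding f_def
      by (intro continuous_intros continuous_on_subset[OF pu] continuous_on_subset[OF pv]) (use mu in auto)
    then obtain x where x: "x \<in> {0..T}" "\<And>r. r \<in> {0..T} \<Longrightarrow> f r \<le> f x"
      using continuous_attains_sup[of "{0..T}" f] t by auto
    define c where "c = max (f x) n0"
    have c: "c \<ge> 0" "f x \<le> c" "n0 \<le> c" using n0 by (auto simp: c_def)
    have neg: "norm (u s - v s) \<le> c" if "s \<in> {- \<mu>..0}" for s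
      using at0[of s] c(3) solvesD(2)[OF u that] solvesD(2)[OF v that] by simp
    have pos: "norm (u s - v s) \<le> c * exp (\<rho> * s)" if "s \<in> {0..T}" for s
      using order_trans[OF x(2)[OF that] c(2)] by (simp add: f_def pos_divide_le_eq)
    have h: "norm (hist \<mu> u r - hist \<mu> v r) \<le> c * exp (\<rho> * r)" if r: "r \<in> {0..T}" for r
      by (rule hist_diff_weighted[OF pu pv _ \<rho>(1) c(1) neg pos]) (use r in auto)
    have "norm (mild_map \<omega> \<xi> u x - mild_map \<omega> \<zeta> v x) \<le> norm (\<xi> 0 - \<zeta> 0)
      + L * W * norm (hist \<mu> u 0 - hist \<mu> v 0) + L * (1 + 3 * W) * J \<rho> * (c * exp (\<rho> * x))"
      by (rule mild_map_diff[OF pu pv \<omega> _ \<rho>(1) c(1) W h]) (use x in auto)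
    also have "\<dots> \<le> n0 + L * W * n0 + 1 / 2 * (c * exp (\<rho> * x))"
      using at0[of 0] c(1) solves_hist_0[OF u init(1)] solves_hist_0[OF v init(2)] unfolding n0_def
      by (intro add_mono mult_right_mono \<rho>(2)) auto
    finally have d1: "norm (mild_map \<omega> \<xi> u x - mild_map \<omega> \<zeta> v x) \<le> (1 + L * W) * n0 + 1 / 2 * (c * exp (\<rho> * x))"
      by (simp add: algebra_simps)
    have "mild_map \<omega> \<zeta> v x - mild_map \<eta> \<zeta> v x = noise v (\<lambda>r. \<omega> r - \<eta> r) x"
      unfolding mild_map_def noise_diff[OF pv \<omega> \<eta>, symmetric] by simp
    also have "norm \<dots> \<le> C * \<delta> * (J lam + 1)"
      by (rule noise_bound[OF pv _ _ lam \<delta>0]) (use x \<delta> in \<open>auto intro!: continuous_on_diff \<omega> \<eta>\<close>)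
    finally have d2: "norm (mild_map \<omega> \<zeta> v x - mild_map \<eta> \<zeta> v x) \<le> C * \<delta> * (J lam + 1)" .
    have "norm (u x - v x) \<le> (1 + L * W) * n0 + C * \<delta> * (J lam + 1) + 1 / 2 * (c * exp (\<rho> * x))"
      using norm_triangle_ineq[of "mild_map \<omega> \<xi> u x - mild_map \<omega> \<zeta> v x" "mild_map \<omega> \<zeta> v x - mild_map \<eta> \<zeta> v x"]
        d1 d2 solvesD(3)[OF u, of x] solvesD(3)[OF v, of x] x(1) by simp
    then have "f x \<le> ((1 + L * W) * n0 + C * \<delta> * (J lam + 1) + 1 / 2 * (c * exp (\<rho> * x))) / exp (\<rho> * x)"
      unfolding f_def by (intro divide_right_mono) auto
    also have "\<dots> = ((1 + L * W) * n0 + C * \<delta> * (J lam + 1)) / exp (\<rho> * x) + c / 2"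
      by (simp add: add_divide_distrib)
    also have "\<dots> \<le> ((1 + L * W) * n0 + C * \<delta> * (J lam + 1)) / 1 + c / 2"
      using x(1) \<rho>(1) L W0 n0 C \<delta>0 J_pos[OF lam]
      by (intro add_right_mono divide_left_mono add_nonneg_nonneg mult_nonneg_nonneg) auto
    finally have "c \<le> 2 * ((1 + L * W) * n0 + C * \<delta> * (J lam + 1)) + 2 * n0"
    proof -
      assume a: "f x \<le> ((1 + L * W) * n0 + C * \<delta> * (J lam + 1)) / 1 + c / 2"
      have "0 \<le> (1 + L * W) * n0 + C * \<delta> * (J lam + 1)" using L W0 n0 C \<delta>0 J_pos[OF lam] by simp
      then show ?thesis using a n0 unfolding c_def by (auto simp: max_def split: if_splits)
    qed
    also have "\<dots> \<le> B1 * (n0 + \<delta>)"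
    proof -
      have "0 \<le> C * (J lam + 1) * n0" "0 \<le> (2 + L * W) * \<delta>"
        using L W0 n0 C \<delta>0 J_pos[OF lam] by simp_all
      then show ?thesis using W0 unfolding B1_def by (simp add: algebra_simps)
    qed
    finally have cB: "c \<le> B1 * (n0 + \<delta>)" .
    have "norm (hist \<mu> u t - hist \<mu> v t) \<le> c * exp (\<rho> * t)" by (rule h[OF t])
    also have "\<dots> \<le> (B1 * (n0 + \<delta>)) * exp (\<rho> * T)"
      using cB t \<rho>(1) B1(2) n0 \<delta>0 by (intro mult_mono) auto
    finally show "norm (hist \<mu> u t - hist \<mu> v t) \<le> B1 * exp (\<rho> * T) * (norm (\<xi> - \<zeta>) + \<delta>)"
      by (simp add: n0_def ac_simps)
  qed
  moreover have "0 \<le> B1 * exp (\<rho> * T)" using B1 by simp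
  ultimately show ?thesis by blast
qed

lemma solution_unique:
  assumes "noisy \<omega>" "\<xi> \<in> Cmu \<mu>" "solves \<omega> \<xi> u" "solves \<omega> \<xi> v" "t \<ge> 0"
  shows "hist \<mu> u t = hist \<mu> v t"
proof -
  obtain W where W: "\<And>r. r \<in> {0..t} \<Longrightarrow> norm (\<omega> r) \<le> W" using bounded_interval[OF assms(1)] by metis
  obtain B where B: "stability_bound t W B" using solution_stability by blast
  have "norm (hist \<mu> u t - hist \<mu> v t) \<le> B * (norm (\<xi> - \<xi>) + 0)"
    by (rule stability_boundD[OF B assms(1) assms(1) assms(2) assms(2) assms(3) assms(4) W]) (use assms in auto)
  then show ?thesis by simp
qed

section \<open>The cocycle property\<close>

lemma conv_shift:
  fixes R :: "real \<Rightarrow> 'h \<Rightarrow>\<^sub>L 'h"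
  assumes int: "set_integrable lborel {0..t + \<tau>} (\<lambda>s. R s (g (t + \<tau> - s)))" and t: "0 \<le> t" "0 \<le> \<tau>"
    and R: "\<And>s. s > 0 \<Longrightarrow> R (t + s) = S t o\<^sub>L R s"
    and int': "set_integrable lborel {0..\<tau>} (\<lambda>s. R s (g (\<tau> - s)))"
  shows "conv R g (t + \<tau>) = conv R (\<lambda>r. g (r + \<tau>)) t + S t (conv R g \<tau>)"
proof -
  have "conv R g (t + \<tau>) = (LINT s:{0..t}|lborel. R s (g (t + \<tau> - s))) + (LINT s:{0..\<tau>}|lborel. R (t
      + s) (g (t + \<tau> - (t + s))))"
    unfolding conv_def by (rule split_integral[OF int t])
  also have "(LINT s:{0..t}|lborel. R s (g (t + \<tau> - s))) = conv R (\<lambda>r. g (r + \<tau>)) t"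
    unfolding conv_def by (simp add: algebra_simps)
  also have "(LINT s:{0..\<tau>}|lborel. R (t + s) (g (t + \<tau> - (t + s)))) = S t (conv R g \<tau>)"
  proof -
    have "(LINT s|lborel. S t (indicator {0..\<tau>} s *\<^sub>R R s (g (\<tau> - s)))) = S t (conv R g \<tau>)"
      using integral_bounded_linear[OF blinfun.bounded_linear_right int'[unfolded set_integrable_def], of "S t"]
      unfolding conv_def set_lebesgue_integral_def .
    moreover have "(LINT s|lborel. indicator {0..\<tau>} s *\<^sub>R R (t + s) (g (t + \<tau> - (t + s))))
        = (LINT s|lborel. S t (indicator {0..\<tau>} s *\<^sub>R R s (g (\<tau> - s))))"
      by (rule integral_discrete_difference[of "{0}"])
         (auto simp: R blinfun.scaleR_right split: split_indicator)
    ultimately show ?thesis unfolding set_lebesgue_integral_def by simp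
  qed
  finally show ?thesis .
qed

lemma noise_shift:
  assumes u: "path u" and \<omega>: "noisy \<omega>" and t: "0 \<le> t" "0 \<le> \<tau>"
  shows "noise u \<omega> (t + \<tau>) = noise (\<lambda>s. u (s + \<tau>)) (\<lambda>r. \<omega> (r + \<tau>)) t
    + S t (noise u \<omega> \<tau> - G (hist \<mu> u \<tau>) (\<omega> \<tau>))"
proof -
  have "conv S' (\<lambda>r. G (hist \<mu> u r) (\<omega> r)) (t + \<tau>)
      = conv S' (\<lambda>r. G (hist \<mu> u (r + \<tau>)) (\<omega> (r + \<tau>))) t + S t (conv S' (\<lambda>r. G (hist \<mu> u r) (\<omega> r)) \<tau>)"
    by (rule conv_shift) (use t S'_add in \<open>auto intro: S'_integrable[OF u \<omega>]\<close>)
  moreover have "conv S (\<lambda>r. K (hist \<mu> u r) (\<omega> r)) (t + \<tau>)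
      = conv S (\<lambda>r. K (hist \<mu> u (r + \<tau>)) (\<omega> (r + \<tau>))) t + S t (conv S (\<lambda>r. K (hist \<mu> u r) (\<omega> r)) \<tau>)"
    by (rule conv_shift) (use t S_add in \<open>auto intro: S_integrable[OF forcing_continuous(2)[OF u \<omega>]]\<close>)
  ultimately show ?thesis
    unfolding noise_def hist_shift by (simp add: blinfun.diff_right blinfun.add_right algebra_simps)
qed

text \<open>Splitting the integrals at \<open>\<tau>\<close> gives the equation for the shifted path \<open>r \<mapsto> \<omega>(r + \<tau>)\<close>, which does
  not vanish at \<open>0\<close>; subtracting the constant path \<open>\<omega>(\<tau>)\<close> removes exactly the surplus term
  \<open>S(t) G(u\<^sub>\<tau>) \<omega>(\<tau>)\<close>.\<close>

theorem solves_shift: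
  assumes sol: "solves \<omega> \<xi> u" and \<omega>: "noisy \<omega>" and \<tau>: "\<tau> \<ge> 0"
  shows "solves (wiener_shift \<tau> \<omega>) (hist \<mu> u \<tau>) (\<lambda>s. u (s + \<tau>))"
  unfolding solves_def
proof (intro conjI ballI allI impI)
  note u = solvesD(1)[OF sol]
  define v where "v = (\<lambda>s. u (s + \<tau>))"
  show v: "path (\<lambda>s. u (s + \<tau>))" by (rule path_shift[OF u \<tau>])
  have h: "hist \<mu> u \<tau> s = u (\<tau> + max (- \<mu>) (min s 0))" for s
    using hist_apply[OF path_cont[OF u \<tau>]] mu by simp
  show "u (s + \<tau>) = hist \<mu> u \<tau> s" if "s \<in> {- \<mu>..0}" for s
    using that by (simp add: h add.commute)
  fix t :: real assume t: "t \<ge> 0"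
  have \<omega>\<tau>: "noisy (\<lambda>r. \<omega> (r + \<tau>))"
    by (rule continuous_on_compose2[OF \<omega>]) (use \<tau> in \<open>auto intro!: continuous_intros\<close>)
  have Fs: "conv S (\<lambda>r. F (hist \<mu> u r)) (t + \<tau>)
      = conv S (\<lambda>r. F (hist \<mu> u (r + \<tau>))) t + S t (conv S (\<lambda>r. F (hist \<mu> u r)) \<tau>)"
    by (rule conv_shift) (use t \<tau> S_add in \<open>auto intro: S_integrable[OF coeff_continuous(1)[OF u]]\<close>)
  have "noise v (\<lambda>r. \<omega> (r + \<tau>)) t - noise v (\<lambda>_. \<omega> \<tau>) t = noise v (wiener_shift \<tau> \<omega>) t"
    using noise_diff[OF v[folded v_def] \<omega>\<tau> continuous_on_const] by (simp add: wiener_shift_def)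
  moreover have "noise v (\<lambda>_. \<omega> \<tau>) t = S t (G (hist \<mu> u \<tau>) (\<omega> \<tau>))"
    using noise_const[OF v[folded v_def] t] unfolding v_def hist_shift by simp
  ultimately have N: "noise v (\<lambda>r. \<omega> (r + \<tau>)) t = noise v (wiener_shift \<tau> \<omega>) t + S t (G (hist \<mu> u \<tau>) (\<omega> \<tau>))"
    by (simp add: algebra_simps)
  have "u (t + \<tau>) = S t (S \<tau> (\<xi> 0)) + conv S (\<lambda>r. F (hist \<mu> u r)) (t + \<tau>) + noise u \<omega> (t + \<tau>)"
    using solvesD(3)[OF sol, of "t + \<tau>"] t \<tau> by (simp add: mild_map_def S_add)
  also have "\<dots> = S t (mild_map \<omega> \<xi> u \<tau>) + conv S (\<lambda>r. F (hist \<mu> u (r + \<tau>))) t + noise v (wiener_shift \<tau> \<omega>) t"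
    unfolding Fs noise_shift[OF u \<omega> t \<tau>] N[unfolded v_def] v_def mild_map_def
    by (simp add: blinfun.diff_right blinfun.add_right algebra_simps)
  also have "mild_map \<omega> \<xi> u \<tau> = hist \<mu> u \<tau> 0"
    using solvesD(3)[OF sol \<tau>] mu by (simp add: h)
  finally show "u (t + \<tau>) = mild_map (wiener_shift \<tau> \<omega>) (hist \<mu> u \<tau>) (\<lambda>s. u (s + \<tau>)) t"
    unfolding mild_map_def v_def hist_shift .
qed

end

section \<open>Total boundedness in the space of segments\<close>

lemma compact_closure_totally_bounded:
  fixes A :: "'a::complete_space set"
  assumes "\<And>e. e > 0 \<Longrightarrow> \<exists>k. finite k \<and> A \<subseteq> (\<Union>x\<in>k. ball x e)"
  shows "compact (closure A)"
  unfolding compact_eq_totally_bounded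
proof (rule conjI, simp add: complete_eq_closed, intro allI impI)
  fix e :: real assume "e > 0"
  then obtain k where k: "finite k" "A \<subseteq> (\<Union>x\<in>k. ball x (e / 2))" using assms[of "e / 2"] by auto
  have "A \<subseteq> (\<Union>x\<in>k. cball x (e / 2))" using k(2) by force
  then have "closure A \<subseteq> (\<Union>x\<in>k. cball x (e / 2))"
    using k(1) by (intro closure_minimal closed_UN) auto
  also have "\<dots> \<subseteq> (\<Union>x\<in>k. ball x e)" using \<open>e > 0\<close> by (intro UN_mono) auto
  finally show "\<exists>k. finite k \<and> closure A \<subseteq> (\<Union>x\<in>k. ball x e)" using k(1) by blast
qed

lemma compact_closure_imp_finite_net:
  fixes A :: "'a::metric_space set"
  assumes "compact (closure A)" "e > 0"
  obtains k where "finite k" "\<And>x. x \<in> A \<Longrightarrow> \<exists>y\<in>k. dist y x < e"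
proof -
  obtain k where "finite k" "closure A \<subseteq> (\<Union>x\<in>k. ball x e)"
    using assms unfolding compact_eq_totally_bounded by blast
  then show thesis using closure_subset[of A] by (intro that[of k]) force+
qed

text \<open>The Arzela-Ascoli criterion with values in a space that need not have the Heine-Borel property:
  each segment is coded by nearest net points at the nodes of a fine grid, and segments with the
  same code are close.\<close>

lemma Cmu_compact_closure:
  fixes \<F> :: "(real \<Rightarrow>\<^sub>C 'h::{real_normed_vector,complete_space}) set"
  assumes sub: "\<F> \<subseteq> Cmu \<mu>" and mu: "\<mu> > 0"
    and net: "\<And>e. e > 0 \<Longrightarrow> \<exists>N. finite N \<and> (\<forall>x\<in>\<F>. \<forall>s\<in>{- \<mu>..0}. \<exists>n\<in>N. dist (apply_bcontfun x s) n < e)"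
    and equi: "\<And>e. e > 0 \<Longrightarrow> \<exists>\<delta>>0. \<forall>x\<in>\<F>. \<forall>s\<in>{- \<mu>..0}. \<forall>t\<in>{- \<mu>..0}. \<bar>s - t\<bar> < \<delta> \<longrightarrow>
        dist (apply_bcontfun x s) (apply_bcontfun x t) < e"
  shows "compact (closure \<F>)"
proof (rule compact_closure_totally_bounded)
  fix e :: real assume "e > 0"
  then have e8: "e / 8 > 0" by simp
  obtain N where N: "finite N" "\<And>x s. x \<in> \<F> \<Longrightarrow> s \<in> {- \<mu>..0} \<Longrightarrow> \<exists>n\<in>N. dist (apply_bcontfun x s) n < e / 8"
    using net[OF e8] by blast
  obtain \<delta> where \<delta>: "\<delta> > 0" "\<And>x s t. x \<in> \<F> \<Longrightarrow> s \<in> {- \<mu>..0} \<Longrightarrow> t \<in> {- \<mu>..0} \<Longrightarrow> \<bar>s - t\<bar> < \<delta> \<Longrightarrow>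
        dist (apply_bcontfun x s) (apply_bcontfun x t) < e / 8"
    using equi[OF e8] by blast
  define M where "M = nat \<lceil>\<mu> / \<delta>\<rceil>"
  \<comment> \<open>Nodes of mesh \<open>\<delta> / 2\<close>, starting at \<open>0\<close> and cut off at \<open>-\<mu>\<close>.\<close>
  define p where "p i = - min \<mu> (real i * \<delta> / 2)" for i :: nat
  have p: "p i \<in> {- \<mu>..0}" for i using mu \<delta>(1) by (auto simp: p_def)
  define I where "I = {..2 * M}"
  define code where "code x = (\<lambda>i\<in>I. SOME n. n \<in> N \<and> dist (apply_bcontfun x (p i)) n < e / 8)" for x
  have code: "code x i \<in> N" "dist (apply_bcontfun x (p i)) (code x i) < e / 8" if "x \<in> \<F>" "i \<in> I" for x i
  proof -
    have "\<exists>n. n \<in> N \<and> dist (apply_bcontfun x (p i)) n < e / 8" using N(2)[OF that(1) p] by blast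
    from someI_ex[OF this] show "code x i \<in> N" "dist (apply_bcontfun x (p i)) (code x i) < e / 8"
      using that(2) by (auto simp: code_def)
  qed
  have "code ` \<F> \<subseteq> PiE I (\<lambda>_. N)" using code(1) by (auto simp: code_def)
  then have fin: "finite (code ` \<F>)" by (rule finite_subset) (auto simp: I_def intro!: finite_PiE N(1))
  define rep where "rep c = (SOME x. x \<in> \<F> \<and> code x = c)" for c
  have "dist (rep (code x)) x < e" if x: "x \<in> \<F>" for x
  proof -
    have "\<exists>y. y \<in> \<F> \<and> code y = code x" using x by blast
    from someI_ex[OF this] have y: "rep (code x) \<in> \<F>" "code (rep (code x)) = code x"
      by (auto simp: rep_def)
    define y where "y = rep (code x)"
    have close: "dist (apply_bcontfun y s) (apply_bcontfun x s) \<le> e / 2" if s: "s \<in> {- \<mu>..0}" for s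
    proof -
      define i where "i = nat \<lfloor>- s / (\<delta> / 2)\<rfloor>"
      have i1: "real i \<le> - s / (\<delta> / 2)" "- s / (\<delta> / 2) < real i + 1"
      proof -
        have "0 \<le> - s / (\<delta> / 2)" using s \<delta>(1) by (intro divide_nonneg_pos) auto
        then have "real i = of_int \<lfloor>- s / (\<delta> / 2)\<rfloor>" unfolding i_def by simp
        then show "real i \<le> - s / (\<delta> / 2)" "- s / (\<delta> / 2) < real i + 1" by linarith+
      qed
      have i2: "real i * \<delta> / 2 \<le> - s" "- s < real i * \<delta> / 2 + \<delta> / 2"
        using i1 \<delta>(1) by (simp_all add: field_simps)
      have pi: "p i = - (real i * \<delta> / 2)" using i2 s by (simp add: p_def)
      have "- s / (\<delta> / 2) \<le> \<mu> / (\<delta> / 2)" using s \<delta>(1) by (intro divide_right_mono) auto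
      then have "real i \<le> \<mu> / (\<delta> / 2)" using i1(1) by linarith
      also have "\<dots> = 2 * (\<mu> / \<delta>)" by simp
      also have "\<dots> \<le> 2 * real M" unfolding M_def by linarith
      finally have iI: "i \<in> I" unfolding I_def by simp
      have si: "\<bar>s - p i\<bar> < \<delta>" "\<bar>p i - s\<bar> < \<delta>" using i2 \<delta>(1) unfolding pi by (auto simp: abs_if)
      have "dist (apply_bcontfun y s) (apply_bcontfun x s)
        \<le> dist (apply_bcontfun y s) (apply_bcontfun y (p i)) + dist (apply_bcontfun y (p i)) (code x i)
          + dist (apply_bcontfun x (p i)) (code x i) + dist (apply_bcontfun x (p i)) (apply_bcontfun x s)"
        by metric
      also have "\<dots> \<le> e / 8 + e / 8 + e / 8 + e / 8"
        using \<delta>(2)[OF _ s p si(1), of y] \<delta>(2)[OF x p s si(2)] code(2)[OF x iI] code(2)[of y i] iI y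
        unfolding y_def by (intro add_mono) (auto intro: less_imp_le)
      finally show ?thesis by simp
    qed
    have "dist y x \<le> e / 2"
    proof (rule dist_bound)
      fix s
      have "max (- \<mu>) (min s 0) \<in> {- \<mu>..0}" using mu by auto
      from close[OF this] show "dist (apply_bcontfun y s) (apply_bcontfun x s) \<le> e / 2"
        using sub x y unfolding y_def Cmu_def by (metis (mono_tags, lifting) mem_Collect_eq subset_eq)
    qed
    then show ?thesis using \<open>e > 0\<close> unfolding y_def by simp
  qed
  then have "\<F> \<subseteq> (\<Union>x\<in>rep ` code ` \<F>. ball x e)" by auto
  with fin show "\<exists>k. finite k \<and> \<F> \<subseteq> (\<Union>x\<in>k. ball x e)" by blast
qed

section \<open>The a priori bound\<close>

context delay_equation begin

text \<open>Possible since \<open>cF < lam\<close>, which is the case \<open>\<epsilon> = 0\<close>.\<close>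

lemma small_rate:
  obtains \<epsilon> where "0 < \<epsilon>" "\<epsilon> < lam" "cF * exp (\<epsilon> * \<mu>) < lam - \<epsilon>"
proof -
  have "((\<lambda>\<epsilon>. lam - \<epsilon> - cF * exp (\<epsilon> * \<mu>)) \<longlongrightarrow> lam - 0 - cF * exp (0 * \<mu>)) (at_right 0)"
    by (intro tendsto_intros)
  then have "eventually (\<lambda>\<epsilon>. lam - \<epsilon> - cF * exp (\<epsilon> * \<mu>) > 0) (at_right 0)"
    by (rule order_tendstoD) (use cF in auto)
  moreover have "eventually (\<lambda>\<epsilon>. \<epsilon> < lam) (at_right (0::real))"
    using eventually_at_right_field lam by blast
  ultimately have "eventually (\<lambda>\<epsilon>. lam - \<epsilon> - cF * exp (\<epsilon> * \<mu>) > 0 \<and> \<epsilon> < lam \<and> \<epsilon> > 0) (at_right 0)"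
    using eventually_at_right_less[of 0] by eventually_elim auto
  then have "\<exists>\<epsilon>. lam - \<epsilon> - cF * exp (\<epsilon> * \<mu>) > 0 \<and> \<epsilon> < lam \<and> \<epsilon> > 0"
    by (rule eventually_happens'[rotated]) simp
  then show thesis using that by auto
qed

text \<open>The noise is measured by its oscillation weighted with the same exponential as the bound, which is
  the form that is stable under pullback.\<close>

definition a_priori_constants :: "real \<Rightarrow> real \<Rightarrow> bool" where
  "a_priori_constants \<epsilon> c \<longleftrightarrow> (\<forall>\<omega> \<xi> u T V. noisy \<omega> \<longrightarrow> \<omega> 0 = 0 \<longrightarrow> \<xi> \<in> Cmu \<mu> \<longrightarrow> solves \<omega> \<xi> u \<longrightarrow> 0 \<le> V \<longrightarrow>
     (\<forall>t\<in>{0..T}. \<forall>r\<in>{0..t}. norm (\<omega> r - \<omega> t) \<le> V * exp (- \<epsilon> * r)) \<longrightarrow>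
     (\<forall>t\<in>{0..T}. norm (hist \<mu> u t) \<le> c * ((norm \<xi> + V) * exp (- \<epsilon> * t) + 1)))"

lemma a_prioriD:
  assumes "a_priori_constants \<epsilon> c" "noisy \<omega>" "\<omega> 0 = 0" "\<xi> \<in> Cmu \<mu>" "solves \<omega> \<xi> u" "0 \<le> V"
    "\<And>t r. t \<in> {0..T} \<Longrightarrow> r \<in> {0..t} \<Longrightarrow> norm (\<omega> r - \<omega> t) \<le> V * exp (- \<epsilon> * r)" "t \<in> {0..T}"
  shows "norm (hist \<mu> u t) \<le> c * ((norm \<xi> + V) * exp (- \<epsilon> * t) + 1)"
  by (rule assms(1)[unfolded a_priori_constants_def, rule_format,
        OF assms(2) assms(3) assms(4) assms(5) assms(6) _ assms(8)]) (rule assms(7))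

text \<open>The function \<open>z t = \<alpha> exp (- \<epsilon> t) + \<beta>\<close> is a strict supersolution of the integral inequality
  satisfied by \<open>norm (u t)\<close>: if \<open>norm (u t)\<close> exceeded \<open>z t\<close>, then at a maximum point of the quotient
  \<open>norm (u t) / z t\<close> the inequality would give a strictly smaller value of this quotient.\<close>

theorem a_priori: "\<exists>\<epsilon>>0. \<exists>c>0. a_priori_constants \<epsilon> c"
proof -
  obtain \<epsilon> where \<epsilon>: "0 < \<epsilon>" "\<epsilon> < lam" "cF * exp (\<epsilon> * \<mu>) < lam - \<epsilon>" by (rule small_rate)
  define \<kappa> where "\<kappa> = lam - \<epsilon>"
  have \<kappa>: "\<kappa> > 0" using \<epsilon> by (simp add: \<kappa>_def)
  define \<theta> where "\<theta> = cF * exp (\<epsilon> * \<mu>) / \<kappa>"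
  have \<theta>: "0 \<le> \<theta>" "\<theta> < 1" using \<epsilon> \<kappa> cF by (simp_all add: \<theta>_def \<kappa>_def)
  define B where "B = C * (J \<kappa> + 2)"
  have B: "B \<ge> 0" using C J_pos[OF \<kappa>] by (simp add: B_def)
  \<comment> \<open>\<open>\<alpha>\<close> and \<open>\<beta>\<close> are chosen such that \<open>(1 - \<theta>) z\<close> is the inhomogeneous part of the inequality plus \<open>1\<close>.\<close>
  define \<beta> where "\<beta> = (C / \<kappa> + 1) / (1 - \<theta>)"
  have \<beta>: "\<beta> > 0" using C \<kappa> \<theta> by (simp add: \<beta>_def add_nonneg_pos)
  define c where "c = max \<beta> (exp (\<epsilon> * \<mu>) * (1 + B) / (1 - \<theta>))"
  have c: "c > 0" using \<beta> by (simp add: c_def)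
  have "a_priori_constants \<epsilon> c"
    unfolding a_priori_constants_def
  proof (intro allI impI ballI)
    fix \<omega> \<xi> u T V t0
    assume \<omega>: "noisy \<omega>" "\<omega> 0 = 0" and \<xi>: "\<xi> \<in> Cmu \<mu>" and sol: "solves \<omega> \<xi> u" and V: "0 \<le> V"
      and osc: "\<forall>t\<in>{0..T}. \<forall>r\<in>{0..t}. norm (\<omega> r - \<omega> t) \<le> V * exp (- \<epsilon> * r)" and t0: "t0 \<in> {0..T}"
    note u = solvesD(1)[OF sol]
    define q where "q = norm \<xi> + B * V"
    have q: "q \<ge> 0" "norm \<xi> \<le> q" using B V by (auto simp: q_def)
    define \<alpha> where "\<alpha> = q / (1 - \<theta>)"
    have \<alpha>: "\<alpha> \<ge> q"
    proof -
      have "q / 1 \<le> q / (1 - \<theta>)" using q \<theta> by (intro divide_left_mono) auto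
      then show ?thesis by (simp add: \<alpha>_def)
    qed
    have \<alpha>0: "\<alpha> \<ge> 0" using \<alpha> q by simp
    define z where "z = (\<lambda>t. \<alpha> * exp (- \<epsilon> * t) + \<beta>)"
    have z: "z t > 0" for t using \<alpha>0 \<beta> by (simp add: z_def add_nonneg_pos)
    have "continuous_on {- \<mu>..T} (\<lambda>t. norm (u t) / z t)"
      unfolding z_def using \<alpha>0 \<beta>
      by (intro continuous_intros continuous_on_subset[OF u]) (auto simp: add_nonneg_eq_0_iff z[unfolded
          z_def, THEN less_imp_neq, symmetric])
    then obtain x where x: "x \<in> {- \<mu>..T}" "\<And>s. s \<in> {- \<mu>..T} \<Longrightarrow> norm (u s) / z s \<le> norm (u x) / z x"
      using continuous_attains_sup[of "{- \<mu>..T}" "\<lambda>t. norm (u t) / z t"] t0 mu by fastforce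
    define m where "m = norm (u x) / z x"
    have m0: "m \<ge> 0" using z[of x] by (simp add: m_def)
    have le_m: "norm (u s) \<le> m * z s" if "s \<in> {- \<mu>..T}" for s
      using x(2)[OF that] z[of s] by (simp add: m_def pos_divide_le_eq)
    have h_le: "norm (hist \<mu> u r) \<le> m * (\<alpha> * exp (\<epsilon> * \<mu>) * exp (- \<epsilon> * r) + \<beta>)" if r: "r \<in> {0..T}" for r
    proof (rule norm_hist_le)
      show "continuous_on {r - \<mu>..r} u" using path_cont[OF u] r by simp
      fix s assume s: "s \<in> {r - \<mu>..r}"
      have "norm (u s) \<le> m * z s" using s r by (intro le_m) auto
      also have "\<dots> \<le> m * (\<alpha> * exp (\<epsilon> * \<mu>) * exp (- \<epsilon> * r) + \<beta>)"
      proof -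
        have "\<epsilon> * (r - \<mu>) \<le> \<epsilon> * s" using s \<epsilon>(1) by (intro mult_left_mono) auto
        then have "exp (- \<epsilon> * s) \<le> exp (\<epsilon> * \<mu>) * exp (- \<epsilon> * r)" by (simp add: mult_exp_exp algebra_simps)
        from mult_left_mono[OF this \<alpha>0] show ?thesis
          unfolding z_def by (intro mult_left_mono m0 add_right_mono) (simp add: mult.assoc)
      qed
      finally show "norm (u s) \<le> m * (\<alpha> * exp (\<epsilon> * \<mu>) * exp (- \<epsilon> * r) + \<beta>)" .
    qed (use mu in auto)
    have "m \<le> 1"
    proof (rule ccontr)
      assume "\<not> m \<le> 1"
      then have m1: "m > 1" by simp
      show False
      proof (cases "x \<le> 0")
        case True
        have "norm (u x) \<le> norm \<xi>" using True x(1) solvesD(2)[OF sol, of x] norm_bounded[of \<xi> x] by simp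
        also have "\<dots> \<le> \<alpha> * 1" using q \<alpha> by simp
        also have "\<dots> \<le> \<alpha> * exp (- \<epsilon> * x)"
        proof -
          have "\<epsilon> * x \<le> 0" using True \<epsilon> by (simp add: mult_nonneg_nonpos)
          then show ?thesis using \<alpha>0 by (intro mult_left_mono) auto
        qed
        also have "\<dots> \<le> z x" using \<beta> by (simp add: z_def)
        finally have "m \<le> 1" using z[of x] by (simp add: m_def)
        with m1 show False by simp
      next
        case False
        then have x0: "x \<ge> 0" "x \<in> {0..T}" using x(1) by auto
        define E where "E = exp (- \<epsilon> * x)"
        have E: "E > 0" by (simp add: E_def)
        have lamE: "exp (- lam * x) \<le> E" unfolding E_def
            using mult_right_mono[OF less_imp_le[OF \<epsilon>(2)] x0(1)] by simp
        have t1: "norm (S x (\<xi> 0)) \<le> norm \<xi> * E"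
        proof -
          have "norm (S x (\<xi> 0)) \<le> norm (S x) * norm (\<xi> 0)" by (rule norm_blinfun)
          also have "\<dots> \<le> E * norm \<xi>"
            using S_norm[OF x0(1)] lamE norm_bounded[of \<xi> 0] E by (intro mult_mono) auto
          finally show ?thesis by (simp add: mult.commute)
        qed
        have t2: "norm (noise u \<omega> x) \<le> B * V * E"
        proof -
          have d: "noise u \<omega> x = noise u (\<lambda>r. \<omega> r - \<omega> x) x + S x (G (hist \<mu> u 0) (\<omega> x))"
            unfolding noise_const[OF u x0(1), symmetric] noise_diff[OF u \<omega>(1) continuous_on_const,
                symmetric] by simp
          have 1: "norm (noise u (\<lambda>r. \<omega> r - \<omega> x) x) \<le> C * (V * E) * (J \<kappa> + 1)"
          proof (rule noise_bound[OF u _ x0(1) \<kappa>])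
            fix s assume s: "0 \<le> s" "s \<le> x"
            have "norm (\<omega> (x - s) - \<omega> x) \<le> V * exp (- \<epsilon> * (x - s))" using osc x0 s by auto
            also have "exp (- \<epsilon> * (x - s)) = E * exp ((lam - \<kappa>) * s)"
              by (simp add: E_def \<kappa>_def mult_exp_exp algebra_simps)
            finally show "norm (\<omega> (x - s) - \<omega> x) \<le> V * E * exp ((lam - \<kappa>) * s)" by simp
          qed (use V E in \<open>auto intro!: continuous_on_diff \<omega>\<close>)
          have "norm (S x (G (hist \<mu> u 0) (\<omega> x))) \<le> norm (S x) * norm (G (hist \<mu> u 0) (\<omega> x))"
              by (rule norm_blinfun)
          also have "\<dots> \<le> norm (S x) * (norm (G (hist \<mu> u 0)) * norm (\<omega> x))"
            by (intro mult_left_mono norm_blinfun) auto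
          also have "\<dots> \<le> E * (C * V)"
          proof (intro mult_mono)
            show "norm (S x) \<le> E" using S_norm[OF x0(1)] lamE by simp
            show "norm (G (hist \<mu> u 0)) \<le> C" using G_bound[OF hist_in[OF u]] by simp
            show "norm (\<omega> x) \<le> V" using osc[rule_format, of x 0] x0 \<omega>(2) by simp
          qed (use E C V in auto)
          finally have 2: "norm (S x (G (hist \<mu> u 0) (\<omega> x))) \<le> E * (C * V)" .
          have "norm (noise u \<omega> x) \<le> C * (V * E) * (J \<kappa> + 1) + E * (C * V)"
            unfolding d by (rule order_trans[OF norm_triangle_ineq add_mono[OF 1 2]])
          also have "\<dots> = B * V * E" by (simp add: B_def algebra_simps)
          finally show ?thesis .
        qed
        define D where "D = C + cF * (m * (\<alpha> * exp (\<epsilon> * \<mu>) * E + \<beta>))"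
        have t3: "norm (conv S (\<lambda>r. F (hist \<mu> u r)) x) \<le> D / \<kappa>"
        proof (rule S_kernel[OF coeff_continuous(1)[OF u] x0(1) \<kappa>])
          show "D \<ge> 0" using C cF m0 \<alpha>0 E \<beta> by (simp add: D_def)
          fix s assume s: "0 < s" "s \<le> x"
          have es: "exp (\<epsilon> * s) \<ge> 1" using s \<epsilon> by simp
          have "norm (F (hist \<mu> u (x - s))) \<le> C + cF * norm (hist \<mu> u (x - s))"
            using s by (intro F_growth hist_in u) auto
          also have "\<dots> \<le> C + cF * (m * (\<alpha> * exp (\<epsilon> * \<mu>) * exp (- \<epsilon> * (x - s)) + \<beta>))"
            using s x0 cF by (intro add_left_mono mult_left_mono h_le) auto
          also have "exp (- \<epsilon> * (x - s)) = E * exp (\<epsilon> * s)"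
            by (simp add: E_def mult_exp_exp algebra_simps)
          also have "C + cF * (m * (\<alpha> * exp (\<epsilon> * \<mu>) * (E * exp (\<epsilon> * s)) + \<beta>))
             \<le> C * exp (\<epsilon> * s) + cF * (m * (\<alpha> * exp (\<epsilon> * \<mu>) * (E * exp (\<epsilon> * s)) + \<beta> * exp (\<epsilon> * s)))"
            using es C cF m0 \<beta> \<alpha>0 E mult_left_mono[OF es, of C] mult_left_mono[OF es, of \<beta>]
            by (intro add_mono mult_left_mono) auto
          also have "\<dots> = D * exp ((lam - \<kappa>) * s)" by (simp add: D_def \<kappa>_def algebra_simps)
          finally show "norm (F (hist \<mu> u (x - s))) \<le> D * exp ((lam - \<kappa>) * s)" .
        qed
        have "norm (u x) \<le> norm \<xi> * E + D / \<kappa> + B * V * E"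
          unfolding solvesD(3)[OF sol x0(1)] mild_map_def
          by (rule order_trans[OF norm_triangle_ineq add_mono[OF order_trans[OF norm_triangle_ineq
              add_mono[OF t1 t3]] t2]])
        also have "\<dots> = q * E + C / \<kappa> + m * (\<theta> * \<alpha> * E + cF / \<kappa> * \<beta>)"
          using \<kappa> by (simp add: q_def D_def \<theta>_def field_simps)
        also have "\<dots> \<le> q * E + C / \<kappa> + m * (\<theta> * \<alpha> * E + \<theta> * \<beta>)"
        proof -
          have "cF * 1 \<le> cF * exp (\<epsilon> * \<mu>)" using cF \<epsilon> mu by (intro mult_left_mono) auto
          then have "cF / \<kappa> \<le> \<theta>" unfolding \<theta>_def using \<kappa> by (intro divide_right_mono) auto
          then show ?thesis using \<beta> m0 by (intro add_left_mono mult_left_mono mult_right_mono) auto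
        qed
        also have "q * E + C / \<kappa> = (1 - \<theta>) * z x - 1"
        proof -
          have "q = (1 - \<theta>) * \<alpha>" "C / \<kappa> = (1 - \<theta>) * \<beta> - 1" using \<theta> by (simp_all add: \<alpha>_def \<beta>_def)
          then show ?thesis by (simp add: z_def E_def distrib_left)
        qed
        also have "(1 - \<theta>) * z x - 1 + m * (\<theta> * \<alpha> * E + \<theta> * \<beta>) = (1 - \<theta>) * z x * 1 - 1 + m * \<theta> * z x"
          by (simp add: z_def E_def algebra_simps)
        also have "\<dots> \<le> (1 - \<theta>) * z x * m - 1 + m * \<theta> * z x"
          using m1 \<theta> z[of x] by (intro add_right_mono diff_right_mono mult_left_mono) auto
        also have "\<dots> < m * z x" by (simp add: algebra_simps)
        also have "m * z x = norm (u x)" using z[of x] by (simp add: m_def)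
        finally show False by simp
      qed
    qed
    have "norm (hist \<mu> u t0) \<le> m * (\<alpha> * exp (\<epsilon> * \<mu>) * exp (- \<epsilon> * t0) + \<beta>)" by (rule h_le[OF t0])
    also have "\<dots> \<le> 1 * (\<alpha> * exp (\<epsilon> * \<mu>) * exp (- \<epsilon> * t0) + \<beta>)"
      using \<open>m \<le> 1\<close> \<alpha>0 \<beta> by (intro mult_right_mono) auto
    also have "\<dots> \<le> c * ((norm \<xi> + V) * exp (- \<epsilon> * t0)) + c"
    proof -
      have "q \<le> (1 + B) * (norm \<xi> + V)" using B V by (simp add: q_def algebra_simps)
      then have "\<alpha> * exp (\<epsilon> * \<mu>) \<le> (1 + B) * (norm \<xi> + V) / (1 - \<theta>) * exp (\<epsilon> * \<mu>)"
        unfolding \<alpha>_def using \<theta> by (intro mult_right_mono divide_right_mono) auto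
      also have "\<dots> = exp (\<epsilon> * \<mu>) * (1 + B) / (1 - \<theta>) * (norm \<xi> + V)" by simp
      also have "\<dots> \<le> c * (norm \<xi> + V)" using V by (intro mult_right_mono) (auto simp: c_def)
      finally have "\<alpha> * exp (\<epsilon> * \<mu>) * exp (- \<epsilon> * t0) \<le> c * (norm \<xi> + V) * exp (- \<epsilon> * t0)"
        by (intro mult_right_mono) auto
      moreover have "\<beta> \<le> c" by (simp add: c_def)
      ultimately have "\<alpha> * exp (\<epsilon> * \<mu>) * exp (- \<epsilon> * t0) + \<beta> \<le> c * (norm \<xi> + V) * exp (- \<epsilon> * t0) + c"
        by (rule add_mono)
      then show ?thesis by (simp only: mult.assoc mult_1)
    qed
    finally show "norm (hist \<mu> u t0) \<le> c * ((norm \<xi> + V) * exp (- \<epsilon> * t0) + 1)" by (simp add: distrib_left)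
  qed
  with \<epsilon>(1) c show ?thesis by blast
qed

section \<open>Compactness of the solution operator\<close>

lemma bounded_on_interval:
  assumes \<omega>: "noisy \<omega>" "\<omega> 0 = 0"
  shows "\<exists>M\<ge>0. \<forall>\<xi> u. \<xi> \<in> Cmu \<mu> \<longrightarrow> norm \<xi> \<le> R \<longrightarrow> solves \<omega> \<xi> u \<longrightarrow> (\<forall>t\<in>{0..T}. norm (hist \<mu> u t) \<le> M)"
proof -
  obtain \<epsilon> c where c: "\<epsilon> > 0" "c > 0" "a_priori_constants \<epsilon> c" using a_priori by blast
  obtain W where W: "W \<ge> 0" "\<And>r. r \<in> {0..T} \<Longrightarrow> norm (\<omega> r) \<le> W" using bounded_interval[OF \<omega>(1), of T] by blast
  define V where "V = 2 * W * exp (\<epsilon> * T)"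
  have V: "V \<ge> 0" using W by (simp add: V_def)
  have "norm (hist \<mu> u t) \<le> c * ((\<bar>R\<bar> + V) * 1 + 1)"
    if \<xi>: "\<xi> \<in> Cmu \<mu>" "norm \<xi> \<le> R" and sol: "solves \<omega> \<xi> u" and t: "t \<in> {0..T}" for \<xi> u t
  proof -
    have "norm (hist \<mu> u t) \<le> c * ((norm \<xi> + V) * exp (- \<epsilon> * t) + 1)"
    proof (rule a_prioriD[OF c(3) \<omega> \<xi>(1) sol V _ t])
      fix t r assume tr: "t \<in> {0..T}" "r \<in> {0..t}"
      have "norm (\<omega> r - \<omega> t) \<le> norm (\<omega> r) + norm (\<omega> t)" by (rule norm_triangle_ineq4)
      also have "\<dots> \<le> 2 * W * 1" using W(2)[of r] W(2)[of t] tr by auto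
      also have "\<dots> \<le> 2 * W * exp (\<epsilon> * T - \<epsilon> * r)"
        using W(1) tr c(1) by (intro mult_left_mono) (auto intro: mult_left_mono)
      also have "\<dots> = V * exp (- \<epsilon> * r)" by (simp add: V_def mult_exp_exp)
      finally show "norm (\<omega> r - \<omega> t) \<le> V * exp (- \<epsilon> * r)" .
    qed
    also have "\<dots> \<le> c * ((\<bar>R\<bar> + V) * 1 + 1)"
      using c \<xi>(2) V t by (intro mult_left_mono add_right_mono mult_mono) auto
    finally show ?thesis .
  qed
  then show ?thesis using c(2) V by (intro exI[of _ "c * ((\<bar>R\<bar> + V) * 1 + 1)"]) auto
qed

text \<open>Restarted at time \<open>t\<close>, the equation contains only the increments of \<open>\<omega>\<close> after \<open>t\<close>, which are small
  by uniform continuity, and a drift integral over an interval of length \<open>h\<close>.\<close>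

lemma short_time:
  assumes \<omega>: "noisy \<omega>" "\<omega> 0 = 0" and \<eta>: "\<eta> > 0"
  shows "\<exists>h0>0. \<forall>h\<in>{0<..h0}. \<forall>\<xi> u. \<forall>t\<ge>0. \<xi> \<in> Cmu \<mu> \<longrightarrow> norm \<xi> \<le> R \<longrightarrow> solves \<omega> \<xi> u \<longrightarrow> t + h \<le> T \<longrightarrow>
      norm (u (t + h) - S h (u t)) \<le> \<eta>"
proof -
  obtain M where M: "M \<ge> 0" "\<forall>\<xi> u. \<xi> \<in> Cmu \<mu> \<longrightarrow> norm \<xi> \<le> R \<longrightarrow> solves \<omega> \<xi> u \<longrightarrow> (\<forall>t\<in>{0..T}. norm (hist \<mu> u t) \<le> M)"
    using bounded_on_interval[OF \<omega>] by blast
  define b where "b = (C + cF * M) * exp 1"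
  have b: "b \<ge> 0" using C cF M by (simp add: b_def)
  define k where "k = C * (J lam + 1) + 1"
  have "C * (J lam + 1) \<ge> 0" using C J_pos[OF lam] by simp
  then have k: "k > 0" by (simp add: k_def)
  define \<sigma> where "\<sigma> = \<eta> / 2 / k"
  have \<sigma>: "\<sigma> > 0" using \<eta> k by (simp add: \<sigma>_def)
  have "uniformly_continuous_on {0..T} \<omega>"
    by (intro compact_uniformly_continuous continuous_on_subset[OF \<omega>(1)]) auto
  then obtain d where d: "d > 0" "\<And>x y. x \<in> {0..T} \<Longrightarrow> y \<in> {0..T} \<Longrightarrow> dist y x < d \<Longrightarrow> dist (\<omega> y) (\<omega> x) < \<sigma>"
    unfolding uniformly_continuous_on_def using \<sigma> by metis
  define h0 where "h0 = min (d / 2) (\<eta> / 2 / (b + 1))"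
  have h0: "h0 > 0" using d(1) \<eta> b by (simp add: h0_def)
  have "norm (u (t + h) - S h (u t)) \<le> \<eta>"
    if h: "h \<in> {0<..h0}" and t: "t \<ge> 0" "t + h \<le> T" and \<xi>: "\<xi> \<in> Cmu \<mu>" "norm \<xi> \<le> R" and sol: "solves \<omega> \<xi> u"
        for h \<xi> u t
  proof -
    note u = solvesD(1)[OF sol]
    define v where "v = (\<lambda>s. u (s + t))"
    have solv: "solves (wiener_shift t \<omega>) (hist \<mu> u t) v"
      unfolding v_def by (rule solves_shift[OF sol \<omega>(1) t(1)])
    note pv = solvesD(1)[OF solv]
    have h': "h > 0" "h \<le> h0" using h by auto
    have shift: "noisy (wiener_shift t \<omega>)" unfolding wiener_shift_def
      by (intro continuous_on_diff continuous_on_const continuous_on_compose2[OF \<omega>(1)]) (use t in \<open>auto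
          intro!: continuous_intros\<close>)
    have init: "hist \<mu> u t 0 = u t"
      using hist_apply[OF path_cont[OF u t(1)]] mu by simp
    \<comment> \<open>The weight \<open>exp (- s / h)\<close> is at least \<open>exp (- 1)\<close> on \<open>[0,h]\<close> and has integral at most \<open>h\<close>.\<close>
    have 1: "norm (conv S (\<lambda>r. F (hist \<mu> v r)) h) \<le> b / (1 / h + lam)"
    proof (rule S_kernel[OF coeff_continuous(1)[OF pv] less_imp_le[OF h'(1)] _ b])
      show "0 < 1 / h + lam" using h' lam by (simp add: add_pos_pos)
      fix s assume s: "0 < s" "s \<le> h"
      have "norm (F (hist \<mu> v (h - s))) \<le> C + cF * norm (hist \<mu> v (h - s))"
        using s by (intro F_growth hist_in pv) auto
      also have "\<dots> \<le> C + cF * M"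
        using M(2)[rule_format, OF \<xi> sol, of "h - s + t"] s t cF
        unfolding v_def hist_shift by (intro add_left_mono mult_left_mono) auto
      also have "\<dots> = b * exp (- 1)" by (simp add: b_def mult_exp_exp)
      also have "\<dots> \<le> b * exp ((lam - (1 / h + lam)) * s)"
        using s b h' by (intro mult_left_mono) (auto simp: field_simps)
      finally show "norm (F (hist \<mu> v (h - s))) \<le> b * exp ((lam - (1 / h + lam)) * s)" .
    qed
    also have "b / (1 / h + lam) \<le> b / (1 / h)" using b h' lam
        by (intro divide_left_mono) (auto simp: add_pos_pos)
    also have "\<dots> = b * h" by simp
    also have "\<dots> \<le> b * (\<eta> / 2 / (b + 1))" using h' by (intro mult_left_mono b) (simp add: h0_def)
    also have "\<dots> \<le> \<eta> / 2" using b \<eta> by (simp add: field_simps)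
    finally have F: "norm (conv S (\<lambda>r. F (hist \<mu> v r)) h) \<le> \<eta> / 2" .
    have "norm (noise v (wiener_shift t \<omega>) h) \<le> C * \<sigma> * (J lam + 1)"
    proof (rule noise_bound[OF pv shift less_imp_le[OF h'(1)] lam less_imp_le[OF \<sigma>]])
      fix s assume s: "0 \<le> s" "s \<le> h"
      have "dist (\<omega> (h - s + t)) (\<omega> t) < \<sigma>"
        using s t h' d(1) by (intro d(2)) (auto simp: dist_real_def h0_def)
      then show "norm (wiener_shift t \<omega> (h - s)) \<le> \<sigma> * exp ((lam - lam) * s)"
        by (simp add: wiener_shift_def dist_norm)
    qed
    also have "\<dots> \<le> \<eta> / 2"
    proof -
      have "\<sigma> * (C * (J lam + 1)) \<le> \<sigma> * k" using \<sigma> by (intro mult_left_mono) (auto simp: k_def)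
      also have "\<dots> = \<eta> / 2" using k by (simp add: \<sigma>_def)
      finally show ?thesis by (simp add: ac_simps)
    qed
    finally have N: "norm (noise v (wiener_shift t \<omega>) h) \<le> \<eta> / 2" .
    have "u (t + h) - S h (u t) = conv S (\<lambda>r. F (hist \<mu> v r)) h + noise v (wiener_shift t \<omega>) h"
      using solvesD(3)[OF solv less_imp_le[OF h'(1)]] init by (simp add: mild_map_def v_def add.commute)
    then show ?thesis using norm_triangle_le[OF add_mono[OF F N]] by simp
  qed
  with h0 show ?thesis by blast
qed

text \<open>By \<open>short_time\<close> the values \<open>u(t)\<close> are uniformly close to the precompact set \<open>S(h) (cball 0 M)\<close>, hence
  they form a totally bounded set themselves; on such a set \<open>S(h)\<close> is uniformly close to the identity for
  small \<open>h\<close>, which gives equicontinuity.\<close>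

theorem flow_compact:
  assumes \<omega>: "noisy \<omega>" "\<omega> 0 = 0" and T: "T > \<mu>"
  shows "compact (closure {hist \<mu> u T | u \<xi>. \<xi> \<in> Cmu \<mu> \<and> norm \<xi> \<le> R \<and> solves \<omega> \<xi> u})" (is
      "compact (closure ?F)")
proof -
  have T0: "T > 0" using T mu by simp
  obtain M where M: "M \<ge> 0" "\<forall>\<xi> u. \<xi> \<in> Cmu \<mu> \<longrightarrow> norm \<xi> \<le> R \<longrightarrow> solves \<omega> \<xi> u \<longrightarrow> (\<forall>t\<in>{0..T}. norm (hist \<mu> u t) \<le> M)"
    using bounded_on_interval[OF \<omega>] by blast
  define sols where "sols = {u. \<exists>\<xi>. \<xi> \<in> Cmu \<mu> \<and> norm \<xi> \<le> R \<and> solves \<omega> \<xi> u}"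
  have path: "path u" if "u \<in> sols" for u using that solvesD(1) by (auto simp: sols_def)
  have uM: "norm (u t) \<le> M" if "u \<in> sols" "t \<in> {0..T}" for u t
  proof -
    have "norm (u t) \<le> norm (hist \<mu> u t)"
      using that mu by (intro norm_le_hist path_cont path) auto
    moreover have "norm (hist \<mu> u t) \<le> M" using M(2) that unfolding sols_def by blast
    ultimately show ?thesis by simp
  qed
  have step: "\<exists>h0>0. \<forall>h\<in>{0<..h0}. \<forall>u\<in>sols. \<forall>t\<ge>0. t + h \<le> T \<longrightarrow> norm (u (t + h) - S h (u t)) \<le> \<eta>" if "\<eta> > 0" for \<eta>
    using short_time[OF \<omega> that, of R T] unfolding sols_def by blast
  have net: "\<exists>N. finite N \<and> (\<forall>u\<in>sols. \<forall>t\<in>{T - \<mu>..T}. \<exists>n\<in>N. dist (u t) n < e)" if e: "e > 0" for e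
  proof -
    have "e / 2 > 0" using e by simp
    from step[OF this] obtain h0 where h0: "h0 > 0"
      "\<And>h u t. h \<in> {0<..h0} \<Longrightarrow> u \<in> sols \<Longrightarrow> t \<ge> 0 \<Longrightarrow> t + h \<le> T \<Longrightarrow> norm (u (t + h) - S h (u t)) \<le> e / 2" by blast
    define h where "h = min h0 (T - \<mu>)"
    have h: "h \<in> {0<..h0}" "h > 0" "h \<le> T - \<mu>" using h0(1) T by (auto simp: h_def)
    have "compact (closure (S h ` cball 0 M))"
      using S_compact[OF h(2)] bounded_cball unfolding compact_operator_def by blast
    from compact_closure_imp_finite_net[OF this \<open>e / 2 > 0\<close>]
    obtain N where N: "finite N" "\<And>x. x \<in> S h ` cball 0 M \<Longrightarrow> \<exists>n\<in>N. dist n x < e / 2" by metis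
    have "\<exists>n\<in>N. dist (u t) n < e" if u: "u \<in> sols" and t: "t \<in> {T - \<mu>..T}" for u t
    proof -
      have "norm (u (t - h)) \<le> M" using u t h mu by (intro uM) auto
      then have "S h (u (t - h)) \<in> S h ` cball 0 M" by simp
      from N(2)[OF this] obtain n where n: "n \<in> N" "dist n (S h (u (t - h))) < e / 2" by blast
      have "dist (u t) (S h (u (t - h))) \<le> e / 2"
        using h0(2)[OF h(1) u, of "t - h"] t h by (simp add: dist_norm)
      then have "dist (u t) n < e" using n(2) dist_triangle[of "u t" n "S h (u (t - h))"]
          by (simp add: dist_commute)
      then show ?thesis using n(1) by blast
    qed
    with N(1) show ?thesis by blast
  qed
  have equi: "\<exists>\<delta>>0. \<forall>u\<in>sols. \<forall>t\<in>{T - \<mu>..T}. \<forall>h>0. h < \<delta> \<longrightarrow> t + h \<le> T \<longrightarrow> dist (u (t + h)) (u t) < e" if e: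
      "e > 0" for e
  proof -
    have e5: "e / 5 > 0" using e by simp
    from step[OF e5] obtain h0 where h0: "h0 > 0"
      "\<And>h u t. h \<in> {0<..h0} \<Longrightarrow> u \<in> sols \<Longrightarrow> t \<ge> 0 \<Longrightarrow> t + h \<le> T \<Longrightarrow> norm (u (t + h) - S h (u t)) \<le> e / 5" by blast
    from net[OF e5] obtain N where N: "finite N" "\<And>u t. u \<in> sols \<Longrightarrow> t \<in> {T - \<mu>..T}
        \<Longrightarrow> \<exists>n\<in>N. dist (u t) n < e / 5" by blast
    have "\<forall>n\<in>N. eventually (\<lambda>h. dist (S h n) n < e / 5) (at_right 0)"
    proof
      fix n assume "n \<in> N"
      have "((\<lambda>h. S h n) \<longlongrightarrow> n) (at_right 0)" using C0 unfolding C0_semigroup_def by blast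
      from tendstoD[OF this e5] show "eventually (\<lambda>h. dist (S h n) n < e / 5) (at_right 0)" .
    qed
    then have "eventually (\<lambda>h. \<forall>n\<in>N. dist (S h n) n < e / 5) (at_right 0)"
      using N(1) by (simp add: eventually_ball_finite)
    then obtain d where d: "d > 0" "\<And>h. 0 < h \<Longrightarrow> h < d \<Longrightarrow> \<forall>n\<in>N. dist (S h n) n < e / 5"
      unfolding eventually_at_right_field by auto
    have "dist (u (t + h)) (u t) < e"
      if u: "u \<in> sols" and t: "t \<in> {T - \<mu>..T}" and h: "h > 0" "h < min h0 d" "t + h \<le> T" for u t h
    proof -
      obtain n where n: "n \<in> N" "dist (u t) n < e / 5" using N(2)[OF u t] by blast
      have 1: "dist (u (t + h)) (S h (u t)) \<le> e / 5"
        using h0(2)[of h u t] u t h T by (simp add: dist_norm)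
      have "norm (S h (u t - n)) \<le> norm (S h) * norm (u t - n)" by (rule norm_blinfun)
      also have "\<dots> \<le> 1 * norm (u t - n)"
        using h lam by (intro mult_right_mono order_trans[OF S_norm]) auto
      finally have 2: "dist (S h (u t)) (S h n) \<le> dist (u t) n" by (simp add: dist_norm blinfun.diff_right)
      have 3: "dist (S h n) n < e / 5" using d(2)[of h] h n(1) by auto
      have "dist (u (t + h)) (u t) \<le> dist (u (t + h)) (S h (u t)) + dist (S h (u t)) (S h n)
          + dist (S h n) n + dist (u t) n"
        by metric
      then show ?thesis using 1 2 3 n(2) e by linarith
    qed
    then show ?thesis using h0(1) d(1) by (intro exI[of _ "min h0 d"]) auto
  qed
  have F: "?F = (\<lambda>u. hist \<mu> u T) ` sols" by (auto simp: sols_def)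
  have app: "hist \<mu> u T s = u (T + s)" if "u \<in> sols" "s \<in> {- \<mu>..0}" for u s
    using hist_apply[OF path_cont[OF path[OF that(1)] less_imp_le[OF T0]], of s] that(2) mu by simp
  show ?thesis
    unfolding F
  proof (rule Cmu_compact_closure[OF _ mu])
    show "(\<lambda>u. hist \<mu> u T) ` sols \<subseteq> Cmu \<mu>" using hist_in path T0 by auto
    fix e :: real assume e: "e > 0"
    obtain N where N: "finite N" "\<And>u t. u \<in> sols \<Longrightarrow> t \<in> {T - \<mu>..T} \<Longrightarrow> \<exists>n\<in>N. dist (u t) n < e"
      using net[OF e] by blast
    have "\<exists>n\<in>N. dist (hist \<mu> u T s) n < e" if "u \<in> sols" "s \<in> {- \<mu>..0}" for u s
      using N(2)[OF that(1), of "T + s"] app[OF that] that(2) by auto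
    then show "\<exists>N. finite N \<and> (\<forall>x\<in>(\<lambda>u. hist \<mu> u T) ` sols. \<forall>s\<in>{- \<mu>..0}. \<exists>n\<in>N. dist (apply_bcontfun x s) n < e)"
      using N(1) by blast
    obtain \<delta> where \<delta>: "\<delta> > 0" "\<And>u t h. u \<in> sols \<Longrightarrow> t \<in> {T - \<mu>..T} \<Longrightarrow> h > 0 \<Longrightarrow> h < \<delta> \<Longrightarrow> t + h \<le> T \<Longrightarrow> dist (u (t
        + h)) (u t) < e"
      using equi[OF e] by blast
    have lt: "dist (hist \<mu> u T s) (hist \<mu> u T r) < e"
      if u: "u \<in> sols" and s: "s \<in> {- \<mu>..0}" "r \<in> {- \<mu>..0}" and sr: "r < s" "s - r < \<delta>" for u s r
      using \<delta>(2)[OF u, of "T + r" "s - r"] s sr by (simp add: app[OF u s(1)] app[OF u s(2)])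
    have "dist (hist \<mu> u T s) (hist \<mu> u T r) < e"
      if u: "u \<in> sols" and s: "s \<in> {- \<mu>..0}" "r \<in> {- \<mu>..0}" and sr: "\<bar>s - r\<bar> < \<delta>" for u s r
      using lt[OF u s] lt[OF u s(2) s(1)] sr e by (cases r s rule: linorder_cases) (auto simp: dist_commute)
    then show "\<exists>\<delta>>0. \<forall>x\<in>(\<lambda>u. hist \<mu> u T) ` sols. \<forall>s\<in>{- \<mu>..0}. \<forall>t\<in>{- \<mu>..0}. \<bar>s - t\<bar> < \<delta> \<longrightarrow>
        dist (apply_bcontfun x s) (apply_bcontfun x t) < e"
      using \<delta>(1) by blast
  qed
qed

end

section \<open>Pullback attractors\<close>

text \<open>Absorption takes place into the closed sets \<open>B0\<close> inside \<open>B\<close>. The room between the two allows \<open>B\<close> to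
  consist of open balls, for which measurability is easy, while the attractor still lies in \<open>B\<close>.\<close>

locale absorbing_cocycle =
  fixes \<theta> :: "real \<Rightarrow> 'w \<Rightarrow> 'w" and \<Omega> :: "'w set" and \<phi> :: "real \<Rightarrow> 'w \<Rightarrow> 'x::metric_space \<Rightarrow> 'x"
    and X :: "'x set" and B B0 :: "'w \<Rightarrow> 'x set" and T1 :: real
  assumes shift_in: "\<And>w t. w \<in> \<Omega> \<Longrightarrow> \<theta> t w \<in> \<Omega>"
    and shift_0: "\<And>w. w \<in> \<Omega> \<Longrightarrow> \<theta> 0 w = w"
    and shift_add: "\<And>w s t. w \<in> \<Omega> \<Longrightarrow> \<theta> s (\<theta> t w) = \<theta> (s + t) w"
    and flow_in: "\<And>t w x. t \<ge> 0 \<Longrightarrow> w \<in> \<Omega> \<Longrightarrow> x \<in> X \<Longrightarrow> \<phi> t w x \<in> X"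
    and cocycle: "\<And>s t w x. s \<ge> 0 \<Longrightarrow> t \<ge> 0 \<Longrightarrow> w \<in> \<Omega> \<Longrightarrow> x \<in> X \<Longrightarrow> \<phi> (t + s) w x = \<phi> t (\<theta> s w) (\<phi> s w x)"
    and flow_continuous: "\<And>t w. t \<ge> 0 \<Longrightarrow> w \<in> \<Omega> \<Longrightarrow> continuous_on X (\<phi> t w)"
    and X_closed: "closed X"
    and B: "\<And>w. w \<in> \<Omega> \<Longrightarrow> B w \<noteq> {}" "\<And>w. w \<in> \<Omega> \<Longrightarrow> B w \<subseteq> X"
    and B0: "\<And>w. w \<in> \<Omega> \<Longrightarrow> closed (B0 w)" "\<And>w. w \<in> \<Omega> \<Longrightarrow> B0 w \<subseteq> B w"
    and T1: "T1 \<ge> 0"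
    and flow_compact: "\<And>w. w \<in> \<Omega> \<Longrightarrow> compact (closure (\<phi> T1 w ` B w))"
    and B_absorbed: "\<And>w. w \<in> \<Omega> \<Longrightarrow> \<exists>T. \<forall>t\<ge>T. t \<ge> 0 \<longrightarrow> \<phi> t (\<theta> (- t) w) ` B (\<theta> (- t) w) \<subseteq> B0 w"
begin

definition absorbed :: "('w \<Rightarrow> 'x set) \<Rightarrow> bool" where
  "absorbed D \<longleftrightarrow> (\<forall>w\<in>\<Omega>. D w \<subseteq> X \<and> (\<exists>T. \<forall>t\<ge>T. t \<ge> 0 \<longrightarrow> \<phi> t (\<theta> (- t) w) ` D (\<theta> (- t) w) \<subseteq> B0 w))"

lemma absorbed_B: "absorbed B"
  unfolding absorbed_def using B_absorbed B(2) by blast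

text \<open>The pullback limit set of \<open>B\<close>.\<close>

definition attractor :: "'w \<Rightarrow> 'x set" where
  "attractor w = {z. \<forall>s. \<forall>e>0. \<exists>t\<ge>s. t \<ge> 0 \<and> (\<exists>b\<in>B (\<theta> (- t) w). dist (\<phi> t (\<theta> (- t) w) b) z < e)}"

lemma attractorI:
  assumes "\<And>s e. e > 0 \<Longrightarrow> \<exists>t\<ge>s. t \<ge> 0 \<and> (\<exists>b\<in>B (\<theta> (- t) w). dist (\<phi> t (\<theta> (- t) w) b) z < e)"
  shows "z \<in> attractor w"
  using assms unfolding attractor_def by blast

lemma attractorD:
  assumes "z \<in> attractor w" "e > 0"
  shows "\<exists>t b. t \<ge> s \<and> t \<ge> 0 \<and> b \<in> B (\<theta> (- t) w) \<and> dist (\<phi> t (\<theta> (- t) w) b) z < e"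
  using assms unfolding attractor_def by blast

text \<open>The time axis is split at \<open>k\<close>: started from time \<open>-t\<close>, an absorbed orbit is in \<open>B\<close> at time
  \<open>-k\<close>, whatever the starting point, and moves on under the fixed map \<open>\<phi> k\<close>.\<close>

lemma cocycle_split:
  assumes w: "w \<in> \<Omega>" and k: "k \<ge> 0" and D: "absorbed D"
  shows "\<exists>T. \<forall>t\<ge>T. t \<ge> k \<longrightarrow> (\<forall>x\<in>D (\<theta> (- t) w). \<phi> (t - k) (\<theta> (- t) w) x \<in> B0 (\<theta> (- k) w) \<and>
    \<phi> t (\<theta> (- t) w) x = \<phi> k (\<theta> (- k) w) (\<phi> (t - k) (\<theta> (- t) w) x))"
proof -
  have w': "\<theta> (- k) w \<in> \<Omega>" using shift_in[OF w] .
  obtain T where T: "\<forall>t\<ge>T. t \<ge> 0 \<longrightarrow> \<phi> t (\<theta> (- t) (\<theta> (- k) w)) ` D (\<theta> (- t) (\<theta> (- k) w)) \<subseteq> B0 (\<theta> (- k) w)"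
    using D w' unfolding absorbed_def by blast
  show ?thesis
  proof (intro exI[of _ "T + k"] allI impI ballI)
    fix t x assume t: "t \<ge> T + k" "t \<ge> k" and x: "x \<in> D (\<theta> (- t) w)"
    have eq: "\<theta> (- (t - k)) (\<theta> (- k) w) = \<theta> (- t) w" using shift_add[OF w] by simp
    have xX: "x \<in> X" using D shift_in[OF w] x unfolding absorbed_def by blast
    have "\<phi> (t - k) (\<theta> (- t) w) x \<in> B0 (\<theta> (- k) w)"
      using T[rule_format, of "t - k"] t x unfolding eq by auto
    moreover have "\<phi> t (\<theta> (- t) w) x = \<phi> k (\<theta> (- k) w) (\<phi> (t - k) (\<theta> (- t) w) x)"
      using cocycle[of "t - k" k "\<theta> (- t) w" x] k t shift_in[OF w] xX shift_add[OF w, of "t - k" "- t"] by simp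
    ultimately show "\<phi> (t - k) (\<theta> (- t) w) x \<in> B0 (\<theta> (- k) w) \<and>
      \<phi> t (\<theta> (- t) w) x = \<phi> k (\<theta> (- k) w) (\<phi> (t - k) (\<theta> (- t) w) x)" by blast
  qed
qed

text \<open>By \<open>cocycle_split\<close> with \<open>k = T1\<close> the sequence is eventually in a compact set; with arbitrary \<open>k\<close> its
  limit points are limits of images of \<open>B\<close>, even if it starts in another absorbed family \<open>D\<close>.\<close>

lemma asymptotic_compactness:
  assumes w: "w \<in> \<Omega>" and D: "absorbed D" and t: "filterlim t at_top sequentially"
    and x: "\<And>n. x n \<in> D (\<theta> (- t n) w)"
  obtains z r where "z \<in> attractor w" "strict_mono (r :: nat \<Rightarrow> nat)"
    "(\<lambda>n. \<phi> (t (r n)) (\<theta> (- t (r n)) w) (x (r n))) \<longlonglongrightarrow> z"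
proof -
  define y where "y n = \<phi> (t n) (\<theta> (- t n) w) (x n)" for n
  have split: "eventually (\<lambda>n. y n \<in> \<phi> k (\<theta> (- k) w) ` B (\<theta> (- k) w)) sequentially" if k: "k \<ge> 0" for k
  proof -
    obtain T where T: "\<forall>t\<ge>T. t \<ge> k \<longrightarrow> (\<forall>x\<in>D (\<theta> (- t) w). \<phi> (t - k) (\<theta> (- t) w) x \<in> B0 (\<theta> (- k) w) \<and>
        \<phi> t (\<theta> (- t) w) x = \<phi> k (\<theta> (- k) w) (\<phi> (t - k) (\<theta> (- t) w) x))"
      using cocycle_split[OF w k D] by blast
    have "eventually (\<lambda>n. t n \<ge> max T k) sequentially" using t unfolding filterlim_at_top by blast
    then show ?thesis
    proof eventually_elim
      case (elim n)
      with T x[of n] have "\<phi> (t n - k) (\<theta> (- t n) w) (x n) \<in> B0 (\<theta> (- k) w)"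
        "y n = \<phi> k (\<theta> (- k) w) (\<phi> (t n - k) (\<theta> (- t n) w) (x n))" unfolding y_def by auto
      then show ?case using B0(2)[OF shift_in[OF w], of "- k"] by blast
    qed
  qed
  have "compact (closure (\<phi> T1 (\<theta> (- T1) w) ` B (\<theta> (- T1) w)))"
    by (rule flow_compact[OF shift_in[OF w]])
  moreover obtain N where N: "\<And>n. n \<ge> N \<Longrightarrow> y n \<in> \<phi> T1 (\<theta> (- T1) w) ` B (\<theta> (- T1) w)"
    using split[OF T1] unfolding eventually_sequentially by blast
  have "\<forall>n. y (n + N) \<in> closure (\<phi> T1 (\<theta> (- T1) w) ` B (\<theta> (- T1) w))"
    using N closure_subset by (meson le_add2 subsetD)
  ultimately obtain z q where q: "strict_mono (q :: nat \<Rightarrow> nat)" "((\<lambda>n. y (n + N)) \<circ> q) \<longlonglongrightarrow> z"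
    using seq_compactE[of "closure (\<phi> T1 (\<theta> (- T1) w) ` B (\<theta> (- T1) w))" "\<lambda>n. y (n + N)"]
    unfolding compact_eq_seq_compact_metric by blast
  define r where "r n = q n + N" for n
  have r: "strict_mono r" using q(1) by (simp add: r_def strict_mono_def)
  have lim: "(\<lambda>n. y (r n)) \<longlonglongrightarrow> z" using q(2) by (simp add: r_def o_def)
  have "z \<in> attractor w"
  proof (rule attractorI)
    fix s e :: real assume e: "e > 0"
    define k where "k = max s 0"
    have k: "k \<ge> 0" "k \<ge> s" by (auto simp: k_def)
    have "eventually (\<lambda>n. y (r n) \<in> \<phi> k (\<theta> (- k) w) ` B (\<theta> (- k) w)) sequentially"
      using split[OF k(1)] filterlim_subseq[OF r] by (rule eventually_compose_filterlim)
    moreover have "eventually (\<lambda>n. dist (y (r n)) z < e) sequentially" by (rule tendstoD[OF lim e])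
    ultimately have "eventually (\<lambda>n. y (r n) \<in> \<phi> k (\<theta> (- k) w) ` B (\<theta> (- k) w)
        \<and> dist (y (r n)) z < e) sequentially"
      by (rule eventually_conj)
    then obtain n where "y (r n) \<in> \<phi> k (\<theta> (- k) w) ` B (\<theta> (- k) w)" "dist (y (r n)) z < e"
      using eventually_happens'[OF sequentially_bot] by blast
    then show "\<exists>t\<ge>s. t \<ge> 0 \<and> (\<exists>b\<in>B (\<theta> (- t) w). dist (\<phi> t (\<theta> (- t) w) b) z < e)"
      using k by (intro exI[of _ k]) auto
  qed
  then show thesis using that r lim unfolding y_def by blast
qed

lemma attractor_nonempty: assumes "w \<in> \<Omega>" shows "attractor w \<noteq> {}"
proof -
  have "\<exists>x. x \<in> B (\<theta> (- real n) w)" for n using B(1)[OF shift_in[OF assms]] by blast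
  then obtain x where "\<And>n. x n \<in> B (\<theta> (- real n) w)" by metis
  then show ?thesis
    using asymptotic_compactness[OF assms absorbed_B filterlim_real_sequentially] by blast
qed

lemma attractor_subset: assumes w: "w \<in> \<Omega>" shows "attractor w \<subseteq> B0 w"
proof
  fix z assume z: "z \<in> attractor w"
  obtain T where T: "\<forall>t\<ge>T. t \<ge> 0 \<longrightarrow> \<phi> t (\<theta> (- t) w) ` B (\<theta> (- t) w) \<subseteq> B0 w" using B_absorbed[OF w] by blast
  have "\<exists>y\<in>B0 w. dist y z < e" if e: "e > 0" for e
  proof -
    obtain t b where "t \<ge> T" "t \<ge> 0" "b \<in> B (\<theta> (- t) w)" "dist (\<phi> t (\<theta> (- t) w) b) z < e"
      using attractorD[OF z e] by blast
    then show ?thesis using T by blast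
  qed
  then have "z \<in> closure (B0 w)" unfolding closure_approachable by blast
  then show "z \<in> B0 w" using B0(1)[OF w] by simp
qed

lemma attractor_closed: "closed (attractor w)"
proof -
  have "z \<in> attractor w" if z: "z \<in> closure (attractor w)" for z
  proof (rule attractorI)
    fix s e :: real assume e: "e > 0"
    then obtain y where y: "y \<in> attractor w" "dist y z < e / 2"
      using z unfolding closure_approachable by (meson half_gt_zero)
    obtain t b where t: "t \<ge> s" "t \<ge> 0" "b \<in> B (\<theta> (- t) w)" "dist (\<phi> t (\<theta> (- t) w) b) y < e / 2"
      using attractorD[OF y(1) half_gt_zero[OF e]] by blast
    have "dist (\<phi> t (\<theta> (- t) w) b) z < e"
        by (rule dist_triangle_half_l[OF t(4)]) (use y(2) in \<open>simp add: dist_commute\<close>)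
    then show "\<exists>t\<ge>s. t \<ge> 0 \<and> (\<exists>b\<in>B (\<theta> (- t) w). dist (\<phi> t (\<theta> (- t) w) b) z < e)" using t by blast
  qed
  then show ?thesis using closure_subset_eq by blast
qed

lemma attractor_compact: assumes w: "w \<in> \<Omega>" shows "compact (attractor w)"
proof -
  let ?K = "closure (\<phi> T1 (\<theta> (- T1) w) ` B (\<theta> (- T1) w))"
  obtain T where T: "\<forall>t\<ge>T. t \<ge> T1 \<longrightarrow> (\<forall>x\<in>B (\<theta> (- t) w). \<phi> (t - T1) (\<theta> (- t) w) x \<in> B0 (\<theta> (- T1) w) \<and>
      \<phi> t (\<theta> (- t) w) x = \<phi> T1 (\<theta> (- T1) w) (\<phi> (t - T1) (\<theta> (- t) w) x))"
    using cocycle_split[OF w T1 absorbed_B] by blast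
  have "attractor w \<subseteq> ?K"
  proof
    fix z assume z: "z \<in> attractor w"
    show "z \<in> ?K"
      unfolding closure_approachable
    proof (intro allI impI)
      fix e :: real assume "e > 0"
      from attractorD[OF z this, of "max T T1"] obtain t b where "t \<ge> max T T1"
        and t: "b \<in> B (\<theta> (- t) w)" "dist (\<phi> t (\<theta> (- t) w) b) z < e" by blast
      with T have "\<phi> (t - T1) (\<theta> (- t) w) b \<in> B0 (\<theta> (- T1) w)"
        "\<phi> t (\<theta> (- t) w) b = \<phi> T1 (\<theta> (- T1) w) (\<phi> (t - T1) (\<theta> (- t) w) b)" by auto
      then show "\<exists>y\<in>\<phi> T1 (\<theta> (- T1) w) ` B (\<theta> (- T1) w). dist y z < e"
        using t(2) B0(2)[OF shift_in[OF w], of "- T1"] by auto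
    qed
  qed
  then have "attractor w = ?K \<inter> attractor w" by blast
  then show ?thesis
    using compact_Int_closed[OF flow_compact[OF shift_in[OF w]] attractor_closed] by metis
qed

lemma attractor_in_X: "w \<in> \<Omega> \<Longrightarrow> attractor w \<subseteq> X"
  using attractor_subset B0(2) B(2) by blast

text \<open>For the inclusion from right to left the approximating orbits are stopped at time \<open>t\<close> before the end,
  where they have a limit point in the attractor.\<close>

theorem attractor_invariant:
  assumes w: "w \<in> \<Omega>" and t: "t \<ge> 0"
  shows "\<phi> t w ` attractor w = attractor (\<theta> t w)"
proof
  show "\<phi> t w ` attractor w \<subseteq> attractor (\<theta> t w)"
  proof
    fix y assume "y \<in> \<phi> t w ` attractor w"
    then obtain z where z: "z \<in> attractor w" "y = \<phi> t w z" by blast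
    have zX: "z \<in> X" using attractor_in_X[OF w] z(1) by blast
    show "y \<in> attractor (\<theta> t w)"
    proof (rule attractorI)
      fix s e :: real assume "e > 0"
      then obtain d where d: "d > 0" "\<And>x. x \<in> X \<Longrightarrow> dist x z < d \<Longrightarrow> dist (\<phi> t w x) y < e"
        using flow_continuous[OF t w] zX unfolding continuous_on_iff z(2) by meson
      obtain r b where r: "r \<ge> s" "r \<ge> 0" "b \<in> B (\<theta> (- r) w)" "dist (\<phi> r (\<theta> (- r) w) b) z < d"
        using attractorD[OF z(1) d(1)] by blast
      have bX: "b \<in> X" using B(2)[OF shift_in[OF w]] r(3) by blast
      have eq: "\<theta> (- (t + r)) (\<theta> t w) = \<theta> (- r) w" using shift_add[OF w] by simp
      have "\<phi> (t + r) (\<theta> (- r) w) b = \<phi> t w (\<phi> r (\<theta> (- r) w) b)"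
        using cocycle[OF r(2) t shift_in[OF w] bX, of "- r"] shift_add[OF w] shift_0[OF w] by simp
      then have "dist (\<phi> (t + r) (\<theta> (- r) w) b) y < e"
        using d(2) flow_in[OF r(2) shift_in[OF w] bX] r(4) by simp
      then show "\<exists>q\<ge>s. q \<ge> 0 \<and> (\<exists>b\<in>B (\<theta> (- q) (\<theta> t w)). dist (\<phi> q (\<theta> (- q) (\<theta> t w)) b) y < e)"
        using r t eq by (intro exI[of _ "t + r"]) auto
    qed
  qed
  show "attractor (\<theta> t w) \<subseteq> \<phi> t w ` attractor w"
  proof
    fix z assume z: "z \<in> attractor (\<theta> t w)"
    have "\<exists>r b. r \<ge> real n \<and> b \<in> B (\<theta> (- r) w) \<and> dist (\<phi> t w (\<phi> r (\<theta> (- r) w) b)) z < 1 / Suc n" for n :: nat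
    proof -
      have "1 / real (Suc n) > 0" by simp
      from attractorD[OF z this, of "real n + t"] obtain q b where q: "q \<ge> real n + t" "b \<in> B (\<theta> (- q) (\<theta> t w))"
        "dist (\<phi> q (\<theta> (- q) (\<theta> t w)) b) z < 1 / Suc n" by blast
      define r where "r = q - t"
      have r: "r \<ge> real n" "r \<ge> 0" using q(1) by (auto simp: r_def)
      have eq: "\<theta> (- q) (\<theta> t w) = \<theta> (- r) w" using shift_add[OF w] by (simp add: r_def)
      have b: "b \<in> B (\<theta> (- r) w)" "b \<in> X" using q(2) B(2)[OF shift_in[OF w]] unfolding eq by auto
      have "\<phi> q (\<theta> (- r) w) b = \<phi> t w (\<phi> r (\<theta> (- r) w) b)"
        using cocycle[OF r(2) t shift_in[OF w] b(2), of "- r"] shift_add[OF w] shift_0[OF w]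
            by (simp add: r_def)
      then show ?thesis using q(3) r b(1) unfolding eq by auto
    qed
    then obtain r b where r: "\<And>n. r n \<ge> real n" and b: "\<And>n. b n \<in> B (\<theta> (- r n) w)"
      and close: "\<And>n. dist (\<phi> t w (\<phi> (r n) (\<theta> (- r n) w) (b n))) z < 1 / Suc n" by metis
    have lim: "filterlim r at_top sequentially"
      by (rule filterlim_at_top_mono[OF filterlim_real_sequentially]) (use r in auto)
    obtain y q where y: "y \<in> attractor w" and q: "strict_mono q"
      "(\<lambda>n. \<phi> (r (q n)) (\<theta> (- r (q n)) w) (b (q n))) \<longlonglongrightarrow> y"
      using asymptotic_compactness[OF w absorbed_B lim b] by metis
    have rX: "\<phi> (r n) (\<theta> (- r n) w) (b n) \<in> X" for n
      using b[of n] B(2)[OF shift_in[OF w]] r[of n] by (intro flow_in shift_in w) auto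
    have "(\<lambda>n. \<phi> t w (\<phi> (r (q n)) (\<theta> (- r (q n)) w) (b (q n)))) \<longlonglongrightarrow> \<phi> t w y"
      using continuous_on_tendsto_compose[OF flow_continuous[OF t w] q(2)] attractor_in_X[OF w] y rX by auto
    moreover have "(\<lambda>n. \<phi> t w (\<phi> (r (q n)) (\<theta> (- r (q n)) w) (b (q n)))) \<longlonglongrightarrow> z"
    proof -
      have "(\<lambda>n. \<phi> t w (\<phi> (r n) (\<theta> (- r n) w) (b n))) \<longlonglongrightarrow> z"
        by (rule metric_tendsto_imp_tendsto[OF LIMSEQ_Suc[OF lim_1_over_n[where 'a=real]]])
           (use close in \<open>auto intro!: always_eventually less_imp_le simp: dist_real_def\<close>)
      from LIMSEQ_subseq_LIMSEQ[OF this q(1)] show ?thesis by (simp add: o_def)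
    qed
    ultimately have "z = \<phi> t w y" using LIMSEQ_unique by blast
    then show "z \<in> \<phi> t w ` attractor w" using y by blast
  qed
qed

theorem attractor_attracts:
  assumes w: "w \<in> \<Omega>" and D: "absorbed D" and e: "e > 0"
  shows "\<exists>T. \<forall>t\<ge>T. \<forall>x\<in>D (\<theta> (- t) w). \<exists>y\<in>attractor w. dist (\<phi> t (\<theta> (- t) w) x) y < e"
proof (rule ccontr)
  assume "\<not> ?thesis"
  then have "\<forall>n. \<exists>t x. t \<ge> real n \<and> x \<in> D (\<theta> (- t) w) \<and> (\<forall>y\<in>attractor w. \<not> dist (\<phi> t (\<theta> (- t) w) x) y < e)"
    by blast
  then obtain t x where t: "\<And>n. t n \<ge> real n" and x: "\<And>n. x n \<in> D (\<theta> (- t n) w)"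
    and far: "\<And>n y. y \<in> attractor w \<Longrightarrow> \<not> dist (\<phi> (t n) (\<theta> (- t n) w) (x n)) y < e" by metis
  have lim: "filterlim t at_top sequentially"
    by (rule filterlim_at_top_mono[OF filterlim_real_sequentially]) (use t in auto)
  obtain z r where z: "z \<in> attractor w" "(\<lambda>n. \<phi> (t (r n)) (\<theta> (- t (r n)) w) (x (r n))) \<longlonglongrightarrow> z"
    using asymptotic_compactness[OF w D lim x] by metis
  have "eventually (\<lambda>n. dist (\<phi> (t (r n)) (\<theta> (- t (r n)) w) (x (r n))) z < e) sequentially"
    by (rule tendstoD[OF z(2) e])
  then show False using far[OF z(1)] by simp
qed

text \<open>The distance to the attractor is a limit of distances to images of \<open>B\<close>: these images come
  close to the attractor, and by invariance they contain it.\<close>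

theorem attractor_distance_limit:
  assumes w: "w \<in> \<Omega>"
  shows "(\<lambda>n. INF b\<in>B (\<theta> (- real n) w). dist (\<phi> (real n) (\<theta> (- real n) w) b) y) \<longlonglongrightarrow> (INF z\<in>attractor w. dist z y)"
proof (rule LIMSEQ_I)
  fix e :: real assume e: "e > 0"
  define f where "f n = (INF b\<in>B (\<theta> (- real n) w). dist (\<phi> (real n) (\<theta> (- real n) w) b) y)" for n
  define a where "a = (INF z\<in>attractor w. dist z y)"
  have bdd: "bdd_below ((\<lambda>z. dist z y) ` A)" "bdd_below ((\<lambda>z. dist (g z) y) ` A')" for A A' and g :: "'x \<Rightarrow> 'x"
    by (auto intro: bdd_belowI[of _ 0])
  have e2: "e / 2 > 0" using e by simp
  obtain T where T: "\<forall>t\<ge>T. \<forall>x\<in>B (\<theta> (- t) w). \<exists>y\<in>attractor w. dist (\<phi> t (\<theta> (- t) w) x) y < e / 2"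
    using attractor_attracts[OF w absorbed_B e2] by blast
  have "norm (f n - a) < e" if n: "n \<ge> nat \<lceil>T\<rceil>" for n
  proof -
    have nT: "real n \<ge> T" using n by linarith
    have w': "\<theta> (- real n) w \<in> \<Omega>" by (rule shift_in[OF w])
    have "f n \<le> a"
      unfolding a_def
    proof (rule cINF_greatest[OF attractor_nonempty[OF w]])
      fix z assume "z \<in> attractor w"
      moreover have "\<phi> (real n) (\<theta> (- real n) w) ` attractor (\<theta> (- real n) w) = attractor w"
        using attractor_invariant[OF w', of "real n"] shift_add[OF w] shift_0[OF w] by simp
      ultimately obtain b where "b \<in> attractor (\<theta> (- real n) w)" "z = \<phi> (real n) (\<theta> (- real n) w) b" by blast
      moreover then have "b \<in> B (\<theta> (- real n) w)" using attractor_subset[OF w'] B0(2)[OF w'] by blast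
      ultimately show "f n \<le> dist z y" unfolding f_def by (auto intro!: cINF_lower bdd)
    qed
    moreover have "a - e / 2 \<le> f n"
      unfolding f_def
    proof (rule cINF_greatest[OF B(1)[OF w']])
      fix b assume "b \<in> B (\<theta> (- real n) w)"
      then obtain z where z: "z \<in> attractor w" "dist (\<phi> (real n) (\<theta> (- real n) w) b) z < e / 2" using T nT
          by blast
      have "a \<le> dist z y" unfolding a_def using z(1) by (intro cINF_lower bdd)
      also have "\<dots> \<le> dist z (\<phi> (real n) (\<theta> (- real n) w) b) + dist (\<phi> (real n) (\<theta> (- real n) w) b) y"
        by (rule dist_triangle)
      finally show "a - e / 2 \<le> dist (\<phi> (real n) (\<theta> (- real n) w) b) y" using z(2) by (simp add: dist_commute)
    qed
    ultimately show ?thesis using e by (simp add: abs_if)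
  qed
  then show "\<exists>no. \<forall>n\<ge>no. norm ((INF b\<in>B (\<theta> (- real n) w). dist (\<phi> (real n) (\<theta> (- real n) w) b) y)
      - (INF z\<in>attractor w. dist z y)) < e" unfolding f_def a_def by blast
qed

end

section \<open>The flow generated by the mild solutions\<close>

lemma C0D:
  assumes "\<omega> \<in> C0"
  shows "continuous_on A \<omega>" "\<omega> 0 = 0"
  using assms unfolding C0_def by (auto intro: continuous_on_subset)

lemma wiener_shift_in_C0: "\<omega> \<in> C0 \<Longrightarrow> wiener_shift t \<omega> \<in> C0"
  unfolding C0_def wiener_shift_def
  by (auto intro!: continuous_on_diff continuous_on_compose2[of UNIV \<omega>] continuous_intros)

lemma wiener_shift_shift: "wiener_shift s (wiener_shift t \<omega>) = wiener_shift (s + t) \<omega>"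
  unfolding wiener_shift_def by (simp add: fun_eq_iff algebra_simps)

lemma wiener_shift_0: "\<omega> \<in> C0 \<Longrightarrow> wiener_shift 0 \<omega> = \<omega>"
  unfolding wiener_shift_def C0_def by simp

context delay_equation begin

definition flow :: "real \<Rightarrow> (real \<Rightarrow> 'u) \<Rightarrow> (real \<Rightarrow>\<^sub>C 'h) \<Rightarrow> (real \<Rightarrow>\<^sub>C 'h)" where
  "flow t \<omega> \<xi> = hist \<mu> (SOME u. solves \<omega> \<xi> u) t"

lemma flow_solution:
  assumes "\<omega> \<in> C0" "\<xi> \<in> Cmu \<mu>"
  obtains u where "solves \<omega> \<xi> u" "\<And>t. flow t \<omega> \<xi> = hist \<mu> u t"
proof -
  have "\<exists>u. solves \<omega> \<xi> u"
    using solution_exists[OF C0D(1)[OF assms(1)] C0D(2)[OF assms(1)] assms(2)] by metis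
  then have "solves \<omega> \<xi> (SOME u. solves \<omega> \<xi> u)" by (rule someI_ex)
  then show thesis using that unfolding flow_def by blast
qed

lemma flow_eq:
  assumes "\<omega> \<in> C0" "\<xi> \<in> Cmu \<mu>" "solves \<omega> \<xi> u" "t \<ge> 0"
  shows "flow t \<omega> \<xi> = hist \<mu> u t"
proof -
  obtain v where v: "solves \<omega> \<xi> v" "\<And>t. flow t \<omega> \<xi> = hist \<mu> v t" using flow_solution[OF assms(1,2)] by metis
  show ?thesis using solution_unique[OF C0D(1)[OF assms(1)] assms(2) v(1) assms(3,4)] v(2) by simp
qed

lemma flow_in_Cmu: "\<omega> \<in> C0 \<Longrightarrow> \<xi> \<in> Cmu \<mu> \<Longrightarrow> t \<ge> 0 \<Longrightarrow> flow t \<omega> \<xi> \<in> Cmu \<mu>"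
  using flow_solution[of \<omega> \<xi>] hist_in solvesD(1) by metis

lemma flow_cocycle:
  assumes "\<omega> \<in> C0" "\<xi> \<in> Cmu \<mu>" "s \<ge> 0" "t \<ge> 0"
  shows "flow (t + s) \<omega> \<xi> = flow t (wiener_shift s \<omega>) (flow s \<omega> \<xi>)"
proof -
  obtain u where u: "solves \<omega> \<xi> u" "\<And>t. flow t \<omega> \<xi> = hist \<mu> u t" using flow_solution[OF assms(1,2)] by metis
  have "solves (wiener_shift s \<omega>) (flow s \<omega> \<xi>) (\<lambda>r. u (r + s))"
    unfolding u(2) by (rule solves_shift[OF u(1) C0D(1)[OF assms(1)] assms(3)])
  from flow_eq[OF wiener_shift_in_C0[OF assms(1)] flow_in_Cmu[OF assms(1-3)] this assms(4)]
  show ?thesis unfolding hist_shift u(2) by simp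
qed

lemma flow_stability:
  assumes B: "stability_bound T W B" and t: "t \<in> {0..T}" and \<omega>: "\<omega> \<in> C0" and \<eta>: "\<eta> \<in> C0"
    and \<xi>: "\<xi> \<in> Cmu \<mu>" and \<zeta>: "\<zeta> \<in> Cmu \<mu>"
    and W: "\<And>r. r \<in> {0..T} \<Longrightarrow> norm (\<omega> r) \<le> W" and \<delta>: "\<And>r. r \<in> {0..T} \<Longrightarrow> norm (\<omega> r - \<eta> r) \<le> \<delta>"
  shows "norm (flow t \<omega> \<xi> - flow t \<eta> \<zeta>) \<le> B * (norm (\<xi> - \<zeta>) + \<delta>)"
proof -
  obtain u where u: "solves \<omega> \<xi> u" "\<And>t. flow t \<omega> \<xi> = hist \<mu> u t" using flow_solution[OF \<omega> \<xi>] by metis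
  obtain v where v: "solves \<eta> \<zeta> v" "\<And>t. flow t \<eta> \<zeta> = hist \<mu> v t" using flow_solution[OF \<eta> \<zeta>] by metis
  show ?thesis unfolding u(2) v(2)
    by (rule stability_boundD[OF B C0D(1)[OF \<omega>] C0D(1)[OF \<eta>] \<xi> \<zeta> u(1) v(1) W \<delta> t])
qed

lemma flow_continuous:
  assumes \<omega>: "\<omega> \<in> C0" and t: "t \<ge> 0"
  shows "continuous_on (Cmu \<mu>) (flow t \<omega>)"
proof -
  obtain W where W: "\<And>r. r \<in> {0..t} \<Longrightarrow> norm (\<omega> r) \<le> W" using bounded_interval[OF C0D(1)[OF \<omega>]] by metis
  obtain B where B: "B \<ge> 0" "stability_bound t W B" using solution_stability by blast
  have "B-lipschitz_on (Cmu \<mu>) (flow t \<omega>)"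
  proof (rule lipschitz_onI[OF _ B(1)])
    fix \<xi> \<zeta> :: "real \<Rightarrow>\<^sub>C 'h" assume \<xi>: "\<xi> \<in> Cmu \<mu>" "\<zeta> \<in> Cmu \<mu>"
    have "norm (flow t \<omega> \<xi> - flow t \<omega> \<zeta>) \<le> B * (norm (\<xi> - \<zeta>) + 0)"
      by (rule flow_stability[OF B(2) _ \<omega> \<omega> \<xi> W]) (use t in auto)
    then show "dist (flow t \<omega> \<xi>) (flow t \<omega> \<zeta>) \<le> B * dist \<xi> \<zeta>" by (simp add: dist_norm)
  qed
  then show ?thesis by (rule lipschitz_on_continuous_on)
qed

lemma flow_maps_bounded_to_precompact:
  assumes \<omega>: "\<omega> \<in> C0" and T: "T > \<mu>" and D: "D \<subseteq> {\<xi>\<in>Cmu \<mu>. norm \<xi> \<le> R}"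
  shows "compact (closure (flow T \<omega> ` D))"
proof -
  have "flow T \<omega> ` D \<subseteq> {hist \<mu> u T | u \<xi>. \<xi> \<in> Cmu \<mu> \<and> norm \<xi> \<le> R \<and> solves \<omega> \<xi> u}"
  proof
    fix y assume "y \<in> flow T \<omega> ` D"
    then obtain \<xi> where \<xi>: "\<xi> \<in> Cmu \<mu>" "norm \<xi> \<le> R" "y = flow T \<omega> \<xi>" using D by blast
    obtain u where "solves \<omega> \<xi> u" "\<And>t. flow t \<omega> \<xi> = hist \<mu> u t" using flow_solution[OF \<omega> \<xi>(1)] by metis
    then show "y \<in> {hist \<mu> u T | u \<xi>. \<xi> \<in> Cmu \<mu> \<and> norm \<xi> \<le> R \<and> solves \<omega> \<xi> u}" using \<xi> by blast
  qed
  from closure_mono[OF this]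
  have sub: "closure (flow T \<omega> ` D) \<subseteq> closure {hist \<mu> u T | u \<xi>. \<xi> \<in> Cmu \<mu> \<and> norm \<xi> \<le> R \<and> solves \<omega> \<xi> u}" .
  show ?thesis
    using compact_Int_closed[OF flow_compact[OF C0D(1)[OF \<omega>] C0D(2)[OF \<omega>] T] closed_closure,
        of R "flow T \<omega> ` D"]
    unfolding Int_absorb1[OF sub] .
qed

text \<open>The integrands of \<open>mild_solution\<close> are those of \<open>solves\<close> after the reflection \<open>s = t - r\<close>,
  up to the value at the endpoint.\<close>

lemma mild_solution_iff_solves:
  assumes A: "\<And>t x. t > 0 \<Longrightarrow> A (S t x) = S' t x" and \<omega>: "noisy \<omega>"
  shows "mild_solution \<mu> A S F G K \<omega> \<xi> u \<longleftrightarrow> solves \<omega> \<xi> u"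
proof (cases "path u")
  case False
  then show ?thesis unfolding mild_solution_def solves_def by blast
next
  case u: True
  have SF: "set_integrable lborel {0..t} (\<lambda>r. S (t - r) (F (hist \<mu> u r)))"
    "(LINT r:{0..t}|lborel. S (t - r) (F (hist \<mu> u r))) = conv S (\<lambda>r. F (hist \<mu> u r)) t" for t
    using reflect_integral[of t
        "\<lambda>s. S s (F (hist \<mu> u (t - s)))"] S_integrable[OF coeff_continuous(1)[OF u], of t]
    by (simp_all add: conv_def)
  have SK: "set_integrable lborel {0..t} (\<lambda>r. S (t - r) (K (hist \<mu> u r) (\<omega> r)))"
    "(LINT r:{0..t}|lborel. S (t - r) (K (hist \<mu> u r) (\<omega> r))) = conv S (\<lambda>r. K (hist \<mu> u r) (\<omega> r)) t" for t
    using reflect_integral[of t "\<lambda>s. S s (K (hist \<mu> u (t - s)) (\<omega> (t - s)))"]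
      S_integrable[OF forcing_continuous(2)[OF u \<omega>], of t]
    by (simp_all add: conv_def)
  have AG: "set_integrable lborel {0..t} (\<lambda>r. A (S (t - r) (G (hist \<mu> u r) (\<omega> r))))"
    "(LINT r:{0..t}|lborel. A (S (t - r) (G (hist \<mu> u r) (\<omega> r)))) = conv S' (\<lambda>r. G (hist \<mu> u r) (\<omega> r)) t" for t
  proof -
    have i: "set_integrable lborel {0..t} (\<lambda>r. S' (t - r) (G (hist \<mu> u r) (\<omega> r)))"
      "(LINT r:{0..t}|lborel. S' (t - r) (G (hist \<mu> u r) (\<omega> r))) = conv S' (\<lambda>r. G (hist \<mu> u r) (\<omega> r)) t"
      using reflect_integral[of t "\<lambda>s. S' s (G (hist \<mu> u (t - s)) (\<omega> (t - s)))"] S'_integrable[OF u \<omega>, of t]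
      by (simp_all add: conv_def)
    have eq: "indicator {0..t} r *\<^sub>R A (S (t - r) (G (hist \<mu> u r) (\<omega> r)))
        = indicator {0..t} r *\<^sub>R S' (t - r) (G (hist \<mu> u r) (\<omega> r))" if "r \<notin> {t}" for r
      using that A[of "t - r"] by (auto split: split_indicator)
    show "set_integrable lborel {0..t} (\<lambda>r. A (S (t - r) (G (hist \<mu> u r) (\<omega> r))))"
      using i(1) unfolding set_integrable_def
      by (subst integrable_discrete_difference[of "{t}", OF _ _ _ eq]) auto
    show "(LINT r:{0..t}|lborel. A (S (t - r) (G (hist \<mu> u r) (\<omega> r)))) = conv S' (\<lambda>r. G (hist \<mu> u r) (\<omega> r)) t"
      unfolding i(2)[symmetric] set_lebesgue_integral_def
      by (rule integral_discrete_difference[of "{t}", OF _ _ _ eq]) auto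
  qed
  show ?thesis
    unfolding mild_solution_def solves_def mild_map_def noise_def SF(2) SK(2) AG(2)
    using SF(1) SK(1) AG(1) by (simp add: algebra_simps)
qed

lemma mild_flow_eq_flow:
  assumes A: "\<And>t x. t > 0 \<Longrightarrow> A (S t x) = S' t x" and \<omega>: "\<omega> \<in> C0" and \<xi>: "\<xi> \<in> Cmu \<mu>" and t: "t \<ge> 0"
  shows "mild_flow \<mu> A S F G K t \<omega> \<xi> = flow t \<omega> \<xi>"
proof -
  have eq: "mild_solution \<mu> A S F G K \<omega> \<xi> u \<longleftrightarrow> solves \<omega> \<xi> u" for u
    by (rule mild_solution_iff_solves) (use A C0D(1)[OF \<omega>] in auto)
  show ?thesis
    unfolding mild_flow_def eq
  proof (rule the_equality)
  obtain u where "solves \<omega> \<xi> u" "\<And>t. flow t \<omega> \<xi> = hist \<mu> u t" using flow_solution[OF \<omega> \<xi>] by metis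
  then show "\<exists>u. solves \<omega> \<xi> u \<and> flow t \<omega> \<xi> = hist \<mu> u t" by blast
  qed (use flow_eq[OF \<omega> \<xi> _ t] in auto)
qed

end

section \<open>Growth of the noise paths\<close>

definition subexponential :: "(real \<Rightarrow> 'u::real_normed_vector) \<Rightarrow> bool" where
  "subexponential \<omega> \<longleftrightarrow> (\<forall>\<delta>>0. \<exists>c\<ge>0. \<forall>r. norm (\<omega> r) \<le> c * exp (\<delta> * \<bar>r\<bar>))"

text \<open>The increments over unit intervals at distance \<open>r\<close> from the origin are eventually smaller
  than \<open>r\<close>, so that the path grows at most quadratically.\<close>

lemma sublinear_increments_imp_subexponential:
  fixes \<omega> :: "real \<Rightarrow> 'u::real_normed_vector"
  assumes cont: "continuous_on UNIV \<omega>"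
    and top: "((\<lambda>t. (SUP s\<in>{-1..0}. norm (wiener_shift t \<omega> s)) / \<bar>t\<bar>) \<longlongrightarrow> 0) at_top"
    and bot: "((\<lambda>t. (SUP s\<in>{-1..0}. norm (wiener_shift t \<omega> s)) / \<bar>t\<bar>) \<longlongrightarrow> 0) at_bot"
  shows "subexponential \<omega>"
proof -
  have inc: "norm (\<omega> (t - 1) - \<omega> t) \<le> \<bar>t\<bar>"
    if t: "t \<noteq> 0" and lt: "(SUP s\<in>{-1..0}. norm (wiener_shift t \<omega> s)) / \<bar>t\<bar> < 1" for t
  proof -
    have c: "continuous_on {-1..0} (\<lambda>s. norm (wiener_shift t \<omega> s))"
      unfolding wiener_shift_def
      by (intro continuous_on_norm continuous_on_diff continuous_on_const continuous_on_compose2[OF cont]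
          continuous_intros) auto
    have "bdd_above ((\<lambda>s. norm (wiener_shift t \<omega> s)) ` {-1..0})"
      by (intro bounded_imp_bdd_above compact_imp_bounded compact_continuous_image c) auto
    from cSUP_upper[OF _ this, of "-1"]
    have "norm (\<omega> (t - 1) - \<omega> t) \<le> (SUP s\<in>{-1..0}. norm (wiener_shift t \<omega> s))"
      by (simp add: wiener_shift_def)
    also have "\<dots> < \<bar>t\<bar>" using lt t by (simp add: divide_less_eq)
    finally show ?thesis by simp
  qed
  have "eventually (\<lambda>t. (SUP s\<in>{-1..0}. norm (wiener_shift t \<omega> s)) / \<bar>t\<bar> < 1) at_top"
    using order_tendstoD(2)[OF top, of 1] by simp
  then obtain T1 where T1: "\<And>t. t \<ge> T1 \<Longrightarrow> (SUP s\<in>{-1..0}. norm (wiener_shift t \<omega> s)) / \<bar>t\<bar> < 1"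
    unfolding eventually_at_top_linorder by blast
  have "eventually (\<lambda>t. (SUP s\<in>{-1..0}. norm (wiener_shift t \<omega> s)) / \<bar>t\<bar> < 1) at_bot"
    using order_tendstoD(2)[OF bot, of 1] by simp
  then obtain T2 where T2: "\<And>t. t \<le> T2 \<Longrightarrow> (SUP s\<in>{-1..0}. norm (wiener_shift t \<omega> s)) / \<bar>t\<bar> < 1"
    unfolding eventually_at_bot_linorder by blast
  \<comment> \<open>The extra \<open>1\<close> is for negative times \<open>r\<close>, which are reached from \<open>r + 1\<close>.\<close>
  define N where "N = max (max T1 (- T2)) 1 + 1"
  have N: "N \<ge> 2" "N - 1 \<ge> T1" "- (N - 1) \<le> T2" by (auto simp: N_def)
  have "bounded (\<omega> ` {- N..N})"
    by (intro compact_imp_bounded compact_continuous_image continuous_on_subset[OF cont]) auto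
  then obtain M where M: "\<forall>r\<in>{- N..N}. norm (\<omega> r) \<le> M" unfolding bounded_iff by auto
  have "norm (\<omega> 0) \<le> M" using M N by simp
  then have M0: "M \<ge> 0" using norm_ge_zero[of "\<omega> 0"] by linarith
  have quad: "norm (\<omega> r) \<le> M + real n * (N + real n)" if "\<bar>r\<bar> \<le> N + real n" for n r
    using that
  proof (induction n arbitrary: r)
    case 0
    then show ?case using M[rule_format, of r] by (simp add: abs_le_iff)
  next
    case (Suc n)
    have grow: "M + real n * (N + real n) + (N + real n + 1) \<le> M + real (Suc n) * (N + real (Suc n))"
      by (simp add: algebra_simps)
    consider "\<bar>r\<bar> \<le> N + real n" | "r > N + real n" | "r < - (N + real n)" by linarith
    then show ?case
    proof cases
      case 1
      have "real n * (N + real n) \<le> real (Suc n) * (N + real (Suc n))" using N by (intro mult_mono) auto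
      then show ?thesis using Suc.IH[OF 1] by linarith
    next
      case 2
      have "norm (\<omega> (r - 1) - \<omega> r) \<le> \<bar>r\<bar>" using 2 N by (intro inc T1) auto
      moreover have "norm (\<omega> (r - 1)) \<le> M + real n * (N + real n)" using 2 Suc.prems N by (intro Suc.IH) auto
      moreover have "norm (\<omega> r) \<le> norm (\<omega> (r - 1)) + norm (\<omega> (r - 1) - \<omega> r)"
        using norm_triangle_ineq4[of "\<omega> (r - 1)" "\<omega> (r - 1) - \<omega> r"] by simp
      ultimately show ?thesis using grow Suc.prems by simp
    next
      case 3
      have "norm (\<omega> (r + 1 - 1) - \<omega> (r + 1)) \<le> \<bar>r + 1\<bar>" using 3 N by (intro inc T2) auto
      moreover have "norm (\<omega> (r + 1)) \<le> M + real n * (N + real n)" using 3 Suc.prems N by (intro Suc.IH) auto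
      moreover have "norm (\<omega> r) \<le> norm (\<omega> (r + 1)) + norm (\<omega> r - \<omega> (r + 1))"
        using norm_triangle_ineq[of "\<omega> (r + 1)" "\<omega> r - \<omega> (r + 1)"] by simp
      ultimately show ?thesis using grow Suc.prems 3 N by simp
    qed
  qed
  show ?thesis
    unfolding subexponential_def
  proof (intro allI impI)
    fix \<delta> :: real assume \<delta>: "\<delta> > 0"
    have lin: "x + a \<le> (a + 2 / \<delta>) * exp (\<delta> / 2 * x)" if "x \<ge> 0" "a \<ge> 0" for x a :: real
    proof -
      have e1: "1 \<le> exp (\<delta> / 2 * x)" using that \<delta> by simp
      have "\<delta> / 2 * x \<le> exp (\<delta> / 2 * x)" using exp_ge_add_one_self[of "\<delta> / 2 * x"] by linarith
      then have "x \<le> 2 / \<delta> * exp (\<delta> / 2 * x)" using \<delta> by (simp add: field_simps)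
      moreover have "a \<le> a * exp (\<delta> / 2 * x)" using mult_left_mono[OF e1 that(2)] by simp
      ultimately show ?thesis by (simp add: distrib_right)
    qed
    define c where "c = M + (1 + 2 / \<delta>) * (N + 1 + 2 / \<delta>)"
    have c: "c \<ge> 0" using M0 \<delta> N by (simp add: c_def)
    have "norm (\<omega> r) \<le> c * exp (\<delta> * \<bar>r\<bar>)" for r
    proof -
      define n where "n = nat \<lceil>\<bar>r\<bar>\<rceil>"
      have n: "\<bar>r\<bar> \<le> real n" "real n \<le> \<bar>r\<bar> + 1" unfolding n_def by linarith+
      have "norm (\<omega> r) \<le> M + real n * (N + real n)" using n N by (intro quad) auto
      also have "\<dots> \<le> M * 1 + (\<bar>r\<bar> + 1) * (\<bar>r\<bar> + (N + 1))"
      proof -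
        have "real n * (N + real n) \<le> (\<bar>r\<bar> + 1) * (\<bar>r\<bar> + (N + 1))" using n N by (intro mult_mono) auto
        then show ?thesis by simp
      qed
      also have "\<dots> \<le> M * exp (\<delta> * \<bar>r\<bar>)
          + ((1 + 2 / \<delta>) * exp (\<delta> / 2 * \<bar>r\<bar>)) * ((N + 1 + 2 / \<delta>) * exp (\<delta> / 2 * \<bar>r\<bar>))"
        using M0 \<delta> N by (intro add_mono mult_left_mono mult_mono lin) auto
      also have "\<dots> = M * exp (\<delta> * \<bar>r\<bar>)
          + (1 + 2 / \<delta>) * (N + 1 + 2 / \<delta>) * (exp (\<delta> / 2 * \<bar>r\<bar>) * exp (\<delta> / 2 * \<bar>r\<bar>))" by simp
      also have "exp (\<delta> / 2 * \<bar>r\<bar>) * exp (\<delta> / 2 * \<bar>r\<bar>) = exp (\<delta> * \<bar>r\<bar>)" by (simp add: mult_exp_exp)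
      finally show ?thesis by (simp add: c_def distrib_right)
    qed
    with c show "\<exists>c\<ge>0. \<forall>r. norm (\<omega> r) \<le> c * exp (\<delta> * \<bar>r\<bar>)" by blast
  qed
qed

text \<open>The weighted supremum of the past that controls the radius of the absorbing balls.\<close>

definition peak :: "real \<Rightarrow> (real \<Rightarrow> 'u::real_normed_vector) \<Rightarrow> real" where
  "peak \<epsilon> \<omega> = (SUP s\<in>{..0}. exp (\<epsilon> * s) * norm (\<omega> s))"

lemma peak_bdd:
  assumes "subexponential \<omega>" "\<epsilon> > 0"
  shows "bdd_above ((\<lambda>s. exp (\<epsilon> * s) * norm (\<omega> s)) ` {..0})"
proof -
  obtain c where c: "\<And>r. norm (\<omega> r) \<le> c * exp (\<epsilon> * \<bar>r\<bar>)"
    using assms(1)[unfolded subexponential_def, rule_format, OF assms(2)] by blast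
  have "exp (\<epsilon> * s) * norm (\<omega> s) \<le> c" if "s \<le> 0" for s
  proof -
    have "exp (\<epsilon> * s) * norm (\<omega> s) \<le> exp (\<epsilon> * s) * (c * exp (\<epsilon> * \<bar>s\<bar>))" by (intro mult_left_mono c) auto
    also have "\<dots> = c * (exp (\<epsilon> * s) * exp (\<epsilon> * \<bar>s\<bar>))" by simp
    also have "exp (\<epsilon> * s) * exp (\<epsilon> * \<bar>s\<bar>) = 1" using that by (simp add: mult_exp_exp)
    finally show ?thesis by simp
  qed
  then show ?thesis by (auto intro!: bdd_aboveI)
qed

lemma le_peak:
  assumes "subexponential \<omega>" "\<epsilon> > 0" "s \<le> 0"
  shows "norm (\<omega> s) \<le> peak \<epsilon> \<omega> * exp (- \<epsilon> * s)"
proof -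
  have "exp (\<epsilon> * s) * norm (\<omega> s) \<le> peak \<epsilon> \<omega>"
    unfolding peak_def by (rule cSUP_upper[OF _ peak_bdd[OF assms(1,2)]]) (use assms in auto)
  then have "exp (- \<epsilon> * s) * (exp (\<epsilon> * s) * norm (\<omega> s)) \<le> exp (- \<epsilon> * s) * peak \<epsilon> \<omega>"
      by (intro mult_left_mono) auto
  moreover have "exp (- \<epsilon> * s) * (exp (\<epsilon> * s) * norm (\<omega> s)) = norm (\<omega> s)"
    by (simp add: mult.assoc[symmetric] mult_exp_exp)
  ultimately have "norm (\<omega> s) \<le> exp (- \<epsilon> * s) * peak \<epsilon> \<omega>" by linarith
  then show ?thesis by (simp only: mult.commute)
qed

lemma peak_nonneg: "subexponential \<omega> \<Longrightarrow> \<epsilon> > 0 \<Longrightarrow> peak \<epsilon> \<omega> \<ge> 0"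
  using order_trans[OF norm_ge_zero le_peak[of \<omega> \<epsilon> 0]] by simp

text \<open>A subexponential path satisfies a bound with any smaller rate \<open>d \<le> \<epsilon>\<close>, so the weight \<open>exp (\<epsilon> s)\<close>
  leaves only the growth of the path near \<open>t\<close>.\<close>

lemma peak_shift_growth:
  assumes sub: "subexponential \<omega>" and \<epsilon>: "\<epsilon> > 0" and \<delta>: "\<delta> > 0"
  shows "\<exists>c\<ge>0. \<forall>t. peak \<epsilon> (wiener_shift t \<omega>) \<le> c * exp (\<delta> * \<bar>t\<bar>)"
proof -
  define d where "d = min \<delta> \<epsilon>"
  have d: "d > 0" "d \<le> \<delta>" "d \<le> \<epsilon>" using \<epsilon> \<delta> by (auto simp: d_def)
  obtain c where c: "c \<ge> 0" "\<And>r. norm (\<omega> r) \<le> c * exp (d * \<bar>r\<bar>)"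
    using sub[unfolded subexponential_def, rule_format, OF d(1)] by blast
  have "peak \<epsilon> (wiener_shift t \<omega>) \<le> 2 * c * exp (\<delta> * \<bar>t\<bar>)" for t
    unfolding peak_def
  proof (rule cSUP_least)
    fix s :: real assume "s \<in> {..0}"
    then have s: "s \<le> 0" by simp
    have le: "exp (d * \<bar>s + t\<bar>) \<le> exp (d * \<bar>t\<bar>) * exp (- d * s)"
    proof -
      have "d * \<bar>s + t\<bar> \<le> d * (\<bar>t\<bar> - s)" using s d by (intro mult_left_mono) auto
      then show ?thesis by (simp add: mult_exp_exp algebra_simps)
    qed
    have "norm (wiener_shift t \<omega> s) \<le> norm (\<omega> (s + t)) + norm (\<omega> t)"
      unfolding wiener_shift_def by (rule norm_triangle_ineq4)
    also have "\<dots> \<le> c * (exp (d * \<bar>t\<bar>) * exp (- d * s)) + c * (exp (d * \<bar>t\<bar>) * exp (- d * s))"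
    proof (rule add_mono)
      show "norm (\<omega> (s + t)) \<le> c * (exp (d * \<bar>t\<bar>) * exp (- d * s))"
        by (rule order_trans[OF c(2) mult_left_mono[OF le c(1)]])
      have "1 \<le> exp (- d * s)" using s d by (simp add: mult_nonneg_nonpos)
      then have "exp (d * \<bar>t\<bar>) * 1 \<le> exp (d * \<bar>t\<bar>) * exp (- d * s)" by (intro mult_left_mono) auto
      then show "norm (\<omega> t) \<le> c * (exp (d * \<bar>t\<bar>) * exp (- d * s))"
        using order_trans[OF c(2)[of t] mult_left_mono[OF _ c(1)]] by simp
    qed
    finally have "exp (\<epsilon> * s) * norm (wiener_shift t \<omega> s)
        \<le> exp (\<epsilon> * s) * (2 * c * (exp (d * \<bar>t\<bar>) * exp (- d * s)))" by (intro mult_left_mono) auto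
    also have "\<dots> = 2 * c * (exp (d * \<bar>t\<bar>) * exp ((\<epsilon> - d) * s))" by (simp add: mult_exp_exp algebra_simps)
    also have "\<dots> \<le> 2 * c * (exp (\<delta> * \<bar>t\<bar>) * 1)"
    proof (intro mult_left_mono mult_mono)
      show "exp (d * \<bar>t\<bar>) \<le> exp (\<delta> * \<bar>t\<bar>)" using mult_right_mono[OF d(2), of "\<bar>t\<bar>"] by simp
      show "exp ((\<epsilon> - d) * s) \<le> 1" using s d by (simp add: mult_nonneg_nonpos)
    qed (use c in auto)
    finally show "exp (\<epsilon> * s) * norm (wiener_shift t \<omega> s) \<le> 2 * c * exp (\<delta> * \<bar>t\<bar>)" by simp
  qed auto
  then show ?thesis using c(1) by (intro exI[of _ "2 * c"]) auto
qed

section \<open>The compact-open topology\<close>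

lemma openin_compact_open_subset: "openin compact_open_C0 U \<Longrightarrow> U \<subseteq> C0"
  using openin_subset[of "compact_open_C0" U] unfolding compact_open_C0_def topology_generated_by_topspace
      by blast

lemma openin_compact_open_basic: "compact X \<Longrightarrow> open V \<Longrightarrow> openin compact_open_C0 {\<omega> \<in> C0. \<omega> ` X \<subseteq> V}"
  unfolding compact_open_C0_def by (rule topology_generated_by_Basis) blast

text \<open>On a compact interval, uniform closeness to \<open>\<omega>\<close> is implied by finitely many conditions
  \<open>\<eta> ` X \<subseteq> V\<close>, for intervals \<open>X\<close> on which \<open>\<omega>\<close> varies little and balls \<open>V\<close>.\<close>

lemma compact_open_uniform_neighbourhood:
  fixes \<omega> :: "real \<Rightarrow> 'u::real_normed_vector"
  assumes \<omega>: "\<omega> \<in> C0" and e: "e > 0"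
  shows "\<exists>U. openin compact_open_C0 U \<and> \<omega> \<in> U \<and> (\<forall>\<eta>\<in>U. \<forall>r\<in>{- b..b}. norm (\<eta> r - \<omega> r) < e)"
proof -
  have "uniformly_continuous_on {- b..b} \<omega>"
    by (intro compact_uniformly_continuous C0D(1)[OF \<omega>]) auto
  then obtain d where d: "d > 0" "\<And>x y. x \<in> {- b..b} \<Longrightarrow> y \<in> {- b..b} \<Longrightarrow> dist y x < d \<Longrightarrow> dist (\<omega> y) (\<omega> x) < e / 2"
    unfolding uniformly_continuous_on_def using e by (metis half_gt_zero)
  have "seq_compact {- b..b}" using compact_Icc unfolding compact_eq_seq_compact_metric .
  from seq_compact_imp_totally_bounded[OF this, rule_format, OF half_gt_zero[OF d(1)]]
  obtain k where k: "finite k" "k \<subseteq> {- b..b}" "{- b..b} \<subseteq> (\<Union>p\<in>k. ball p (d / 2))" by blast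
  define X where "X p = cball p (d / 2) \<inter> {- b..b}" for p
  define U where "U k = {\<eta> \<in> C0. \<forall>p\<in>k. \<eta> ` X p \<subseteq> ball (\<omega> p) (e / 2)}" for k
  have "openin compact_open_C0 (U k)"
    using k(1)
  proof induction
    case empty
    have "U {} = {\<omega> \<in> C0. \<omega> ` {} \<subseteq> UNIV}" by (auto simp: U_def)
    then show ?case using openin_compact_open_basic[of "{}" UNIV] by simp
  next
    case (insert p k)
    have "U (insert p k) = {\<omega>' \<in> C0. \<omega>' ` X p \<subseteq> ball (\<omega> p) (e / 2)} \<inter> U k" by (auto simp: U_def)
    moreover have "openin compact_open_C0 {\<omega>' \<in> C0. \<omega>' ` X p \<subseteq> ball (\<omega> p) (e / 2)}"
      by (rule openin_compact_open_basic) (auto simp: X_def intro!: compact_Int)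
    ultimately show ?case using insert by (simp add: openin_Int)
  qed
  moreover have "\<omega> \<in> U k"
    using \<omega> k(2) d by (auto simp: U_def X_def dist_commute)
  moreover have "norm (\<eta> r - \<omega> r) < e" if \<eta>: "\<eta> \<in> U k" and r: "r \<in> {- b..b}" for \<eta> r
  proof -
    obtain p where p: "p \<in> k" "dist p r < d / 2" using k(3) r by auto
    have "r \<in> X p" using p(2) r by (simp add: X_def)
    then have "\<eta> r \<in> \<eta> ` X p" by (rule imageI)
    moreover have "\<eta> ` X p \<subseteq> ball (\<omega> p) (e / 2)" using \<eta> p(1) unfolding U_def by blast
    ultimately have "dist (\<eta> r) (\<omega> p) < e / 2" by (metis dist_commute mem_ball subsetD)
    moreover have "dist (\<omega> r) (\<omega> p) < e / 2" using d r p k(2) by (auto simp: dist_commute)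
    ultimately show ?thesis using dist_triangle_half_l[of "\<eta> r" "\<omega> p" e "\<omega> r"] by (simp add: dist_norm)
  qed
  ultimately show ?thesis by blast
qed

lemma openin_compact_openI:
  fixes P :: "(real \<Rightarrow> 'u::real_normed_vector) set"
  assumes "P \<subseteq> C0"
    and nbhd: "\<And>\<omega>. \<omega> \<in> P \<Longrightarrow> \<exists>b e. e > 0 \<and> (\<forall>\<eta>\<in>C0. (\<forall>r\<in>{- b..b}. norm (\<eta> r - \<omega> r) < e) \<longrightarrow> \<eta> \<in> P)"
  shows "openin compact_open_C0 P"
proof (subst openin_subopen, intro ballI)
  fix \<omega> assume \<omega>: "\<omega> \<in> P"
  obtain b e where e: "e > 0" "\<forall>\<eta>\<in>C0. (\<forall>r\<in>{- b..b}. norm (\<eta> r - \<omega> r) < e) \<longrightarrow> \<eta> \<in> P" using nbhd[OF \<omega>] by blast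
  obtain U where U: "openin compact_open_C0 U" "\<omega> \<in> U" "\<forall>\<eta>\<in>U. \<forall>r\<in>{- b..b}. norm (\<eta> r - \<omega> r) < e"
    using compact_open_uniform_neighbourhood[of \<omega> e b] \<omega> assms(1) e(1) by blast
  have "U \<subseteq> P" using e(2) U(3) openin_compact_open_subset[OF U(1)] by blast
  with U show "\<exists>T. openin compact_open_C0 T \<and> \<omega> \<in> T \<and> T \<subseteq> P" by blast
qed

lemma space_path_sigma:
  "(\<Omega> :: (real \<Rightarrow> 'a::real_normed_vector) set) \<subseteq> C0 \<Longrightarrow> space (path_sigma \<Omega>) = \<Omega>"
proof -
  have "space (borel_C0 :: (real \<Rightarrow> 'a) measure) = C0"
    unfolding borel_C0_def using openin_compact_open_subset by (intro space_measure_of) auto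
  then show "\<Omega> \<subseteq> C0 \<Longrightarrow> space (path_sigma \<Omega>) = \<Omega>"
    unfolding path_sigma_def by (auto simp: space_restrict_space)
qed

lemma open_in_path_sigma:
  assumes "openin compact_open_C0 U"
  shows "\<Omega> \<inter> U \<in> sets (path_sigma \<Omega>)"
proof -
  have "U \<in> sets borel_C0" unfolding borel_C0_def
    using assms openin_compact_open_subset by (subst sets_measure_of) (auto intro: sigma_sets.Basic)
  then show ?thesis unfolding path_sigma_def by (auto simp: sets_restrict_space)
qed

section \<open>Tempered families\<close>

lemma log_plus_nonneg: "0 \<le> log_plus s"
  by (auto simp: log_plus_def max_def)

lemma log_plus_less_imp_le_exp:
  assumes "log_plus s / ereal a < ereal \<delta>" "a > 0" "ereal x \<le> s"
  shows "x \<le> exp (\<delta> * a)"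
proof (cases s)
  case (real r)
  have "max 0 (ln r) / a < \<delta>" using assms(1,2) unfolding real log_plus_def by (simp del: ereal_max)
  then have lt: "max 0 (ln r) < \<delta> * a" using assms(2) by (simp add: pos_divide_less_eq)
  have "x \<le> r" using assms(3) real by simp
  also have "r \<le> exp (\<delta> * a)"
  proof (cases "r > 0")
    case True
    then have "r = exp (ln r)" by simp
    also have "\<dots> \<le> exp (\<delta> * a)" using lt by simp
    finally show ?thesis .
  next
    case False
    then show ?thesis using exp_gt_zero[of "\<delta> * a"] by linarith
  qed
  finally show ?thesis .
next
  case PInf
  then show ?thesis using assms(1,2) by (simp add: log_plus_def)
next
  case MInf
  then show ?thesis using assms(3) by simp
qed

lemma log_plus_growth:
  fixes D :: "real \<Rightarrow> 'a::real_normed_vector set"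
  assumes growth: "\<And>\<delta>. \<delta> > 0 \<Longrightarrow> \<exists>c. \<forall>t. \<forall>x\<in>D t. norm x \<le> c * exp (\<delta> * \<bar>t\<bar>)"
    and ne: "\<And>t. D t \<noteq> {}" and L: "L \<in> {at_top, at_bot}"
  shows "((\<lambda>t. log_plus (SUP x\<in>D t. ereal (norm x)) / ereal \<bar>t\<bar>) \<longlongrightarrow> 0) L"
proof (rule order_tendstoI)
  fix a :: ereal assume "a < 0"
  then have "a < log_plus (SUP x\<in>D t. ereal (norm x)) / ereal \<bar>t\<bar>" if "\<bar>t\<bar> > 0" for t
    by (rule less_le_trans) (use that in \<open>auto intro!: zero_le_divide_ereal log_plus_nonneg\<close>)
  moreover have "eventually (\<lambda>t. \<bar>t\<bar> > 0) L"
    using L eventually_gt_at_top[of "0::real"] eventually_gt_at_bot[of "0::real"]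
        by (auto elim: eventually_mono)
  ultimately show "eventually (\<lambda>t. a < log_plus (SUP x\<in>D t. ereal (norm x)) / ereal \<bar>t\<bar>) L"
    by (auto elim: eventually_mono)
next
  fix a :: ereal assume "0 < a"
  then obtain e where e: "0 < ereal e" "ereal e < a" using ereal_dense2 by blast
  then have e0: "e > 0" by simp
  obtain c where c: "\<forall>t. \<forall>x\<in>D t. norm x \<le> c * exp (e / 2 * \<bar>t\<bar>)" using growth[of "e / 2"] e0 by auto
  define k where "k = ln (max c 1)"
  have k: "k \<ge> 0" by (simp add: k_def)
  have "log_plus (SUP x\<in>D t. ereal (norm x)) / ereal \<bar>t\<bar> < a" if t: "\<bar>t\<bar> > 2 * k / e" "\<bar>t\<bar> > 0" for t
  proof -
    define s where "s = (SUP x\<in>D t. ereal (norm x))"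
    have up: "s \<le> ereal (c * exp (e / 2 * \<bar>t\<bar>))" unfolding s_def using c by (intro SUP_least) auto
    obtain x where "x \<in> D t" using ne by blast
    then have "ereal (norm x) \<le> s" unfolding s_def by (rule SUP_upper)
    then have "0 \<le> s" by (rule order_trans[rotated]) simp
    with up obtain r where r: "s = ereal r" "0 \<le> r" "r \<le> c * exp (e / 2 * \<bar>t\<bar>)" by (cases s) auto
    have "ln r \<le> k + e / 2 * \<bar>t\<bar>" if "r > 0"
    proof -
      have "r \<le> max c 1 * exp (e / 2 * \<bar>t\<bar>)" by (rule order_trans[OF r(3) mult_right_mono]) auto
      then have "ln r \<le> ln (max c 1 * exp (e / 2 * \<bar>t\<bar>))" using that by (intro ln_mono) auto
      also have "\<dots> = k + e / 2 * \<bar>t\<bar>" by (simp add: k_def ln_mult)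
      finally show ?thesis .
    qed
    moreover have "0 \<le> k + e / 2 * \<bar>t\<bar>" using k e0 by simp
    ultimately have "max 0 (ln r) \<le> k + e / 2 * \<bar>t\<bar>" using r(2) by (cases "r = 0") auto
    also have "\<dots> < e * \<bar>t\<bar>" using t e0 by (simp add: pos_divide_less_eq algebra_simps)
    finally have "max 0 (ln r) / \<bar>t\<bar> < e" using t(2) by (simp add: pos_divide_less_eq)
    then have "log_plus s / ereal \<bar>t\<bar> < ereal e" unfolding r(1) log_plus_def using t(2) by (simp del: ereal_max)
    then show ?thesis using e(2) unfolding s_def by (rule less_trans)
  qed
  moreover have "eventually (\<lambda>t. \<bar>t\<bar> > 2 * k / e \<and> \<bar>t\<bar> > 0) L"
  proof -
    have "eventually (\<lambda>t::real. \<bar>t\<bar> > 2 * k / e \<and> \<bar>t\<bar> > 0) at_top"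
      using eventually_gt_at_top[of "max (2 * k / e) 0"] by eventually_elim auto
    moreover have "eventually (\<lambda>t::real. \<bar>t\<bar> > 2 * k / e \<and> \<bar>t\<bar> > 0) at_bot"
      using eventually_gt_at_bot[of "- max (2 * k / e) 0"] by eventually_elim auto
    ultimately show ?thesis using L by blast
  qed
  ultimately show "eventually (\<lambda>t. log_plus (SUP x\<in>D t. ereal (norm x)) / ereal \<bar>t\<bar> < a) L"
    by (auto elim: eventually_mono)
qed

lemma tendsto_0_hausdorff_semidist:
  fixes D :: "real \<Rightarrow> 'a::real_normed_vector set"
  assumes ne: "eventually (\<lambda>t. D t \<noteq> {}) at_top"
    and close: "\<And>e. e > 0 \<Longrightarrow> eventually (\<lambda>t. \<forall>x\<in>D t. \<exists>y\<in>Y. norm (x - y) < e) at_top"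
  shows "((\<lambda>t. hausdorff_semidist (D t) Y) \<longlongrightarrow> 0) at_top"
proof (rule order_tendstoI)
  fix a :: ereal assume a: "a < 0"
  show "eventually (\<lambda>t. a < hausdorff_semidist (D t) Y) at_top"
    using ne
  proof eventually_elim
    case (elim t)
    then obtain x where x: "x \<in> D t" by blast
    have "0 \<le> (INF y\<in>Y. ereal (norm (x - y)))" by (intro INF_greatest) simp
    also have "\<dots> \<le> hausdorff_semidist (D t) Y" unfolding hausdorff_semidist_def by (rule SUP_upper[OF x])
    finally show ?case using a by (rule less_le_trans[rotated])
  qed
next
  fix a :: ereal assume "0 < a"
  then obtain e where e: "0 < ereal e" "ereal e < a" using ereal_dense2 by blast
  then have "e > 0" by simp
  from close[OF this] show "eventually (\<lambda>t. hausdorff_semidist (D t) Y < a) at_top"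
  proof eventually_elim
    case (elim t)
    have "hausdorff_semidist (D t) Y \<le> ereal e"
      unfolding hausdorff_semidist_def
    proof (rule SUP_least)
      fix x assume "x \<in> D t"
      then obtain y where y: "y \<in> Y" "norm (x - y) < e" using elim by blast
      have "(INF y\<in>Y. ereal (norm (x - y))) \<le> ereal (norm (x - y))" by (rule INF_lower[OF y(1)])
      also have "\<dots> \<le> ereal e" using y(2) by simp
      finally show "(INF y\<in>Y. ereal (norm (x - y))) \<le> ereal e" .
    qed
    also note e(2)
    finally show ?case .
  qed
qed

lemma tempered_familiesD:
  assumes "D \<in> tempered_families \<mu> \<Omega>" and "\<omega> \<in> \<Omega>"
  shows "D \<omega> \<noteq> {}" "D \<omega> \<subseteq> Cmu \<mu>"
    and "\<delta> > 0 \<Longrightarrow> \<exists>T. \<forall>t\<ge>T. t > 0 \<longrightarrow> (\<forall>x\<in>D (wiener_shift (- t) \<omega>). norm x \<le> exp (\<delta> * t))"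
proof -
  show "D \<omega> \<noteq> {}" "D \<omega> \<subseteq> Cmu \<mu>" using assms unfolding tempered_families_def by auto
  assume \<delta>: "\<delta> > 0"
  have "((\<lambda>t. log_plus (SUP x\<in>D (wiener_shift t \<omega>). ereal (norm x)) / ereal \<bar>t\<bar>) \<longlongrightarrow> 0) at_bot"
    using assms unfolding tempered_families_def by auto
  then have "eventually (\<lambda>t. log_plus (SUP x\<in>D (wiener_shift t \<omega>). ereal (norm x)) / ereal \<bar>t\<bar> < ereal \<delta>)
      at_bot"
    by (rule order_tendstoD) (use \<delta> in simp)
  then obtain N where N: "\<And>t. t \<le> N
      \<Longrightarrow> log_plus (SUP x\<in>D (wiener_shift t \<omega>). ereal (norm x)) / ereal \<bar>t\<bar> < ereal \<delta>"
    unfolding eventually_at_bot_linorder by blast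
  have "norm x \<le> exp (\<delta> * t)" if t: "t \<ge> - N" "t > 0" and x: "x \<in> D (wiener_shift (- t) \<omega>)" for t x
  proof -
    have "norm x \<le> exp (\<delta> * \<bar>- t\<bar>)"
      by (rule log_plus_less_imp_le_exp[OF N]) (use t x in \<open>auto intro: SUP_upper\<close>)
    then show ?thesis using t by simp
  qed
  then show "\<exists>T. \<forall>t\<ge>T. t > 0 \<longrightarrow> (\<forall>x\<in>D (wiener_shift (- t) \<omega>). norm x \<le> exp (\<delta> * t))" by blast
qed

section \<open>Absorption and measurability\<close>

context delay_equation begin

lemma zero_in_Cmu: "0 \<in> Cmu \<mu>"
  unfolding Cmu_def by simp

text \<open>Pullback form of the a priori bound. The oscillation of \<open>\<theta>\<^sub>-\<^sub>T \<omega>\<close> over \<open>[r,t]\<close> is that of \<open>\<omega>\<close> over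
  \<open>[r - T, t - T]\<close>, hence at most \<open>2 peak(\<omega>) exp (\<epsilon> (T - r))\<close>; the growth \<open>exp (\<epsilon> T)\<close> of this bound is
  compensated by the decay at time \<open>T\<close>.\<close>

lemma pullback_bound:
  assumes c: "a_priori_constants \<epsilon> c" "\<epsilon> > 0" "c > 0" and \<omega>: "\<omega> \<in> C0" "subexponential \<omega>"
    and T: "T \<ge> 0" and \<xi>: "\<xi> \<in> Cmu \<mu>"
  shows "norm (flow T (wiener_shift (- T) \<omega>) \<xi>) \<le> c * (norm \<xi> * exp (- \<epsilon> * T) + 2 * peak \<epsilon> \<omega> + 1)"
proof -
  define \<eta> where "\<eta> = wiener_shift (- T) \<omega>"
  have \<eta>: "\<eta> \<in> C0" unfolding \<eta>_def by (rule wiener_shift_in_C0[OF \<omega>(1)])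
  define M where "M = peak \<epsilon> \<omega>"
  have M: "M \<ge> 0" unfolding M_def by (rule peak_nonneg[OF \<omega>(2) c(2)])
  define V where "V = 2 * M * exp (\<epsilon> * T)"
  have V: "V \<ge> 0" using M by (simp add: V_def)
  obtain u where u: "solves \<eta> \<xi> u" "\<And>t. flow t \<eta> \<xi> = hist \<mu> u t" using flow_solution[OF \<eta> \<xi>] by metis
  have "norm (hist \<mu> u T) \<le> c * ((norm \<xi> + V) * exp (- \<epsilon> * T) + 1)"
  proof (rule a_prioriD[OF c(1) C0D(1)[OF \<eta>] C0D(2)[OF \<eta>] \<xi> u(1) V])
    fix t r assume tr: "t \<in> {0..T}" "r \<in> {0..t}"
    have pk: "norm (\<omega> (s - T)) \<le> M * exp (\<epsilon> * T - \<epsilon> * r)" if s: "r \<le> s" "s \<le> T" for s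
    proof -
      have "norm (\<omega> (s - T)) \<le> M * exp (- \<epsilon> * (s - T))" unfolding M_def using s by (intro le_peak \<omega> c) auto
      also have "\<dots> \<le> M * exp (\<epsilon> * T - \<epsilon> * r)"
        using s mult_left_mono[OF s(1), of \<epsilon>] c(2) M by (intro mult_left_mono) (auto simp: algebra_simps)
      finally show ?thesis .
    qed
    have "norm (\<eta> r - \<eta> t) = norm (\<omega> (r - T) - \<omega> (t - T))" by (simp add: \<eta>_def wiener_shift_def)
    also have "\<dots> \<le> norm (\<omega> (r - T)) + norm (\<omega> (t - T))" by (rule norm_triangle_ineq4)
    also have "\<dots> \<le> M * exp (\<epsilon> * T - \<epsilon> * r) + M * exp (\<epsilon> * T - \<epsilon> * r)"
      using tr by (intro add_mono pk) auto
    also have "\<dots> = V * exp (- \<epsilon> * r)" by (simp add: V_def mult_exp_exp)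
    finally show "norm (\<eta> r - \<eta> t) \<le> V * exp (- \<epsilon> * r)" .
  qed (use T in auto)
  also have "(norm \<xi> + V) * exp (- \<epsilon> * T) = norm \<xi> * exp (- \<epsilon> * T) + 2 * M"
    by (simp add: V_def distrib_right mult_exp_exp)
  finally show ?thesis unfolding u(2)[symmetric] \<eta>_def M_def .
qed

text \<open>Sublevel sets of the distance from \<open>y\<close> to the image of a ball whose radius is controlled by the
  past of the path are even open, as the solution depends continuously on the noise path.\<close>

lemma openin_reachable:
  fixes y :: "real \<Rightarrow>\<^sub>C 'h"
  assumes \<epsilon>: "\<epsilon> > 0" and c: "c > 0"
  shows "openin compact_open_C0 {\<omega> \<in> C0. \<exists>x\<in>Cmu \<mu>. \<exists>s\<le>0.
    norm x < c * (2 * (exp (\<epsilon> * s) * norm (wiener_shift (- real n) \<omega> s)) + 2) + 1 \<and>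
    norm (flow (real n) (wiener_shift (- real n) \<omega>) x - y) < a}" (is "openin _ ?P")
proof (rule openin_compact_openI)
  show "?P \<subseteq> C0" by blast
  fix \<omega> assume "\<omega> \<in> ?P"
  then obtain x s where \<omega>: "\<omega> \<in> C0" and x: "x \<in> Cmu \<mu>" and s: "s \<le> 0"
    and r1: "norm x < c * (2 * (exp (\<epsilon> * s) * norm (wiener_shift (- real n) \<omega> s)) + 2) + 1"
    and r2: "norm (flow (real n) (wiener_shift (- real n) \<omega>) x - y) < a" by blast
  define g1 where "g1 = c * (2 * (exp (\<epsilon> * s) * norm (wiener_shift (- real n) \<omega> s)) + 2) + 1 - norm x"
  define g2 where "g2 = a - norm (flow (real n) (wiener_shift (- real n) \<omega>) x - y)"
  have g: "g1 > 0" "g2 > 0" using r1 r2 by (simp_all add: g1_def g2_def)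
  have \<omega>n: "wiener_shift (- real n) \<omega> \<in> C0" by (rule wiener_shift_in_C0[OF \<omega>])
  obtain W where W: "\<And>r. r \<in> {0..real n} \<Longrightarrow> norm (wiener_shift (- real n) \<omega> r) \<le> W"
    using bounded_interval[OF C0D(1)[OF \<omega>n]] by metis
  obtain B where B: "B \<ge> 0" "stability_bound (real n) W B" using solution_stability by blast
  define e where "e = min (g1 / (8 * c)) (g2 / (4 * (B + 1)))"
  have e: "e > 0" using g c B(1) by (simp add: e_def)
  have e1: "4 * c * e < g1"
  proof -
    have "4 * c * e \<le> 4 * c * (g1 / (8 * c))" using c by (intro mult_left_mono) (auto simp: e_def)
    also have "\<dots> = g1 / 2" using c by simp
    finally show ?thesis using g by simp
  qed
  have e2: "B * (2 * e) < g2"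
  proof -
    have "B * (2 * e) \<le> (B + 1) * (2 * e)" using e by (intro mult_right_mono) auto
    also have "\<dots> \<le> (B + 1) * (2 * (g2 / (4 * (B + 1))))" using B(1) by (intro mult_left_mono) (auto simp: e_def)
    also have "\<dots> = g2 / 2" using B(1) by (simp add: field_simps)
    finally show ?thesis using g by simp
  qed
  \<comment> \<open>The interval \<open>[-b,b]\<close> contains \<open>[-n,0]\<close>, where the flow reads the path, and \<open>s - n\<close>.\<close>
  define b where "b = real n - s"
  have "\<eta> \<in> ?P" if \<eta>: "\<eta> \<in> C0" and close: "\<forall>r\<in>{- b..b}. norm (\<eta> r - \<omega> r) < e" for \<eta>
  proof -
    have sh: "norm (wiener_shift (- real n) \<omega> r - wiener_shift (- real n) \<eta> r) \<le> 2 * e" if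
        "r - real n \<in> {- b..b}" for r
    proof -
      have "norm (\<eta> (r - real n) - \<omega> (r - real n)) < e" using close that by blast
      moreover have "norm (\<eta> (- real n) - \<omega> (- real n)) < e" using close s by (auto simp: b_def)
      moreover have "norm (wiener_shift (- real n) \<omega> r - wiener_shift (- real n) \<eta> r)
          \<le> norm (\<eta> (r - real n) - \<omega> (r - real n)) + norm (\<eta> (- real n) - \<omega> (- real n))"
        using norm_triangle_ineq4[of "\<eta> (- real n) - \<omega> (- real n)" "\<eta> (r - real n) - \<omega> (r - real n)"]
        by (simp add: wiener_shift_def algebra_simps)
      ultimately show ?thesis by linarith
    qed
    have "norm (wiener_shift (- real n) \<omega> s) \<le> norm (wiener_shift (- real n) \<eta> s) + 2 * e"
      using sh[of s] s norm_triangle_ineq2[of "wiener_shift (- real n) \<omega> s" "wiener_shift (- real n) \<eta> s"]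
      by (simp add: b_def)
    then have "exp (\<epsilon> * s) * norm (wiener_shift (- real n) \<omega> s)
        \<le> exp (\<epsilon> * s) * (norm (wiener_shift (- real n) \<eta> s) + 2 * e)"
      by (intro mult_left_mono) auto
    also have "\<dots> \<le> exp (\<epsilon> * s) * norm (wiener_shift (- real n) \<eta> s) + 1 * (2 * e)"
      unfolding distrib_left using e s \<epsilon>
          by (intro add_left_mono mult_right_mono) (auto simp: mult_nonneg_nonpos)
    finally have "2 * c * (exp (\<epsilon> * s) * norm (wiener_shift (- real n) \<omega> s))
        \<le> 2 * c * (exp (\<epsilon> * s) * norm (wiener_shift (- real n) \<eta> s) + 2 * e)" using c
            by (intro mult_left_mono) auto
    then have 1: "norm x < c * (2 * (exp (\<epsilon> * s) * norm (wiener_shift (- real n) \<eta> s)) + 2) + 1"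
      using e1 unfolding g1_def by (simp add: algebra_simps)
    have "norm (flow (real n) (wiener_shift (- real n) \<omega>) x - flow (real n) (wiener_shift (- real n) \<eta>) x)
        \<le> B * (norm (x - x) + 2 * e)"
      by (rule flow_stability[OF B(2) _ \<omega>n wiener_shift_in_C0[OF \<eta>] x x W sh]) (use s in \<open>auto simp: b_def\<close>)
    moreover have "norm (flow (real n) (wiener_shift (- real n) \<eta>) x - y)
        \<le> norm (flow (real n) (wiener_shift (- real n) \<omega>) x - y)
          + norm (flow (real n) (wiener_shift (- real n) \<omega>) x - flow (real n) (wiener_shift (- real n) \<eta>) x)"
      using norm_triangle_ineq4[of "flow (real n) (wiener_shift (- real n) \<omega>) x - y"
        "flow (real n) (wiener_shift (- real n) \<omega>) x - flow (real n) (wiener_shift (- real n) \<eta>) x"] by simp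
    ultimately have "norm (flow (real n) (wiener_shift (- real n) \<eta>) x - y) < a"
      using e2 unfolding g2_def by simp
    with 1 x s \<eta> show ?thesis by blast
  qed
  then show "\<exists>b e. e > 0 \<and> (\<forall>\<eta>\<in>C0. (\<forall>r\<in>{- b..b}. norm (\<eta> r - \<omega> r) < e) \<longrightarrow> \<eta> \<in> ?P)"
    using e by blast
qed

text \<open>By \<open>pullback_bound\<close> every orbit from a tempered family ends up in a ball of radius \<open>R(\<omega>)\<close>, affine in
  \<open>peak(\<omega>)\<close> and hence tempered. The distance to the attractor is a limit of distances to images of such
  balls, whose sublevel sets are relatively open in \<open>\<Omega>\<close>.\<close>

theorem random_attractor_exists:
  assumes \<Omega>: "\<Omega> \<subseteq> C0" and shift: "\<And>\<omega> t. \<omega> \<in> \<Omega> \<Longrightarrow> wiener_shift t \<omega> \<in> \<Omega>"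
    and sub: "\<And>\<omega>. \<omega> \<in> \<Omega> \<Longrightarrow> subexponential \<omega>"
    and \<phi>: "\<And>t \<omega> \<xi>. t \<ge> 0 \<Longrightarrow> \<omega> \<in> \<Omega> \<Longrightarrow> \<xi> \<in> Cmu \<mu> \<Longrightarrow> \<phi> t \<omega> \<xi> = flow t \<omega> \<xi>"
  shows "\<exists>\<A>. random_attractor \<mu> \<Omega> \<phi> \<A>"
proof -
  obtain \<epsilon> c where c: "\<epsilon> > 0" "c > 0" "a_priori_constants \<epsilon> c" using a_priori by blast
  define R where "R \<omega> = c * (2 * peak \<epsilon> \<omega> + 2)" for \<omega> :: "real \<Rightarrow> 'u"
  define B0 where "B0 \<omega> = {x :: real \<Rightarrow>\<^sub>C 'h. x \<in> Cmu \<mu> \<and> norm x \<le> R \<omega>}" for \<omega>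
  define B where "B \<omega> = {x :: real \<Rightarrow>\<^sub>C 'h. x \<in> Cmu \<mu> \<and> norm x < R \<omega> + 1}" for \<omega>
  have C0: "\<omega> \<in> C0" if "\<omega> \<in> \<Omega>" for \<omega> using \<Omega> that by blast
  have R_pos: "R \<omega> > 0" if "\<omega> \<in> \<Omega>" for \<omega>
    using peak_nonneg[OF sub[OF that] c(1)] c(2) by (simp add: R_def add_nonneg_pos)
  have absorb: "\<exists>T. \<forall>t\<ge>T. t \<ge> 0 \<longrightarrow> flow t (wiener_shift (- t) \<omega>) ` D (wiener_shift (- t) \<omega>) \<subseteq> B0 \<omega>"
    if \<omega>: "\<omega> \<in> \<Omega>" and D: "\<And>\<omega>. \<omega> \<in> \<Omega> \<Longrightarrow> D \<omega> \<subseteq> Cmu \<mu>"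
      and growth: "\<exists>T. \<forall>t\<ge>T. t > 0 \<longrightarrow> (\<forall>x\<in>D (wiener_shift (- t) \<omega>). norm x \<le> exp (\<epsilon> * t))" for D \<omega>
  proof -
    obtain T where T: "\<forall>t\<ge>T. t > 0 \<longrightarrow> (\<forall>x\<in>D (wiener_shift (- t) \<omega>). norm x \<le> exp (\<epsilon> * t))" using growth by blast
    have "flow t (wiener_shift (- t) \<omega>) x \<in> B0 \<omega>"
      if t: "t \<ge> max T 1" and x: "x \<in> D (wiener_shift (- t) \<omega>)" for t x
    proof -
      have xC: "x \<in> Cmu \<mu>" using D[OF shift[OF \<omega>]] x by blast
      have t0: "t \<ge> 0" "t > 0" "t \<ge> T" using t by auto
      have "norm x \<le> exp (\<epsilon> * t)" using T t0 x by blast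
      then have "norm x * exp (- \<epsilon> * t) \<le> exp (\<epsilon> * t) * exp (- \<epsilon> * t)" by (intro mult_right_mono) auto
      also have "\<dots> = 1" by (simp add: mult_exp_exp)
      finally have d: "norm x * exp (- \<epsilon> * t) \<le> 1" .
      have "norm (flow t (wiener_shift (- t) \<omega>) x) \<le> c * (norm x * exp (- \<epsilon> * t) + 2 * peak \<epsilon> \<omega> + 1)"
        by (rule pullback_bound[OF c(3,1,2) C0[OF \<omega>] sub[OF \<omega>] t0(1) xC])
      also have "\<dots> \<le> R \<omega>" unfolding R_def using d c(2) by (intro mult_left_mono) auto
      finally show ?thesis
        unfolding B0_def using flow_in_Cmu[OF wiener_shift_in_C0[OF C0[OF \<omega>]] xC t0(1)] by blast
    qed
    then show ?thesis by (intro exI[of _ "max T 1"]) blast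
  qed
  have R_growth: "\<exists>k. \<forall>t. R (wiener_shift t \<omega>) + 1 \<le> k * exp (\<delta> * \<bar>t\<bar>)" if \<omega>: "\<omega> \<in> \<Omega>" and \<delta>: "\<delta> > 0" for \<omega> \<delta>
  proof -
    obtain k where k: "k \<ge> 0" "\<And>t. peak \<epsilon> (wiener_shift t \<omega>) \<le> k * exp (\<delta> * \<bar>t\<bar>)"
      using peak_shift_growth[OF sub[OF \<omega>] c(1) \<delta>] by blast
    have "R (wiener_shift t \<omega>) + 1 \<le> (c * (2 * k + 2) + 1) * exp (\<delta> * \<bar>t\<bar>)" for t
    proof -
      have e1: "1 \<le> exp (\<delta> * \<bar>t\<bar>)" using \<delta> by simp
      have "R (wiener_shift t \<omega>) + 1 \<le> c * (2 * (k * exp (\<delta> * \<bar>t\<bar>)) + 2 * exp (\<delta> * \<bar>t\<bar>)) + exp (\<delta> * \<bar>t\<bar>)"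
        unfolding R_def using k(2)[of t] c(2) e1 by (intro add_mono mult_left_mono) auto
      then show ?thesis by (simp add: algebra_simps)
    qed
    then show ?thesis by blast
  qed
  have B_growth: "\<exists>T. \<forall>t\<ge>T. t > 0 \<longrightarrow> (\<forall>x\<in>B (wiener_shift (- t) \<omega>). norm x \<le> exp (\<epsilon> * t))" if \<omega>: "\<omega> \<in> \<Omega>" for \<omega>
  proof -
    obtain k where k: "\<And>t. R (wiener_shift t \<omega>) + 1 \<le> k * exp (\<epsilon> / 2 * \<bar>t\<bar>)"
      using R_growth[OF \<omega>, of "\<epsilon> / 2"] c(1) by auto
    have "norm x \<le> exp (\<epsilon> * t)" if t: "t \<ge> 2 / \<epsilon> * k" "t > 0" and x: "x \<in> B (wiener_shift (- t) \<omega>)" for t x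
    proof -
      have "k \<le> \<epsilon> / 2 * t" using t c(1) by (simp add: field_simps)
      also have "\<dots> \<le> exp (\<epsilon> / 2 * t)" using exp_ge_add_one_self[of "\<epsilon> / 2 * t"] by linarith
      finally have ke: "k \<le> exp (\<epsilon> / 2 * t)" .
      have "norm x \<le> k * exp (\<epsilon> / 2 * t)" using x k[of "- t"] t unfolding B_def by auto
      also have "\<dots> \<le> exp (\<epsilon> / 2 * t) * exp (\<epsilon> / 2 * t)" using ke by (intro mult_right_mono) auto
      also have "\<dots> = exp (\<epsilon> * t)" by (simp add: mult_exp_exp)
      finally show ?thesis .
    qed
    then show ?thesis by (intro exI[of _ "2 / \<epsilon> * k"]) blast
  qed
  have B_sub: "B \<omega> \<subseteq> Cmu \<mu>" for \<omega> unfolding B_def by blast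
  interpret ac: absorbing_cocycle wiener_shift \<Omega> flow "Cmu \<mu>" B B0 "\<mu> + 1"
  proof
    fix \<omega> assume \<omega>: "\<omega> \<in> \<Omega>"
    show "wiener_shift t \<omega> \<in> \<Omega>" for t by (rule shift[OF \<omega>])
    show "wiener_shift 0 \<omega> = \<omega>" by (rule wiener_shift_0[OF C0[OF \<omega>]])
    show "wiener_shift s (wiener_shift t \<omega>) = wiener_shift (s + t) \<omega>" for s t by (rule wiener_shift_shift)
    show "flow t \<omega> x \<in> Cmu \<mu>" if "t \<ge> 0" "x \<in> Cmu \<mu>" for t x by (rule flow_in_Cmu[OF C0[OF \<omega>] that(2,1)])
    show "flow (t + s) \<omega> x = flow t (wiener_shift s \<omega>) (flow s \<omega> x)" if "s \<ge> 0" "t \<ge> 0" "x \<in> Cmu \<mu>" for s t x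
      by (rule flow_cocycle[OF C0[OF \<omega>] that(3,1,2)])
    show "continuous_on (Cmu \<mu>) (flow t \<omega>)" if "t \<ge> 0" for t by (rule flow_continuous[OF C0[OF \<omega>] that])
    show "B \<omega> \<noteq> {}" using zero_in_Cmu R_pos[OF \<omega>] unfolding B_def by (auto intro!: exI[of _ 0])
    show "B \<omega> \<subseteq> Cmu \<mu>" by (rule B_sub)
    have "B0 \<omega> = Cmu \<mu> \<inter> cball 0 (R \<omega>)" by (auto simp: B0_def)
    then show "closed (B0 \<omega>)" by (simp add: closed_Int closed_Cmu)
    show "B0 \<omega> \<subseteq> B \<omega>" unfolding B0_def B_def by auto
    show "compact (closure (flow (\<mu> + 1) \<omega> ` B \<omega>))"
      by (rule flow_maps_bounded_to_precompact[OF C0[OF \<omega>], of _ _ "R \<omega> + 1"]) (auto simp: B_def)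
    show "\<exists>T. \<forall>t\<ge>T. t \<ge> 0 \<longrightarrow> flow t (wiener_shift (- t) \<omega>) ` B (wiener_shift (- t) \<omega>) \<subseteq> B0 \<omega>"
      by (rule absorb[OF \<omega> B_sub B_growth[OF \<omega>]])
  qed (use closed_Cmu mu in auto)
  have measurable_dist: "(\<lambda>\<omega>. INF x\<in>ac.attractor \<omega>. norm (x - y)) \<in> borel_measurable (path_sigma \<Omega>)" for y
  proof (rule borel_measurable_LIMSEQ_real)
    show "(\<lambda>n. INF b\<in>B (wiener_shift (- real n) \<omega>). dist (flow (real n) (wiener_shift (- real n) \<omega>) b) y)
        \<longlonglongrightarrow> (INF x\<in>ac.attractor \<omega>. norm (x - y))" if "\<omega> \<in> space (path_sigma \<Omega>)" for \<omega>
      using ac.attractor_distance_limit[of \<omega> y] that unfolding space_path_sigma[OF \<Omega>] by (simp add: dist_norm)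
    fix n :: nat
    show "(\<lambda>\<omega>. INF b\<in>B (wiener_shift (- real n) \<omega>). dist (flow (real n) (wiener_shift (- real n) \<omega>) b) y)
        \<in> borel_measurable (path_sigma \<Omega>)"
      unfolding borel_measurable_iff_less space_path_sigma[OF \<Omega>]
    proof
      fix a :: real
      have iff: "(INF b\<in>B (wiener_shift (- real n) \<omega>). dist (flow (real n) (wiener_shift (- real n) \<omega>) b) y)
          < a \<longleftrightarrow>
        (\<exists>x\<in>Cmu \<mu>. \<exists>s\<le>0. norm x < c * (2 * (exp (\<epsilon> * s) * norm (wiener_shift (- real n) \<omega> s)) + 2) + 1 \<and>
          norm (flow (real n) (wiener_shift (- real n) \<omega>) x - y) < a)" if \<omega>: "\<omega> \<in> \<Omega>" for \<omega>
      proof -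
        define \<eta> where "\<eta> = wiener_shift (- real n) \<omega>"
        have \<eta>: "\<eta> \<in> \<Omega>" unfolding \<eta>_def by (rule shift[OF \<omega>])
        \<comment> \<open>The supremum in the radius becomes an existential quantifier.\<close>
        have radius: "norm x < R \<eta> + 1 \<longleftrightarrow> (\<exists>s\<le>0. norm x < c * (2 * (exp (\<epsilon> * s) * norm (\<eta> s)) + 2) + 1)"
            for x :: "real \<Rightarrow>\<^sub>C 'h"
        proof -
          have lin: "norm x < c * (2 * m + 2) + 1 \<longleftrightarrow> ((norm x - 1) / c - 2) / 2 < m" for m
            using c(2) by (simp add: field_simps)
          have "norm x < R \<eta> + 1 \<longleftrightarrow> ((norm x - 1) / c - 2) / 2 < (SUP s\<in>{..0}. exp (\<epsilon> * s) * norm (\<eta> s))"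
            unfolding R_def lin peak_def ..
          also have "\<dots> \<longleftrightarrow> (\<exists>s\<in>{..0}. ((norm x - 1) / c - 2) / 2 < exp (\<epsilon> * s) * norm (\<eta> s))"
            by (rule less_cSUP_iff[OF _ peak_bdd[OF sub[OF \<eta>] c(1)]]) auto
          finally show ?thesis unfolding lin by auto
        qed
        have "(INF b\<in>B \<eta>. dist (flow (real n) \<eta> b) y) < a \<longleftrightarrow> (\<exists>b\<in>B \<eta>. dist (flow (real n) \<eta> b) y < a)"
          by (rule cINF_less_iff[OF ac.B(1)[OF \<eta>]]) (auto intro: bdd_belowI[of _ 0])
        also have "\<dots> \<longleftrightarrow> (\<exists>x\<in>Cmu \<mu>. \<exists>s\<le>0. norm x < c * (2 * (exp (\<epsilon> * s) * norm (\<eta> s)) + 2) + 1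
            \<and> norm (flow (real n) \<eta> x - y) < a)"
          using radius unfolding B_def dist_norm by blast
        finally show ?thesis unfolding \<eta>_def .
      qed
      have "{\<omega> \<in> \<Omega>. (INF b\<in>B (wiener_shift (- real n) \<omega>). dist (flow (real n) (wiener_shift (- real n) \<omega>) b)
          y) < a}
        = \<Omega> \<inter> {\<omega> \<in> C0. \<exists>x\<in>Cmu \<mu>. \<exists>s\<le>0.
          norm x < c * (2 * (exp (\<epsilon> * s) * norm (wiener_shift (- real n) \<omega> s)) + 2) + 1 \<and>
          norm (flow (real n) (wiener_shift (- real n) \<omega>) x - y) < a}"
        using iff \<Omega> by blast
      then show "{\<omega> \<in> \<Omega>. (INF b\<in>B (wiener_shift (- real n) \<omega>). dist (flow (real n) (wiener_shift (- real n)
          \<omega>) b) y) < a}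
          \<in> sets (path_sigma \<Omega>)"
        using open_in_path_sigma[OF openin_reachable[OF c(1,2)]] by simp
    qed
  qed
  have tempered: "ac.attractor \<in> tempered_families \<mu> \<Omega>"
    unfolding tempered_families_def
  proof (intro CollectI conjI ballI)
    fix \<omega> L assume \<omega>: "\<omega> \<in> \<Omega>" and L: "L \<in> {at_top :: real filter, at_bot}"
    show "((\<lambda>t. log_plus (SUP x\<in>ac.attractor (wiener_shift t \<omega>). ereal (norm x)) / ereal \<bar>t\<bar>) \<longlongrightarrow> 0) L"
    proof (rule log_plus_growth[OF _ _ L])
      show "ac.attractor (wiener_shift t \<omega>) \<noteq> {}" for t by (rule ac.attractor_nonempty[OF shift[OF \<omega>]])
      fix \<delta> :: real assume "\<delta> > 0"
      from R_growth[OF \<omega> this] obtain k where k: "\<And>t. R (wiener_shift t \<omega>) + 1 \<le> k * exp (\<delta> * \<bar>t\<bar>)" by blast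
      have "norm x \<le> k * exp (\<delta> * \<bar>t\<bar>)" if "x \<in> ac.attractor (wiener_shift t \<omega>)" for x t
        using ac.attractor_subset[OF shift[OF \<omega>], of t] that k[of t] unfolding B0_def by force
      then show "\<exists>k. \<forall>t. \<forall>x\<in>ac.attractor (wiener_shift t \<omega>). norm x \<le> k * exp (\<delta> * \<bar>t\<bar>)" by blast
    qed
  qed (use ac.attractor_nonempty ac.attractor_closed ac.attractor_in_X measurable_dist in auto)
  have "random_attractor \<mu> \<Omega> \<phi> ac.attractor"
    unfolding random_attractor_def
  proof (intro conjI ballI allI impI)
    show "ac.attractor \<in> tempered_families \<mu> \<Omega>" by (rule tempered)
    fix \<omega> assume \<omega>: "\<omega> \<in> \<Omega>"
    show "compact (ac.attractor \<omega>)" by (rule ac.attractor_compact[OF \<omega>])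
    show "\<phi> t \<omega> ` ac.attractor \<omega> = ac.attractor (wiener_shift t \<omega>)" if t: "0 \<le> t" for t
    proof -
      have "\<phi> t \<omega> ` ac.attractor \<omega> = flow t \<omega> ` ac.attractor \<omega>"
        using ac.attractor_in_X[OF \<omega>] by (intro image_cong refl \<phi> t \<omega>) blast
      then show ?thesis using ac.attractor_invariant[OF \<omega> t] by simp
    qed
  next
    fix D :: "(real \<Rightarrow> 'u) \<Rightarrow> (real \<Rightarrow>\<^sub>C 'h) set" and \<omega>
    assume D: "D \<in> tempered_families \<mu> \<Omega>" and \<omega>: "\<omega> \<in> \<Omega>"
    note DD = tempered_familiesD[OF D]
    have absorbed: "ac.absorbed D"
      unfolding ac.absorbed_def using DD(2) absorb[OF _ DD(2) DD(3)[OF _ c(1)]] by blast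
    show "((\<lambda>t. hausdorff_semidist (\<phi> t (wiener_shift (- t) \<omega>) ` D (wiener_shift (- t) \<omega>)) (ac.attractor \<omega>))
        \<longlongrightarrow> 0) at_top"
    proof (rule tendsto_0_hausdorff_semidist)
      show "eventually (\<lambda>t. \<phi> t (wiener_shift (- t) \<omega>) ` D (wiener_shift (- t) \<omega>) \<noteq> {}) at_top"
        using DD(1)[OF shift[OF \<omega>]] by simp
      fix e :: real assume "e > 0"
      from ac.attractor_attracts[OF \<omega> absorbed this] obtain T where
        T: "\<forall>t\<ge>T. \<forall>x\<in>D (wiener_shift (- t) \<omega>). \<exists>y\<in>ac.attractor \<omega>. dist (flow t (wiener_shift (- t) \<omega>) x) y <
            e" by blast
      show "eventually (\<lambda>t. \<forall>x\<in>\<phi> t (wiener_shift (- t) \<omega>) ` D (wiener_shift (- t) \<omega>). \<exists>y\<in>ac.attractor \<omega>.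
          norm (x - y) < e) at_top"
        using eventually_ge_at_top[of "max T 0"]
      proof eventually_elim
        case (elim t)
        have "\<phi> t (wiener_shift (- t) \<omega>) x = flow t (wiener_shift (- t) \<omega>) x" if
            "x \<in> D (wiener_shift (- t) \<omega>)" for x
          using elim DD(2)[OF shift[OF \<omega>]] that by (intro \<phi> shift \<omega>) auto
        then show ?case using T elim by (auto simp: dist_norm)
      qed
    qed
  qed
  then show ?thesis by blast
qed

end

section \<open>The random attractor of the stochastic delay equation\<close>

theorem theorem3p11:
  fixes A :: "'h::{real_inner,banach,second_countable_topology} \<Rightarrow> 'h"
    and DA :: "'h set"
    and S :: "real \<Rightarrow> 'h \<Rightarrow>\<^sub>L 'h"
    and Q :: "'u::{real_inner,banach,second_countable_topology} \<Rightarrow>\<^sub>L 'u"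
    and P :: "(real \<Rightarrow> 'u) measure"
    and \<Omega> :: "(real \<Rightarrow> 'u) set"
    and F :: "(real \<Rightarrow>\<^sub>C 'h) \<Rightarrow> 'h"
    and G K :: "(real \<Rightarrow>\<^sub>C 'h) \<Rightarrow> 'u \<Rightarrow>\<^sub>L 'h"
    and \<mu> lam \<beta> \<nu> C\<^sub>F C\<^sub>F' C\<^sub>G C\<^sub>K :: real
  assumes mu: "\<mu> > 0"
    and A_selfadjoint: "selfadjoint_on DA (\<lambda>x. - A x)"
    and A_positive: "strictly_positive_on DA (\<lambda>x. - A x)"
    and A_inverse: "has_compact_inverse DA (\<lambda>x. - A x)"
    and S_analytic: "analytic_semigroup S"
    and S_generator: "generator_graph S = {(x, A x) | x. x \<in> DA}"
    and lam: "lam > 0"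
    and S_estimates: "semigroup_estimates DA A S lam"
    and Q: "trace_class_covariance Q"
    and P: "wiener_measure Q P"
    and beta: "0 < \<beta>" "\<beta> < 1 / 2"
    and Omega: "admissible_paths \<beta> P \<Omega>"
    and F_lipschitz: "\<exists>L. L-lipschitz_on (Cmu \<mu>) F"
    and F_growth: "C\<^sub>F' \<ge> 0" "C\<^sub>F > 0" "\<And>x. x \<in> Cmu \<mu> \<Longrightarrow> norm (F x) \<le> C\<^sub>F' + C\<^sub>F * norm x"
    and nu: "0 < \<nu>" "\<nu> < 1"
    and G_into: "\<And>x. x \<in> Cmu \<mu> \<Longrightarrow> bounded_into_frac DA (\<lambda>x. - A x) \<nu> (G x)"
    and G_lipschitz: "\<exists>L. \<forall>x\<in>Cmu \<mu>. \<forall>y\<in>Cmu \<mu>.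
          frac_opnorm DA (\<lambda>x. - A x) \<nu> (G x - G y) \<le> L * norm (x - y)"
    and G_bound: "\<And>x. x \<in> Cmu \<mu> \<Longrightarrow> frac_opnorm DA (\<lambda>x. - A x) \<nu> (G x) \<le> C\<^sub>G"
    and K_lipschitz: "\<exists>L. L-lipschitz_on (Cmu \<mu>) K"
    and K_bound: "\<And>x. x \<in> Cmu \<mu> \<Longrightarrow> norm (K x) \<le> C\<^sub>K"
    and G_derivative: "\<And>T u. T > 0 \<Longrightarrow> continuous_on {- \<mu>..T} u \<Longrightarrow>
          (\<forall>t\<in>{0..T}. ((\<lambda>r. G (hist \<mu> u r)) has_vector_derivative K (hist \<mu> u t))
             (at t within {0..T})) \<and>
          continuous_on {0..T} (\<lambda>t. K (hist \<mu> u t))"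
    and mu_small: "\<mu> < 1 / lam * ln (lam / C\<^sub>F)"
  shows "\<exists>\<A>. random_attractor \<mu> \<Omega> (mild_flow \<mu> A S F G K) \<A>"
proof -
  obtain S' where S': "smooth_semigroup S S'" using analytic_semigroup_smooth[OF S_analytic] by blast
  interpret dissipative_semigroup S S' A DA lam
    by (rule dissipative_semigroup.intro[OF S']) (unfold_locales; fact)
  obtain L\<^sub>F where L\<^sub>F: "L\<^sub>F-lipschitz_on (Cmu \<mu>) F" using F_lipschitz by blast
  obtain L\<^sub>G where L\<^sub>G: "\<And>x y. x \<in> Cmu \<mu> \<Longrightarrow> y \<in> Cmu \<mu> \<Longrightarrow> frac_opnorm DA (\<lambda>x. - A x) \<nu> (G x - G y)
      \<le> L\<^sub>G * norm (x - y)"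
    using G_lipschitz by blast
  obtain L\<^sub>K where L\<^sub>K: "L\<^sub>K-lipschitz_on (Cmu \<mu>) K" using K_lipschitz by blast
  \<comment> \<open>The norm of \<open>D((-A)\<^sup>\<nu>)\<close> dominates \<open>d\<close> times the norm of \<open>H\<close>, by \<open>norm_le_fpow\<close>.\<close>
  define d where "d = 1 - exp (- lam)"
  have d: "0 < d" "d \<le> 1" using lam by (auto simp: d_def)
  define C where "C = max C\<^sub>F' (max C\<^sub>K (\<bar>C\<^sub>G\<bar> / d))"
  define L where "L = max L\<^sub>F (max L\<^sub>K (\<bar>L\<^sub>G\<bar> / d))"
  have C0: "C \<ge> 0" using F_growth(1) by (simp add: C_def)
  have L0: "L \<ge> 0" using lipschitz_on_nonneg[OF L\<^sub>F] by (simp add: L_def)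
  have div_d: "\<bar>b\<bar> \<le> \<bar>b\<bar> / d" for b :: real
    using divide_left_mono[OF d(2), of "\<bar>b\<bar>"] d by simp
  have C_G: "\<bar>C\<^sub>G\<bar> / d \<le> C" "\<bar>C\<^sub>G\<bar> \<le> C" using div_d[of C\<^sub>G] by (auto simp: C_def)
  have L_G: "\<bar>L\<^sub>G\<bar> / d \<le> L" "\<bar>L\<^sub>G\<bar> \<le> L" using div_d[of L\<^sub>G] by (auto simp: L_def)
  have into: "G x v \<in> fdom \<nu>" "norm (fpow \<nu> (G x v)) \<le> \<bar>C\<^sub>G\<bar> * norm v" if x: "x \<in> Cmu \<mu>" for x v
  proof -
    show "G x v \<in> fdom \<nu>" using G_into[OF x] unfolding bounded_into_frac_def by blast
    have "bounded_linear (\<lambda>v. fpow \<nu> (G x v))" using G_into[OF x] unfolding bounded_into_frac_def by blast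
    from onorm[OF this, of v] have "norm (fpow \<nu> (G x v)) \<le> frac_opnorm DA (\<lambda>x. - A x) \<nu> (G x) * norm v"
      unfolding frac_opnorm_def .
    also have "\<dots> \<le> \<bar>C\<^sub>G\<bar> * norm v" using G_bound[OF x] by (intro mult_right_mono) auto
    finally show "norm (fpow \<nu> (G x v)) \<le> \<bar>C\<^sub>G\<bar> * norm v" .
  qed
  have diff: "G x v - G y v \<in> fdom \<nu>" "norm (fpow \<nu> (G x v - G y v)) \<le> \<bar>L\<^sub>G\<bar> * norm (x - y) * norm v"
    if x: "x \<in> Cmu \<mu>" and y: "y \<in> Cmu \<mu>" for x y v
  proof -
    show "G x v - G y v \<in> fdom \<nu>" by (rule frac_pow_diff(1)[OF eigenbasis into(1)[OF x] into(1)[OF y]])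
    have "fpow \<nu> ((G x - G y) w) = fpow \<nu> (G x w) - fpow \<nu> (G y w)" for w
      using frac_pow_diff(2)[OF eigenbasis into(1)[OF x] into(1)[OF y]] by (simp add: blinfun.diff_left)
    moreover have "bounded_linear (\<lambda>w. fpow \<nu> (G x w) - fpow \<nu> (G y w))"
      using G_into[OF x] G_into[OF y] unfolding bounded_into_frac_def by (intro bounded_linear_sub) auto
    ultimately have "bounded_linear (\<lambda>w. fpow \<nu> ((G x - G y) w))" by simp
    from onorm[OF this, of v] have "norm (fpow \<nu> (G x v - G y v))
        \<le> frac_opnorm DA (\<lambda>x. - A x) \<nu> (G x - G y) * norm v"
      unfolding frac_opnorm_def by (simp add: blinfun.diff_left)
    also have "\<dots> \<le> \<bar>L\<^sub>G\<bar> * norm (x - y) * norm v"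
    proof (intro mult_right_mono)
      have "L\<^sub>G * norm (x - y) \<le> \<bar>L\<^sub>G\<bar> * norm (x - y)" by (intro mult_right_mono) auto
      then show "frac_opnorm DA (\<lambda>x. - A x) \<nu> (G x - G y) \<le> \<bar>L\<^sub>G\<bar> * norm (x - y)" using L\<^sub>G[OF x y] by linarith
    qed auto
    finally show "norm (fpow \<nu> (G x v - G y v)) \<le> \<bar>L\<^sub>G\<bar> * norm (x - y) * norm v" .
  qed
  have CF_less: "C\<^sub>F < lam"
  proof (rule ccontr)
    assume "\<not> C\<^sub>F < lam"
    then have "lam / C\<^sub>F \<le> 1" using F_growth(2) by simp
    then have "ln (lam / C\<^sub>F) \<le> 0" using lam F_growth(2) by simp
    then have "1 / lam * ln (lam / C\<^sub>F) \<le> 0" using lam by (intro mult_nonneg_nonpos) auto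
    then show False using mu mu_small by simp
  qed
  interpret delay_equation S S' F G K \<mu> lam \<nu> C L C\<^sub>F
  proof
    show "norm (F x - F y) \<le> L * norm (x - y)" if "x \<in> Cmu \<mu>" "y \<in> Cmu \<mu>" for x y
    proof -
      have "norm (F x - F y) \<le> L\<^sub>F * norm (x - y)" using lipschitz_onD[OF L\<^sub>F that] by (simp add: dist_norm)
      also have "\<dots> \<le> L * norm (x - y)" by (intro mult_right_mono) (auto simp: L_def)
      finally show ?thesis .
    qed
    show "norm (K x - K y) \<le> L * norm (x - y)" if "x \<in> Cmu \<mu>" "y \<in> Cmu \<mu>" for x y
    proof -
      have "norm (K x - K y) \<le> L\<^sub>K * norm (x - y)" using lipschitz_onD[OF L\<^sub>K that] by (simp add: dist_norm)
      also have "\<dots> \<le> L * norm (x - y)" by (intro mult_right_mono) (auto simp: L_def)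
      finally show ?thesis .
    qed
    show "norm (F x) \<le> C + C\<^sub>F * norm x" if "x \<in> Cmu \<mu>" for x
      using F_growth(3)[OF that] by (simp add: C_def)
    show "norm (K x) \<le> C" if "x \<in> Cmu \<mu>" for x using K_bound[OF that] by (simp add: C_def)
    show "norm (S' t (G x v)) \<le> C * t powr (\<nu> - 1) * exp (- lam * t) * norm v" if x: "x \<in> Cmu \<mu>" and t:
        "t > 0" for x t v
    proof -
      have "norm (S' t (G x v)) \<le> t powr (\<nu> - 1) * exp (- lam * t) * norm (fpow \<nu> (G x v))"
        by (rule smoothing[OF into(1)[OF x] nu t])
      also have "\<dots> \<le> t powr (\<nu> - 1) * exp (- lam * t) * (C * norm v)"
        using order_trans[OF into(2)[OF x, of v] mult_right_mono[OF C_G(2) norm_ge_zero]]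
            by (intro mult_left_mono) auto
      finally show ?thesis by (simp add: ac_simps)
    qed
    show "norm (S' t (G x v - G y v)) \<le> L * norm (x - y) * t powr (\<nu> - 1) * norm v"
      if xy: "x \<in> Cmu \<mu>" "y \<in> Cmu \<mu>" and t: "t > 0" for x y t v
    proof -
      have "norm (S' t (G x v - G y v)) \<le> t powr (\<nu> - 1) * exp (- lam * t) * norm (fpow \<nu> (G x v - G y v))"
        by (rule smoothing[OF diff(1)[OF xy] nu t])
      also have "\<dots> \<le> t powr (\<nu> - 1) * 1 * (L * norm (x - y) * norm v)"
      proof (intro mult_mono mult_nonneg_nonneg)
        show "norm (fpow \<nu> (G x v - G y v)) \<le> L * norm (x - y) * norm v"
          by (rule order_trans[OF diff(2)[OF xy, of v]]) (intro mult_right_mono L_G norm_ge_zero)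
      qed (use lam t in auto)
      finally show ?thesis by (simp add: ac_simps)
    qed
    show "norm (G x) \<le> C" if x: "x \<in> Cmu \<mu>" for x
    proof (rule norm_blinfun_bound[OF C0])
      fix v
      have "norm (G x v) \<le> norm (fpow \<nu> (G x v)) / d" unfolding d_def
          by (rule norm_le_fpow[OF into(1)[OF x] nu])
      also have "\<dots> \<le> (\<bar>C\<^sub>G\<bar> * norm v) / d" using into(2)[OF x, of v] d by (intro divide_right_mono) auto
      also have "\<dots> = \<bar>C\<^sub>G\<bar> / d * norm v" by simp
      also have "\<dots> \<le> C * norm v" by (intro mult_right_mono C_G norm_ge_zero)
      finally show "norm (G x v) \<le> C * norm v" .
    qed
    show "norm (G x - G y) \<le> L * norm (x - y)" if xy: "x \<in> Cmu \<mu>" "y \<in> Cmu \<mu>" for x y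
    proof (rule norm_blinfun_bound)
      show "0 \<le> L * norm (x - y)" using L0 by simp
      fix v
      have "norm (G x v - G y v) \<le> norm (fpow \<nu> (G x v - G y v)) / d" unfolding d_def
          by (rule norm_le_fpow[OF diff(1)[OF xy] nu])
      also have "\<dots> \<le> (\<bar>L\<^sub>G\<bar> * norm (x - y) * norm v) / d" using diff(2)[OF xy, of v] d
          by (intro divide_right_mono) auto
      also have "\<dots> = \<bar>L\<^sub>G\<bar> / d * norm (x - y) * norm v" by simp
      also have "\<dots> \<le> L * norm (x - y) * norm v" by (intro mult_right_mono L_G norm_ge_zero)
      finally show "norm ((G x - G y) v) \<le> L * norm (x - y) * norm v" by (simp add: blinfun.diff_left)
    qed
    show "((\<lambda>r. G (hist \<mu> u r)) has_vector_derivative K (hist \<mu> u t)) (at t within {0..T})"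
      if "T > 0" "continuous_on {- \<mu>..T} u" "t \<in> {0..T}" for T u t
      using G_derivative[OF that(1,2)] that(3) by blast
    show "norm (S t) \<le> exp (- lam * t)" if "0 \<le> t" for t using S_norm[OF that] .
    show "compact_operator (S t)" if "0 < t" for t by (rule S_compact[OF that])
  qed (use mu lam nu C0 L0 F_growth CF_less in auto)
  have Omega_C0: "\<Omega> \<subseteq> C0"
    using Omega P sets.sets_into_space[of \<Omega> P] unfolding admissible_paths_def wiener_measure_def by auto
  show ?thesis
  proof (rule random_attractor_exists[OF Omega_C0])
    show "wiener_shift t \<omega> \<in> \<Omega>" if "\<omega> \<in> \<Omega>" for \<omega> t
      using Omega that unfolding admissible_paths_def by blast
    show "subexponential \<omega>" if \<omega>: "\<omega> \<in> \<Omega>" for \<omega>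
    proof -
      have lims: "\<forall>a<0. ((\<lambda>t. (SUP s\<in>{a..0}. norm (wiener_shift t \<omega> s)) / \<bar>t\<bar>) \<longlongrightarrow> 0) at_top \<and>
        ((\<lambda>t. (SUP s\<in>{a..0}. norm (wiener_shift t \<omega> s)) / \<bar>t\<bar>) \<longlongrightarrow> 0) at_bot"
        using Omega \<omega> unfolding admissible_paths_def by blast
      show ?thesis
        using lims[rule_format, of "-1"] C0D(1) Omega_C0 \<omega>
            by (intro sublinear_increments_imp_subexponential) auto
    qed
    show "mild_flow \<mu> A S F G K t \<omega> \<xi> = flow t \<omega> \<xi>" if "t \<ge> 0" "\<omega> \<in> \<Omega>" "\<xi> \<in> Cmu \<mu>" for t \<omega> \<xi>
      using that Omega_C0 by (intro mild_flow_eq_flow A_S(2)) auto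
  qed
qed

end
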